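(* If there exists a polynomial $t$ such that $K^t$ is mildly hard-on-average, then for every constant $d$ there exists a polynomial $t'$ such that $K^{t'}$ is mildly hard-on-average to $(d\log n)$-approximate.
   Context: Fix a universal Turing machine $U$ that emulates any Turing machine with polynomial overhead. A description $\Pi\in\{0,1\}^*$ encodes a pair $(M,w)$ of a single-tape Turing machine $M$ and an input $w$; $U(\Pi,1^t)$ denotes the output of $M(w)$ emulated on $U$ for $t$ steps. $K^t(x)=\min\{|\Pi| : U(\Pi,1^{t(|x|)})=x\}$. A function $f$ is $\alpha$-hard-on-average if for every probabilistic polynomial-time (PPT) heuristic $H$ and all sufficiently large $n$, $\Pr[x\leftarrow\{0,1\}^n: H(x)=f(x)]<1-\alpha(n)$; it is $\alpha$-hard-on-average to $\beta$-approximate if for every PPT $H$ and all sufficiently large $n$, $\Pr[x\leftarrow\{0,1\}^n: |H(x)-f(x)|\leq\beta(|x|)]<1-\alpha(n)$. "Mildly" means this holds with $\alpha=1/p$ for some polynomial $p>0$. *)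

theory Defs
  imports
    "HOL-Probability.Probability"
    "HOL-Computational_Algebra.Polynomial"
begin

datatype move = MoveL | MoveR | Stay

text \<open>
  A machine is its transition table: row \<open>q\<close>, column \<open>s\<close> holds (new state, written symbol,
  head move). The row indices are the non-halting states, \<open>0\<close> is the start state and the number
  of rows is the halting state. Tape symbols are the column indices, where \<open>0\<close> is the blank and
  \<open>1\<close>, \<open>2\<close> stand for the bits 0 and 1; further work symbols are allowed.
\<close>
type_synonym tm = "(nat \<times> nat \<times> move) list list"

definition tm_shape :: "nat \<Rightarrow> nat \<Rightarrow> tm \<Rightarrow> bool" where
  "tm_shape m k M \<longleftrightarrow> length M = m \<and> m \<ge> 1 \<and> k \<ge> 3 \<and>
     (\<forall>row\<in>set M. length row = k \<and> (\<forall>(q, s, d)\<in>set row. q \<le> m \<and> s < k))"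

definition wf_tm :: "tm \<Rightarrow> bool" where
  "wf_tm M \<longleftrightarrow> (\<exists>m k. tm_shape m k M)"

record config =
  state :: nat
  head :: int
  tape :: "int \<Rightarrow> nat"

definition init_config :: "bool list \<Rightarrow> config" where
  "init_config w = \<lparr>state = 0, head = 0,
     tape = (\<lambda>i. if 0 \<le> i \<and> i < int (length w) then (if w ! nat i then 2 else 1) else 0)\<rparr>"

definition halted :: "tm \<Rightarrow> config \<Rightarrow> bool" where
  "halted M c \<longleftrightarrow> state c \<ge> length M"

fun shift :: "move \<Rightarrow> int" where
  "shift MoveL = -1"
| "shift MoveR = 1"
| "shift Stay = 0"

definition step :: "tm \<Rightarrow> config \<Rightarrow> config" where
  "step M c =
     (if halted M c then c
      else case M ! state c ! tape c (head c) of
        (q, s, d) \<Rightarrow> \<lparr>state = q, head = head c + shift d, tape = (tape c)(head c := s)\<rparr>)"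

text \<open>The output is the longest block of bits that starts in cell \<open>0\<close>.\<close>
definition tape_output :: "config \<Rightarrow> bool list" where
  "tape_output c = map (\<lambda>i. tape c (int i) = 2) [0..<LEAST n. tape c (int n) \<notin> {1, 2}]"

definition tm_result :: "tm \<Rightarrow> bool list \<Rightarrow> nat \<Rightarrow> bool list option" where
  "tm_result M w t = (let c = (step M ^^ t) (init_config w)
     in if halted M c then Some (tape_output c) else None)"

definition polynomial_fun :: "(nat \<Rightarrow> nat) \<Rightarrow> bool" where
  "polynomial_fun t \<longleftrightarrow> (\<exists>p::real poly. \<forall>n. real (t n) = poly p (real n))"

text \<open>
  A probabilistic machine is a pair of transition tables of the same shape; in each step a fair
  coin selects the table that is used.
\<close>
type_synonym ptm = "tm \<times> tm"

definition wf_ptm :: "ptm \<Rightarrow> bool" where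
  "wf_ptm P \<longleftrightarrow> (\<exists>m k. tm_shape m k (fst P) \<and> tm_shape m k (snd P))"

primrec prun :: "ptm \<Rightarrow> nat \<Rightarrow> config \<Rightarrow> config pmf" where
  "prun P 0 c = return_pmf c"
| "prun P (Suc k) c =
     bind_pmf (bernoulli_pmf (1/2)) (\<lambda>b. prun P k (step (if b then snd P else fst P) c))"

text \<open>The polynomial time bound is worst case, over all inputs and all coin tosses.\<close>
definition PPT :: "(bool list \<Rightarrow> bool list pmf) \<Rightarrow> bool" where
  "PPT H \<longleftrightarrow> (\<exists>P q. wf_ptm P \<and> polynomial_fun q \<and>
     (\<forall>x. (\<forall>c\<in>set_pmf (prun P (q (length x)) (init_config x)). halted (fst P) c) \<and>
          H x = map_pmf tape_output (prun P (q (length x)) (init_config x))))"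

text \<open>
  The input pair \<open>(desc, 1\<^sup>t)\<close> is presented to the universal machine as the string
  \<open>1\<^sup>t 0 desc\<close>. The leading bit \<open>True\<close> of its output flags that the emulated machine has halted
  within \<open>t\<close> of its own steps; the rest is the output of that machine. An empty output means
  that it has not, or that \<open>desc\<close> is not a valid description.
\<close>
definition univ_input :: "bool list \<Rightarrow> nat \<Rightarrow> bool list" where
  "univ_input desc t = replicate t True @ False # desc"

definition univ_outputs :: "tm \<Rightarrow> bool list \<Rightarrow> nat \<Rightarrow> bool list \<Rightarrow> bool" where
  "univ_outputs U desc t x \<longleftrightarrow> (\<exists>k. tm_result U (univ_input desc t) k = Some (True # x))"

text \<open>
  \<open>dec\<close> is the description language. For a fixed machine \<open>M\<close> a description of \<open>(M, w)\<close> costs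
  only a constant more than \<open>w\<close> itself, which is what yields \<open>K\<^sup>t(x) \<le> |x| + O(1)\<close>. The
  overhead polynomial \<open>q\<close> is uniform in the emulated machine.
\<close>
definition universal_tm :: "tm \<Rightarrow> bool" where
  "universal_tm U \<longleftrightarrow> wf_tm U \<and>
     (\<exists>dec :: bool list \<Rightarrow> (tm \<times> bool list) option.
        (\<forall>desc M w. dec desc = Some (M, w) \<longrightarrow> wf_tm M) \<and>
        (\<forall>M. wf_tm M \<longrightarrow>
           (\<exists>c. \<forall>w. \<exists>desc. dec desc = Some (M, w) \<and> length desc \<le> length w + c)) \<and>
        (\<exists>q. polynomial_fun q \<and>
           (\<forall>desc t. tm_result U (univ_input desc t) (q (length desc + t)) = Some
              (case dec desc of
                 None \<Rightarrow> []
               | Some (M, w) \<Rightarrow>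
                   (case tm_result M w t of None \<Rightarrow> [] | Some y \<Rightarrow> True # y)))))"

text \<open>
  The set is nonempty whenever \<open>U\<close> is universal and \<open>t (length x) \<ge> 1\<close>; otherwise the value is
  the fixed junk value \<open>Inf {}\<close>.
\<close>
definition Kt :: "tm \<Rightarrow> (nat \<Rightarrow> nat) \<Rightarrow> bool list \<Rightarrow> nat" where
  "Kt U t x = Inf {length desc | desc. univ_outputs U desc (t (length x)) x}"

definition nat_of_bits :: "bool list \<Rightarrow> nat" where
  "nat_of_bits bs = horner_sum of_bool 2 bs"

text \<open>The joint distribution of a uniform \<open>x \<in> {0,1}\<^sup>n\<close> and the number output by \<open>H(x)\<close>.\<close>
definition heuristic_experiment ::
    "(bool list \<Rightarrow> bool list pmf) \<Rightarrow> nat \<Rightarrow> (bool list \<times> nat) pmf" where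
  "heuristic_experiment H n =
     bind_pmf (pmf_of_set {x. length x = n}) (\<lambda>x. map_pmf (\<lambda>y. (x, nat_of_bits y)) (H x))"

definition hard_on_average :: "(nat \<Rightarrow> real) \<Rightarrow> (bool list \<Rightarrow> nat) \<Rightarrow> bool" where
  "hard_on_average \<alpha> f \<longleftrightarrow>
     (\<forall>H. PPT H \<longrightarrow> (\<forall>\<^sub>F n in sequentially.
        measure_pmf.prob (heuristic_experiment H n) {(x, v). v = f x} < 1 - \<alpha> n))"

definition hard_on_average_to_approx ::
    "(nat \<Rightarrow> real) \<Rightarrow> (nat \<Rightarrow> real) \<Rightarrow> (bool list \<Rightarrow> nat) \<Rightarrow> bool" where
  "hard_on_average_to_approx \<alpha> \<beta> f \<longleftrightarrow>
     (\<forall>H. PPT H \<longrightarrow> (\<forall>\<^sub>F n in sequentially.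
        measure_pmf.prob (heuristic_experiment H n)
          {(x, v). \<bar>real v - real (f x)\<bar> \<le> \<beta> (length x)} < 1 - \<alpha> n))"

definition mildly_hard_on_average :: "(bool list \<Rightarrow> nat) \<Rightarrow> bool" where
  "mildly_hard_on_average f \<longleftrightarrow>
     (\<exists>p::real poly. (\<forall>n::nat. poly p (real n) > 0) \<and>
        hard_on_average (\<lambda>n. 1 / poly p (real n)) f)"

definition mildly_hard_on_average_to_approx ::
    "(nat \<Rightarrow> real) \<Rightarrow> (bool list \<Rightarrow> nat) \<Rightarrow> bool" where
  "mildly_hard_on_average_to_approx \<beta> f \<longleftrightarrow>
     (\<exists>p::real poly. (\<forall>n::nat. poly p (real n) > 0) \<and>
        hard_on_average_to_approx (\<lambda>n. 1 / poly p (real n)) \<beta> f)"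

end

theory Submission imports Defs begin

text \<open>
  Exact values of \<open>K\<^sup>t\<close> are recovered from approximate values of \<open>K\<^bsup>t'\<^esup>\<close>. For a uniform \<open>x\<close> of
  length \<open>n\<close>, let \<open>w\<close> be a shortest description of \<open>x\<close>, padded to \<open>L = n + O(1)\<close> bits. Consider
  strings \<open>(x, z, r)\<close> with \<open>z\<close> a sequence of \<open>L\<close> columns of \<open>k = O(log n)\<close> bits and \<open>r\<close> of \<open>k\<close> bits.
  If \<open>r\<close> is the sum of the columns selected by \<open>w\<close>, then the string is determined by \<open>w\<close> and \<open>z\<close> and
  \<open>K\<^bsup>t'\<^esup>\<close> is smaller by almost \<open>k\<close> than for a random string. Such strings have density \<open>2\<^sup>-\<^sup>k\<close>, which is
  inverse polynomial, so a heuristic that approximates \<open>K\<^bsup>t'\<^esup>\<close> up to \<open>d log n\<close> with a small enough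
  polynomial error probability still separates the two kinds for most \<open>x\<close>.

  The search draws \<open>z\<close>, \<open>r\<close> and a further column \<open>a\<close> and bets that \<open>r\<close> is the selected sum. It reads
  off bit \<open>i\<close> of \<open>w\<close> by replacing column \<open>i\<close> by \<open>a\<close>: if the bit is 0, the string remains of the
  compressible kind, and if it is 1, the string becomes uniformly random, because column \<open>i\<close> alone
  makes \<open>r\<close> uniform. The bet succeeds with probability \<open>2\<^sup>-\<^sup>k\<close> and candidates are verified with the universal
  machine, so polynomially many trials find a shortest description.
\<close>

section \<open>Stack programs and their compilation\<close>

text \<open>The approximating heuristic is only known to succeed at infinitely many lengths
  \<open>N\<close>, which need not be lengths of strings \<open>(x, z, r)\<close>. So every query
  carries random padding up to length \<open>N\<close>, with \<open>n\<close> a power of two such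
  that \<open>N\<close> lies between the query lengths for \<open>n\<close> and
  \<open>2 * n\<close>; the search cannot know \<open>N\<close> and tries all paddings. Wrong
  guesses are harmless because candidates are verified: the search errs only by missing a shortest
  description. A power of two costs only about \<open>log n\<close> bits, written
  \<open>1...10\<close>; the gap of \<open>k\<close> bits has to absorb this header, the machine
  constants, the deficiency allowed to random strings and twice the approximation error. Padding
  descriptions to \<open>L\<close> bits makes the number of columns independent of the unknown
  value. Verification needs \<open>t n\<close> itself and not just a bound, hence the exact
  evaluation of polynomials. Since \<open>t'\<close> precedes the heuristic, \<open>k\<close> and
  \<open>t'\<close> are fixed first; among the parameters of the search only the number of random
  bits per trial depends on the running time of the heuristic.\<close>

type_synonym store = "nat \<Rightarrow> nat list"

datatype com = Skip | Push nat nat | Seq com com | IfPop nat nat com com | While nat com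

text \<open>The step counts leave room for the jumps of the compiled code.\<close>
inductive run :: "com \<Rightarrow> store \<Rightarrow> nat \<Rightarrow> store \<Rightarrow> bool" where
  run_Skip: "run Skip s 0 s"
| run_Push: "run (Push v a) s 1 (s(v := a # s v))"
| run_Seq: "run c s i s1 \<Longrightarrow> run d s1 j s2 \<Longrightarrow> run (Seq c d) s (i + j) s2"
| run_Pop: "s v = a # xs \<Longrightarrow> run c (s(v := xs)) i s1 \<Longrightarrow> run (IfPop v a c d) s (2 + i) s1"
| run_NoPop: "(\<And>xs. s v \<noteq> a # xs) \<Longrightarrow> run d s i s1 \<Longrightarrow> run (IfPop v a c d) s (2 + i) s1"
| run_Done: "s v = [] \<Longrightarrow> run (While v c) s 1 s"
| run_Loop: "s v \<noteq> [] \<Longrightarrow> run c s i s1 \<Longrightarrow> run (While v c) s1 j s2 \<Longrightarrow>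
    run (While v c) s (2 + i + j) s2"

fun regs :: "com \<Rightarrow> nat set" where
  "regs Skip = {}"
| "regs (Push v a) = {v}"
| "regs (Seq c d) = regs c \<union> regs d"
| "regs (IfPop v a c d) = insert v (regs c \<union> regs d)"
| "regs (While v c) = insert v (regs c)"

text \<open>Symbol 0 is excluded because on the tape it marks a cell of a track that holds
  nothing.\<close>

fun coms :: "nat \<Rightarrow> com \<Rightarrow> bool" where
  "coms K Skip \<longleftrightarrow> True"
| "coms K (Push v a) \<longleftrightarrow> 1 \<le> a \<and> a \<le> K"
| "coms K (Seq c d) \<longleftrightarrow> coms K c \<and> coms K d"
| "coms K (IfPop v a c d) \<longleftrightarrow> 1 \<le> a \<and> a \<le> K \<and> coms K c \<and> coms K d"
| "coms K (While v c) \<longleftrightarrow> coms K c"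

section \<open>Several registers on the tracks of one tape\<close>

fun code :: "nat \<Rightarrow> nat list \<Rightarrow> nat" where
  "code B [] = 0"
| "code B (d # ds) = d + B * code B ds"

fun digs :: "nat \<Rightarrow> nat \<Rightarrow> nat \<Rightarrow> nat list" where
  "digs B 0 n = []"
| "digs B (Suc V) n = n mod B # digs B V (n div B)"

lemma length_digs [simp]: "length (digs B V n) = V"
  by (induction V arbitrary: n) auto

lemma digs_code: "set ds \<subseteq> {..<B} \<Longrightarrow> digs B (length ds) (code B ds) = ds"
  by (induction ds) auto

lemma code_less: "set ds \<subseteq> {..<B} \<Longrightarrow> code B ds < B ^ length ds"
proof (induction ds)
  case (Cons d ds)
  then have "code B ds + 1 \<le> B ^ length ds" and "d < B" by auto
  then have "d + B * code B ds < B * (code B ds + 1)" by simp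
  also have "\<dots> \<le> B * B ^ length ds"
    using \<open>code B ds + 1 \<le> _\<close> by (rule mult_le_mono2)
  finally show ?case by simp
qed simp

lemma set_digs: "B > 0 \<Longrightarrow> set (digs B V n) \<subseteq> {..<B}"
  by (induction V arbitrary: n) auto

lemma code_zeros [simp]: "code B (replicate n 0) = 0"
  by (induction n) auto

lemma code_eq_0_iff: "B > 0 \<Longrightarrow> code B ds = 0 \<longleftrightarrow> (\<forall>d\<in>set ds. d = 0)"
  by (induction ds) auto

definition track :: "nat list \<Rightarrow> nat \<Rightarrow> nat" where
  "track xs i = (if i < length xs then rev xs ! i else 0)"

lemma track_Cons: "track (a # xs) i = (if i = length xs then a else track xs i)"
  by (auto simp: track_def nth_append)

lemma track_length [simp]: "track xs (length xs) = 0"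
  by (simp add: track_def)

lemma track_in: "set xs \<subseteq> {1..K} \<Longrightarrow> i < length xs \<Longrightarrow> track xs i \<in> {1..K}"
  unfolding track_def by (metis length_rev nth_mem set_rev subsetD)

definition pstep :: "ptm \<Rightarrow> config \<Rightarrow> bool \<Rightarrow> config" where
  "pstep P c b = step (if b then snd P else fst P) c"

text \<open>Independence of the coins is built in: every coin string of length \<open>T\<close>
  leads to \<open>c'\<close>. Code that both tables share can thus be verified once, and equal
  tables give the deterministic machines.\<close>

definition reach :: "ptm \<Rightarrow> nat \<Rightarrow> config \<Rightarrow> config \<Rightarrow> bool" where
  "reach P T c c' \<longleftrightarrow> (\<forall>w. length w = T \<longrightarrow> foldl (pstep P) c w = c')"

lemma reach_0 [simp]: "reach P 0 c c' \<longleftrightarrow> c = c'"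
  by (simp add: reach_def)

lemma reach_trans: "reach P i c c1 \<Longrightarrow> reach P j c1 c2 \<Longrightarrow> reach P (i + j) c c2"
  unfolding reach_def
proof (intro allI impI)
  fix w :: "bool list"
  assume *: "\<forall>w. length w = i \<longrightarrow> foldl (pstep P) c w = c1" "\<forall>w. length w = j \<longrightarrow> foldl (pstep P) c1 w = c2"
    and "length w = i + j"
  then have "foldl (pstep P) c (take i w @ drop i w) = c2"
    unfolding foldl_append by simp
  then show "foldl (pstep P) c w = c2" by simp
qed

lemma reach_1: "step (fst P) c = c' \<Longrightarrow> step (snd P) c = c' \<Longrightarrow> reach P 1 c c'"
  by (auto simp: reach_def pstep_def length_Suc_conv)

text \<open>
  Register \<open>v\<close> is kept on track \<open>v\<close> of the tape: a tape symbol is the number with base \<open>K + 1\<close> digits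
  given by the tracks, and the head of the list is the rightmost cell. The head of the machine rests
  at cell 0 and finds its way back because every cell left of a nonempty one is nonblank, up to the
  blank cell \<open>-1\<close>. If only register 0 is nonempty and holds bits, coded as 1 and 2, then the tape is
  precisely the input or output tape of a machine.
\<close>
locale tracks =
  fixes K V :: nat
  assumes K2: "2 \<le> K" and V1: "1 \<le> V"
begin

abbreviation "B \<equiv> Suc K"
abbreviation "A \<equiv> B ^ V"
abbreviation "enc_sym \<equiv> code B"
abbreviation "dec_sym \<equiv> digs B V"

definition tp :: "store \<Rightarrow> int \<Rightarrow> nat" where
  "tp s i = (if i < 0 then 0 else enc_sym (map (\<lambda>v. track (s v) (nat i)) [0..<V]))"

definition conf :: "nat \<Rightarrow> int \<Rightarrow> store \<Rightarrow> config" where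
  "conf q h s = \<lparr>state = q, head = h, tape = tp s\<rparr>"

definition row :: "(nat \<Rightarrow> nat \<times> nat \<times> move) \<Rightarrow> (nat \<times> nat \<times> move) list" where
  "row f = map f [0..<A]"

definition wr :: "nat \<Rightarrow> nat \<Rightarrow> nat \<Rightarrow> nat" where
  "wr v a x = enc_sym ((dec_sym x)[v := a])"

definition scan_right :: "nat \<Rightarrow> nat \<Rightarrow> (nat \<Rightarrow> nat \<times> nat \<times> move) \<Rightarrow> nat \<Rightarrow> nat \<times> nat \<times> move" where
  "scan_right p v f x = (if dec_sym x ! v \<noteq> 0 then (p, x, MoveR) else f x)"

definition go_home :: "nat \<Rightarrow> nat \<Rightarrow> nat \<Rightarrow> nat \<times> nat \<times> move" where
  "go_home p q x = (if x \<noteq> 0 then (p, x, MoveL) else (q, x, MoveR))"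

fun clen :: "com \<Rightarrow> nat" where
  "clen Skip = 0"
| "clen (Push v a) = 2"
| "clen (Seq c d) = clen c + clen d"
| "clen (IfPop v a c d) = 5 + clen c + clen d"
| "clen (While v c) = 2 + clen c"

text \<open>The outcome of a pop must survive the walk home, so the two outcomes use separate
  \<open>go_home\<close> states, \<open>p + 2\<close> and \<open>p + 3\<close>. A single jump row
  after the first branch skips the second one. \<open>While\<close> inspects only cell 0 of its
  track, which is nonzero exactly when the register is nonempty.\<close>

fun compile :: "nat \<Rightarrow> com \<Rightarrow> tm" where
  "compile p Skip = []"
| "compile p (Push v a) =
    [row (scan_right p v (\<lambda>x. (p + 1, wr v a x, MoveL))), row (go_home (p + 1) (p + 2))]"
| "compile p (Seq c d) = compile p c @ compile (p + clen c) d"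
| "compile p (IfPop v a c d) =
    [row (scan_right p v (\<lambda>x. (p + 1, x, MoveL))),
     row (\<lambda>x. if dec_sym x ! v = a then (p + 2, wr v 0 x, MoveL) else (p + 3, x, Stay)),
     row (go_home (p + 2) (p + 4)),
     row (go_home (p + 3) (p + 5 + clen c))]
    @ compile (p + 4) c @ [row (\<lambda>x. (p + 5 + clen c + clen d, x, Stay))]
    @ compile (p + 5 + clen c) d"
| "compile p (While v c) =
    [row (\<lambda>x. (if dec_sym x ! v \<noteq> 0 then p + 1 else p + 2 + clen c, x, Stay))]
    @ compile (p + 1) c @ [row (\<lambda>x. (p, x, Stay))]"

lemma length_compile [simp]: "length (compile p c) = clen c"
  by (induction c arbitrary: p) auto

definition code_at :: "tm \<Rightarrow> nat \<Rightarrow> tm \<Rightarrow> bool" where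
  "code_at M p rs \<longleftrightarrow> (\<exists>xs ys. M = xs @ rs @ ys \<and> length xs = p)"

lemma code_at_append: "code_at M p (rs @ rs') \<longleftrightarrow> code_at M p rs \<and> code_at M (p + length rs) rs'"
  (is "?l \<longleftrightarrow> ?r")
proof
  assume ?l
  then obtain xs ys where "M = xs @ (rs @ rs') @ ys" "length xs = p" by (auto simp: code_at_def)
  then have "M = xs @ rs @ (rs' @ ys)" "M = (xs @ rs) @ rs' @ ys" "length (xs @ rs) = p + length rs"
    by simp_all
  then show ?r using \<open>length xs = p\<close> unfolding code_at_def by blast
next
  assume ?r
  then obtain xs ys where "M = xs @ rs @ ys" "length xs = p" unfolding code_at_def by blast
  moreover from \<open>?r\<close> obtain xs' ys' where "M = xs' @ rs' @ ys'" "length xs' = p + length rs"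
    unfolding code_at_def by blast
  ultimately have M: "M = xs @ rs @ ys" "length xs = p" "M = xs' @ rs' @ ys'" "length xs' = p + length rs"
    by simp_all
  then have "(xs @ rs) @ ys = xs' @ rs' @ ys'" "length (xs @ rs) = length xs'" by simp_all
  then have "ys = rs' @ ys'" using append_eq_append_conv by blast
  then have "M = xs @ (rs @ rs') @ ys'" using M(1) by simp
  then show ?l using M(2) unfolding code_at_def by blast
qed

lemma code_at_Cons: "code_at M p (r # rs) \<longleftrightarrow> (p < length M \<and> M ! p = r) \<and> code_at M (Suc p) rs"
proof -
  have "code_at M p [r] \<longleftrightarrow> p < length M \<and> M ! p = r"
  proof
    assume "p < length M \<and> M ! p = r"
    then have "M = take p M @ [r] @ drop (Suc p) M" "length (take p M) = p"
      using id_take_nth_drop[of p M] by auto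
    then show "code_at M p [r]" unfolding code_at_def by blast
  qed (auto simp: code_at_def nth_append)
  then show ?thesis using code_at_append[of M p "[r]" rs] by simp
qed

lemma step_row:
  assumes "p < length M" "M ! p = row f" "T h < A" "f (T h) = (q, a, d)"
  shows "step M \<lparr>state = p, head = h, tape = T\<rparr> = \<lparr>state = q, head = h + shift d, tape = T(h := a)\<rparr>"
  using assms by (simp add: step_def halted_def row_def)

definition valid :: "store \<Rightarrow> bool" where
  "valid s \<longleftrightarrow> (\<forall>v<V. set (s v) \<subseteq> {1..K})"

lemma validD: "valid s \<Longrightarrow> v < V \<Longrightarrow> set (s v) \<subseteq> {1..K}"
  by (simp add: valid_def)

lemma track_less: "valid s \<Longrightarrow> v < V \<Longrightarrow> track (s v) i < B"
  using track_in[of "s v" K i] by (cases "i < length (s v)") (auto simp: valid_def track_def)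

lemma symbols_less: "valid s \<Longrightarrow> set (map (\<lambda>v. track (s v) i) [0..<V]) \<subseteq> {..<B}"
  using track_less by auto

lemma tp_less: "valid s \<Longrightarrow> tp s i < A"
  using code_less[OF symbols_less, of s "nat i"] by (simp add: tp_def)

lemma dec_tp: "valid s \<Longrightarrow> i \<ge> 0 \<Longrightarrow> dec_sym (tp s i) = map (\<lambda>v. track (s v) (nat i)) [0..<V]"
  using digs_code[OF symbols_less, of s "nat i"] by (simp add: tp_def)

lemma dec_zero: "v < V \<Longrightarrow> dec_sym 0 ! v = 0"
  using digs_code[of "replicate V 0" B] by (simp)

lemma dec_tp_nth:
  assumes "valid s" "v < V"
  shows "dec_sym (tp s i) ! v = (if i < 0 then 0 else track (s v) (nat i))"
proof (cases "i < 0")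
  case True
  then have "tp s i = 0" by (simp add: tp_def)
  then show ?thesis using True assms dec_zero by simp
qed (use assms in \<open>simp add: dec_tp\<close>)

lemma tp_nonzero:
  assumes "valid s" "v < V" "i < length (s v)"
  shows "tp s (int i) \<noteq> 0"
proof -
  have "track (s v) i \<noteq> 0" using track_in[of "s v" K i] assms by (auto simp: valid_def)
  then show ?thesis using assms(2) by (auto simp: tp_def code_eq_0_iff)
qed

text \<open>Stated for any \<open>ys\<close> that differs from the register in cell \<open>l\<close>
  only, so that it covers pushing as well as popping.\<close>

lemma tp_update:
  assumes "valid s" "v < V"
    and "\<And>i. track ys i = (if i = l then a else track (s v) i)"
  shows "(tp s)(int l := wr v a (tp s (int l))) = tp (s(v := ys))"
proof
  fix i
  have now: "(map (\<lambda>u. track (s u) l) [0..<V])[v := a] = map (\<lambda>u. track ((s(v := ys)) u) l) [0..<V]"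
    using assms(2) by (auto simp: list_eq_iff_nth_eq nth_list_update assms(3))
  have other: "map (\<lambda>u. track (s u) (nat i)) [0..<V] = map (\<lambda>u. track ((s(v := ys)) u) (nat i)) [0..<V]"
    if "i \<ge> 0" "i \<noteq> int l" using that by (auto simp: assms(3))
  have "wr v a (tp s (int l)) = tp (s(v := ys)) (int l)"
    using now dec_tp[OF assms(1), of "int l"] by (simp add: wr_def tp_def del: map_eq_conv fun_upd_apply)
  moreover have "tp s i = tp (s(v := ys)) i" if "i \<noteq> int l"
    using other that by (simp add: tp_def del: map_eq_conv fun_upd_apply)
  ultimately show "((tp s)(int l := wr v a (tp s (int l)))) i = tp (s(v := ys)) i"
    by (simp del: fun_upd_apply add: fun_upd_apply[of "tp s"])
qed

context
  fixes P :: ptm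
begin

abbreviation "both f p \<equiv> p < length (fst P) \<and> p < length (snd P) \<and> fst P ! p = row f \<and> snd P ! p = row f"

lemma reach_row:
  assumes "both f p" "valid s" "f (tp s h) = (q, a, d)"
  shows "reach P 1 (conf p h s) \<lparr>state = q, head = h + shift d, tape = (tp s)(h := a)\<rparr>"
  unfolding conf_def using assms tp_less[of s h] by (intro reach_1 step_row[where f = f]) auto

lemma reach_row_same:
  assumes "both f p" "valid s" "f (tp s h) = (q, tp s h, d)"
  shows "reach P 1 (conf p h s) (conf q (h + shift d) s)"
  using reach_row[OF assms] by (simp add: conf_def)

lemma reach_scan:
  assumes "both (scan_right p v f) p" "valid s" "v < V" "i \<le> length (s v)"
  shows "reach P i (conf p 0 s) (conf p (int i) s)"
  using assms(4)
proof (induction i)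
  case (Suc i)
  have "track (s v) i \<noteq> 0"
    using track_in[of "s v" K i] Suc.prems assms(2,3) by (auto simp: valid_def)
  then have "reach P 1 (conf p (int i) s) (conf p (int i + shift MoveR) s)"
    using assms by (intro reach_row_same[OF assms(1)]) (auto simp: scan_right_def dec_tp_nth)
  from reach_trans[OF Suc.IH this] show ?case using Suc.prems by (simp add: add.commute)
qed simp

lemma reach_home:
  assumes "both (go_home p q) p" "valid s" "\<And>j. j < i \<Longrightarrow> tp s (int j) \<noteq> 0"
  shows "reach P (Suc i) (conf p (int i - 1) s) (conf q 0 s)"
  using assms(3)
proof (induction i)
  case 0
  have "tp s (- 1) = 0" by (simp add: tp_def)
  then have "reach P 1 (conf p (- 1) s) (conf q (- 1 + shift MoveR) s)"
    by (intro reach_row_same[OF assms(1,2)]) (simp add: go_home_def)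
  then show ?case by simp
next
  case (Suc i)
  have "tp s (int i) \<noteq> 0" using Suc.prems[of i] by simp
  then have "reach P 1 (conf p (int i) s) (conf p (int i + shift MoveL) s)"
    by (intro reach_row_same[OF assms(1,2)]) (simp add: go_home_def)
  from reach_trans[OF this, of "Suc i" "conf q 0 s"] Suc show ?case by simp
qed

lemma reach_Push:
  assumes "both (scan_right p v (\<lambda>x. (p + 1, wr v a x, MoveL))) p" "both (go_home (p + 1) q) (p + 1)"
    "valid s" "v < V" "1 \<le> a" "a \<le> K"
  shows "reach P (2 * length (s v) + 2) (conf p 0 s) (conf q 0 (s(v := a # s v)))"
proof -
  let ?l = "length (s v)"
  have v': "valid (s(v := a # s v))" using assms by (auto simp: valid_def)
  have "reach P 1 (conf p (int ?l) s)
      \<lparr>state = p + 1, head = int ?l + shift MoveL, tape = (tp s)(int ?l := wr v a (tp s (int ?l)))\<rparr>"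
    using assms(3,4) by (intro reach_row[OF assms(1)]) (auto simp: scan_right_def dec_tp_nth)
  also have "(tp s)(int ?l := wr v a (tp s (int ?l))) = tp (s(v := a # s v))"
    by (rule tp_update[OF assms(3,4)]) (simp add: track_Cons)
  finally have "reach P 1 (conf p (int ?l) s) (conf (p + 1) (int ?l - 1) (s(v := a # s v)))"
    by (simp add: conf_def)
  moreover have "reach P (Suc ?l) (conf (p + 1) (int ?l - 1) (s(v := a # s v))) (conf q 0 (s(v := a # s v)))"
    using assms(4) by (intro reach_home[OF assms(2)] v' tp_nonzero[OF v']) auto
  ultimately have "reach P (?l + 1 + Suc ?l) (conf p 0 s) (conf q 0 (s(v := a # s v)))"
    by (intro reach_trans[OF reach_trans[OF reach_scan[OF assms(1,3,4) order_refl]]])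
  then show ?thesis by (simp add: mult_2)
qed

lemma reach_Pop:
  assumes "both (scan_right p v (\<lambda>x. (p + 1, x, MoveL))) p"
    "both (\<lambda>x. if dec_sym x ! v = a then (p + 2, wr v 0 x, MoveL) else (p + 3, x, Stay)) (p + 1)"
    "both (go_home (p + 2) q) (p + 2)"
    "valid s" "v < V" "s v = a # xs"
  shows "reach P (2 * length (s v) + 2) (conf p 0 s) (conf q 0 (s(v := xs)))"
proof -
  let ?l = "length xs"
  have "set xs \<subseteq> {1..K}" using validD[OF assms(4,5)] assms(6) by simp
  then have v': "valid (s(v := xs))" using assms(4) by (auto simp: valid_def)
  have "reach P 1 (conf p (int (length (s v))) s) (conf (p + 1) (int (length (s v)) + shift MoveL) s)"
    using assms(4,5) by (intro reach_row_same[OF assms(1)]) (auto simp: scan_right_def dec_tp_nth)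
  from reach_trans[OF reach_scan[OF assms(1,4,5) order_refl] this]
  have 1: "reach P (Suc (length (s v))) (conf p 0 s) (conf (p + 1) (int ?l) s)"
    using assms(6) by simp
  have "dec_sym (tp s (int ?l)) ! v = a"
    using assms by (simp add: dec_tp_nth track_Cons)
  then have "reach P 1 (conf (p + 1) (int ?l) s)
      \<lparr>state = p + 2, head = int ?l + shift MoveL, tape = (tp s)(int ?l := wr v 0 (tp s (int ?l)))\<rparr>"
    using assms(4,5) by (intro reach_row[OF assms(2)]) auto
  also have "(tp s)(int ?l := wr v 0 (tp s (int ?l))) = tp (s(v := xs))"
    by (rule tp_update[OF assms(4,5)]) (simp add: assms(6) track_Cons)
  finally have 2: "reach P 1 (conf (p + 1) (int ?l) s) (conf (p + 2) (int ?l - 1) (s(v := xs)))"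
    by (simp add: conf_def)
  have 3: "reach P (Suc ?l) (conf (p + 2) (int ?l - 1) (s(v := xs))) (conf q 0 (s(v := xs)))"
    using assms(5) by (intro reach_home[OF assms(3)] v' tp_nonzero[OF v']) auto
  from reach_trans[OF reach_trans[OF 1 2] 3] show ?thesis
    using assms(6) by (simp add: mult_2)
qed

lemma reach_NoPop:
  assumes "both (scan_right p v (\<lambda>x. (p + 1, x, MoveL))) p"
    "both (\<lambda>x. if dec_sym x ! v = a then (p + 2, wr v 0 x, MoveL) else (p + 3, x, Stay)) (p + 1)"
    "both (go_home (p + 3) q) (p + 3)"
    "valid s" "v < V" "\<And>xs. s v \<noteq> a # xs" "a \<ge> 1"
  shows "reach P (2 * length (s v) + 3) (conf p 0 s) (conf q 0 s)"
proof -
  let ?l = "length (s v)"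
  have "reach P 1 (conf p (int ?l) s) (conf (p + 1) (int ?l + shift MoveL) s)"
    using assms(4,5) by (intro reach_row_same[OF assms(1)]) (auto simp: scan_right_def dec_tp_nth)
  from reach_trans[OF reach_scan[OF assms(1,4,5) order_refl] this]
  have 1: "reach P (Suc ?l) (conf p 0 s) (conf (p + 1) (int ?l - 1) s)"
    by simp
  \<comment> \<open>For an empty register the head stands on cell \<open>-1\<close>, whose symbol 0
    differs from \<open>a\<close> because \<open>a \<ge> 1\<close>.\<close>
  have "dec_sym (tp s (int ?l - 1)) ! v \<noteq> a"
    using assms(6,7) by (cases "s v") (auto simp: dec_tp_nth[OF assms(4,5)] track_Cons)
  then have "reach P 1 (conf (p + 1) (int ?l - 1) s) (conf (p + 3) (int ?l - 1 + shift Stay) s)"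
    using assms(4,5) by (intro reach_row_same[OF assms(2)]) auto
  then have 2: "reach P 1 (conf (p + 1) (int ?l - 1) s) (conf (p + 3) (int ?l - 1) s)" by simp
  have 3: "reach P (Suc ?l) (conf (p + 3) (int ?l - 1) s) (conf q 0 s)"
    by (intro reach_home[OF assms(3,4)] tp_nonzero[OF assms(4,5)])
  have "Suc ?l + 1 + Suc ?l = 2 * ?l + 3" by simp
  with reach_trans[OF reach_trans[OF 1 2] 3] show ?thesis by metis
qed

lemma reach_goto:
  assumes "both (\<lambda>x. (q, x, Stay)) p" "valid s"
  shows "reach P 1 (conf p 0 s) (conf q 0 s)"
  using reach_row_same[OF assms(1,2), of 0 q Stay] by simp

lemma reach_test:
  assumes "both (\<lambda>x. (if dec_sym x ! v \<noteq> 0 then q else q', x, Stay)) p" "valid s" "v < V"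
  shows "reach P 1 (conf p 0 s) (conf (if s v \<noteq> [] then q else q') 0 s)"
proof -
  have "track (s v) 0 \<noteq> 0" if "s v \<noteq> []"
    using track_in[of "s v" K 0] validD[OF assms(2,3)] that by simp
  then have "track (s v) 0 \<noteq> 0 \<longleftrightarrow> s v \<noteq> []" by (auto simp: track_def)
  then show ?thesis
    using reach_row_same[OF assms(1,2), of 0 "if s v \<noteq> [] then q else q'" Stay] dec_tp_nth[OF assms(2,3), of 0]
    by simp
qed

definition siz :: "store \<Rightarrow> nat" where
  "siz s = (\<Sum>v<V. length (s v))"

lemma siz_upd: "v < V \<Longrightarrow> siz (s(v := xs)) + length (s v) = siz s + length xs"
proof -
  assume "v < V"
  then have "siz t = length (t v) + (\<Sum>u\<in>{..<V} - {v}. length (t u))" for t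
    unfolding siz_def by (intro sum.remove) auto
  from this[of s] this[of "s(v := xs)"] show ?thesis by simp
qed

lemma length_le_siz: "v < V \<Longrightarrow> length (s v) \<le> siz s"
  unfolding siz_def by (rule member_le_sum) auto

text \<open>A unit of time of the program pays for a walk to the end of a register and back, and no
  register outgrows \<open>siz s + t\<close> during the run. Charging every unit the same
  \<open>m\<close>, fixed for the whole run, lets the bounds of consecutive parts add up.\<close>

lemma compile_correct:
  assumes "run c s t s'" "coms K c" "regs c \<subseteq> {..<V}" "valid s"
    "code_at (fst P) p (compile p c)" "code_at (snd P) p (compile p c)"
    "2 * (siz s + t) + 4 \<le> m"
  shows "valid s' \<and> siz s' \<le> siz s + t \<and>
    (\<exists>T \<le> t * m. reach P T (conf p 0 s) (conf (p + clen c) 0 s'))"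
  using assms
proof (induction arbitrary: p rule: run.induct)
  case (run_Skip s)
  then show ?case by (auto intro!: exI[of _ 0])
next
  case (run_Push v a s)
  have "siz (s(v := a # s v)) = Suc (siz s)" using siz_upd[of v s "a # s v"] run_Push by simp
  moreover have "length (s v) \<le> siz s" using run_Push by (intro length_le_siz) simp
  moreover have "reach P (2 * length (s v) + 2) (conf p 0 s) (conf (p + 2) 0 (s(v := a # s v)))"
    using run_Push by (intro reach_Push[where p = p]) (auto simp: code_at_Cons)
  moreover have "valid (s(v := a # s v))" using run_Push.prems by (auto simp: valid_def)
  ultimately show ?case using run_Push.prems
    by (intro conjI exI[of _ "2 * length (s v) + 2"]) (simp_all add: fun_upd_def)
next
  case (run_Seq c s i s1 d j s2)
  have 1: "valid s1 \<and> siz s1 \<le> siz s + i \<and> (\<exists>T \<le> i * m. reach P T (conf p 0 s) (conf (p + clen c) 0 s1))"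
    using run_Seq.prems by (intro run_Seq.IH) (auto simp: code_at_append)
  moreover have "valid s2 \<and> siz s2 \<le> siz s1 + j \<and>
      (\<exists>T \<le> j * m. reach P T (conf (p + clen c) 0 s1) (conf (p + clen c + clen d) 0 s2))"
    using run_Seq.prems 1 by (intro run_Seq.IH) (auto simp: code_at_append)
  ultimately obtain T1 T2 where "T1 \<le> i * m" "T2 \<le> j * m"
    "reach P T1 (conf p 0 s) (conf (p + clen c) 0 s1)"
    "reach P T2 (conf (p + clen c) 0 s1) (conf (p + clen c + clen d) 0 s2)"
    and v: "valid s2" "siz s2 \<le> siz s1 + j" "siz s1 \<le> siz s + i" by blast
  then have "reach P (T1 + T2) (conf p 0 s) (conf (p + clen (Seq c d)) 0 s2)" "T1 + T2 \<le> (i + j) * m"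
    using reach_trans by (auto simp: add.assoc add_mult_distrib)
  with v show ?case by (intro conjI exI[of _ "T1 + T2"]) auto
next
  case (run_Pop s v a xs c i s1 d)
  let ?s = "s(v := xs)" and ?e = "p + 5 + clen c + clen d"
  have v: "v < V" using run_Pop by simp
  have sz: "siz s = Suc (siz ?s)" using siz_upd[OF v, of s xs] run_Pop by simp
  have "set xs \<subseteq> {1..K}" using validD[OF \<open>valid s\<close> v] run_Pop by simp
  then have "valid ?s" using \<open>valid s\<close> by (auto simp: valid_def)
  then obtain T where T: "T \<le> i * m" "valid s1" "siz s1 \<le> siz ?s + i"
    "reach P T (conf (p + 4) 0 ?s) (conf (p + 4 + clen c) 0 s1)"
    using run_Pop.IH[of "p + 4"] run_Pop.prems sz unfolding fun_upd_def
    by (auto simp: code_at_Cons code_at_append eval_nat_numeral)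
  have "reach P (2 * length (s v) + 2) (conf p 0 s) (conf (p + 4) 0 ?s)"
    using run_Pop.prems run_Pop.hyps v by (intro reach_Pop[where a = a]) (auto simp: code_at_Cons eval_nat_numeral)
  moreover have "reach P 1 (conf (p + 4 + clen c) 0 s1) (conf ?e 0 s1)"
    using run_Pop.prems T(2) by (intro reach_goto) (auto simp: code_at_Cons code_at_append eval_nat_numeral)
  ultimately have "reach P (2 * length (s v) + 2 + T + 1) (conf p 0 s) (conf ?e 0 s1)"
    by (intro reach_trans[OF reach_trans[OF _ T(4)]])
  moreover have "2 * length (s v) + 2 + T + 1 \<le> (2 + i) * m"
    using T(1) length_le_siz[OF v, of s] run_Pop.prems(6) by (simp add: algebra_simps)
  ultimately show ?case using T(2,3) sz by (auto simp: add.assoc)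
next
  case (run_NoPop s v a d i s1 c)
  let ?e = "p + 5 + clen c + clen d"
  have v: "v < V" using run_NoPop by simp
  obtain T where T: "T \<le> i * m" "valid s1" "siz s1 \<le> siz s + i"
    "reach P T (conf (p + 5 + clen c) 0 s) (conf ?e 0 s1)"
    using run_NoPop.IH[of "p + 5 + clen c"] run_NoPop.prems
    by (auto simp: code_at_Cons code_at_append eval_nat_numeral)
  have "reach P (2 * length (s v) + 3) (conf p 0 s) (conf (p + 5 + clen c) 0 s)"
    using run_NoPop.prems run_NoPop.hyps v by (intro reach_NoPop[where a = a]) (auto simp: code_at_Cons eval_nat_numeral)
  then have "reach P (2 * length (s v) + 3 + T) (conf p 0 s) (conf ?e 0 s1)"
    by (rule reach_trans[OF _ T(4)])
  moreover have "2 * length (s v) + 3 + T \<le> (2 + i) * m"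
    using T(1) length_le_siz[OF v, of s] run_NoPop.prems(6) by (simp add: algebra_simps)
  ultimately show ?case using T(2,3) by (auto simp: add.assoc)
next
  case (run_Done s v c)
  then have "reach P 1 (conf p 0 s) (conf (if s v \<noteq> [] then p + 1 else p + 2 + clen c) 0 s)"
    by (intro reach_test) (auto simp: code_at_Cons)
  then have "reach P 1 (conf p 0 s) (conf (p + clen (While v c)) 0 s)"
    using run_Done by (simp add: add.assoc)
  then show ?case using run_Done by (intro conjI exI[of _ 1]) auto
next
  case (run_Loop s v c i s1 j s2)
  have 1: "valid s1 \<and> siz s1 \<le> siz s + i \<and>
      (\<exists>T \<le> i * m. reach P T (conf (p + 1) 0 s) (conf (p + 1 + clen c) 0 s1))"
    using run_Loop.prems by (intro run_Loop.IH(1)) (auto simp: code_at_Cons code_at_append)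
  moreover have "valid s2 \<and> siz s2 \<le> siz s1 + j \<and>
      (\<exists>T \<le> j * m. reach P T (conf p 0 s1) (conf (p + clen (While v c)) 0 s2))"
    using run_Loop.prems 1 by (intro run_Loop.IH(2)) auto
  ultimately obtain T1 T2 where T: "T1 \<le> i * m" "T2 \<le> j * m"
    "reach P T1 (conf (p + 1) 0 s) (conf (p + 1 + clen c) 0 s1)"
    "reach P T2 (conf p 0 s1) (conf (p + clen (While v c)) 0 s2)"
    and v: "valid s1" "valid s2" "siz s2 \<le> siz s1 + j" "siz s1 \<le> siz s + i" by blast
  have "reach P 1 (conf p 0 s) (conf (if s v \<noteq> [] then p + 1 else p + 2 + clen c) 0 s)"
    using run_Loop.prems by (intro reach_test) (auto simp: code_at_Cons)
  then have "reach P 1 (conf p 0 s) (conf (p + 1) 0 s)" using run_Loop.hyps by simp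
  moreover have "reach P 1 (conf (p + 1 + clen c) 0 s1) (conf p 0 s1)"
    using run_Loop.prems v(1) by (intro reach_goto) (auto simp: code_at_Cons code_at_append eval_nat_numeral)
  ultimately have "reach P (1 + T1 + 1 + T2) (conf p 0 s) (conf (p + clen (While v c)) 0 s2)"
    by (intro reach_trans[OF reach_trans[OF reach_trans[OF _ T(3)]] T(4)])
  moreover have "1 + T1 + 1 + T2 \<le> (2 + i + j) * m"
    using T(1,2) run_Loop.prems(6) by (simp add: algebra_simps)
  ultimately show ?case using v by auto
qed

end

end

section \<open>Polynomial-time functions\<close>

text \<open>An upper bound by a monomial in \<open>n + 1\<close> is enough: no exact running times
  are needed, and every bound can be replaced by a monotone one.\<close>

definition pol :: "(nat \<Rightarrow> nat) \<Rightarrow> bool" where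
  "pol f \<longleftrightarrow> (\<exists>a e. \<forall>n. f n \<le> a * Suc n ^ e)"

lemma polE:
  assumes "pol f" obtains a e where "\<And>n. f n \<le> a * Suc n ^ e"
  using assms unfolding pol_def by blast

lemma pol_mono: "pol g \<Longrightarrow> (\<And>n. f n \<le> g n) \<Longrightarrow> pol f"
  unfolding pol_def by (meson order_trans)

named_theorems pol_intros

lemma pol_const [pol_intros]: "pol (\<lambda>_. k)"
  unfolding pol_def by (rule exI[of _ k], rule exI[of _ 0]) simp

lemma pol_id [pol_intros]: "pol (\<lambda>n. n)"
  unfolding pol_def by (rule exI[of _ 1], rule exI[of _ 1]) simp

lemma pol_add [pol_intros]: assumes "pol f" "pol g" shows "pol (\<lambda>n. f n + g n)"
proof -
  from assms obtain a e b d where f: "\<And>n. f n \<le> a * Suc n ^ e" and g: "\<And>n. g n \<le> b * Suc n ^ d"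
    by (auto elim!: polE)
  have "f n + g n \<le> (a + b) * Suc n ^ (e + d)" for n
  proof -
    have "Suc n ^ e \<le> Suc n ^ (e + d)" "Suc n ^ d \<le> Suc n ^ (e + d)"
      by (rule power_increasing; simp)+
    then have "a * Suc n ^ e \<le> a * Suc n ^ (e + d)" "b * Suc n ^ d \<le> b * Suc n ^ (e + d)"
      by (auto intro: mult_le_mono2)
    with f[of n] g[of n] show ?thesis unfolding add_mult_distrib by linarith
  qed
  then show ?thesis unfolding pol_def by blast
qed

lemma pol_mult [pol_intros]: assumes "pol f" "pol g" shows "pol (\<lambda>n. f n * g n)"
proof -
  from assms obtain a e b d where f: "\<And>n. f n \<le> a * Suc n ^ e" and g: "\<And>n. g n \<le> b * Suc n ^ d"
    by (auto elim!: polE)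
  have "f n * g n \<le> (a * b) * Suc n ^ (e + d)" for n
    using mult_mono[OF f[of n] g[of n]] by (simp add: power_add mult_ac)
  then show ?thesis unfolding pol_def by blast
qed

lemma pol_Suc [pol_intros]: "pol f \<Longrightarrow> pol (\<lambda>n. Suc (f n))"
  using pol_add[OF _ pol_const[of 1], of f] by simp

lemma pol_power [pol_intros]: "pol f \<Longrightarrow> pol (\<lambda>n. f n ^ k)"
  by (induction k) (auto intro: pol_intros)

lemma pol_comp: assumes "pol f" "pol g" shows "pol (\<lambda>n. f (g n))"
proof -
  obtain a e where f: "\<And>n. f n \<le> a * Suc n ^ e" by (rule polE[OF assms(1)]) blast
  show ?thesis
    by (rule pol_mono[of "\<lambda>n. a * Suc (g n) ^ e"]) (auto intro!: pol_intros assms(2) f)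
qed

lemma pol_sum [pol_intros]: "(\<And>i. i \<in> I \<Longrightarrow> pol (f i)) \<Longrightarrow> pol (\<lambda>n. \<Sum>i\<in>I. f i n)"
  by (induction I rule: infinite_finite_induct) (auto intro: pol_intros)

section \<open>Values as contents of registers\<close>

class symb =
  fixes sy :: "'a \<Rightarrow> nat"

instantiation nat :: symb
begin
definition sy_nat :: "nat \<Rightarrow> nat" where [simp]: "sy_nat n = n"
instance ..
end

instantiation bool :: symb
begin
definition sy_bool :: "bool \<Rightarrow> nat" where [simp]: "sy_bool b = (if b then 2 else 1)"
instance ..
end

text \<open>All values of a type occupy the same number of registers, so that pairs need no separators.\<close>
class reg =
  fixes enc :: "'a \<Rightarrow> nat list list"
  assumes enc_length: "length (enc x) = length (enc y)"

instantiation list :: (symb) reg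
begin
definition enc_list :: "'a list \<Rightarrow> nat list list" where [simp]: "enc_list xs = [map sy xs]"
instance by standard simp
end

text \<open>Unary: the numbers computed with are lengths, time bounds and loop counts, for which
  polynomial in the value is the right measure. Binary values enter as bit lists.\<close>

instantiation nat :: reg
begin
definition enc_nat :: "nat \<Rightarrow> nat list list" where [simp]: "enc_nat n = [replicate n 1]"
instance by standard simp
end

instantiation bool :: reg
begin
definition enc_bool :: "bool \<Rightarrow> nat list list" where [simp]: "enc_bool b = [if b then [1] else []]"
instance by standard simp
end

instantiation prod :: (reg, reg) reg
begin
definition enc_prod :: "'a \<times> 'b \<Rightarrow> nat list list" where [simp]: "enc_prod p = enc (fst p) @ enc (snd p)"
instance by standard (simp, metis enc_length)
end

definition width :: "'a::reg itself \<Rightarrow> nat" where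
  "width _ = length (enc (undefined :: 'a))"

lemma length_enc [simp]: "length (enc (x :: 'a::reg)) = width TYPE('a)"
  unfolding width_def by (rule enc_length)

lemma width_simps [simp]:
  "width TYPE('a::symb list) = 1" "width TYPE(nat) = 1" "width TYPE(bool) = 1"
  "width TYPE('b::reg \<times> 'c::reg) = width TYPE('b) + width TYPE('c)"
proof -
  show "width TYPE('a list) = 1" using length_enc[of "undefined :: 'a list"] by simp
  show "width TYPE(nat) = 1" using length_enc[of "undefined :: nat"] by simp
  show "width TYPE(bool) = 1" using length_enc[of "undefined :: bool"] by simp
  show "width TYPE('b \<times> 'c) = width TYPE('b) + width TYPE('c)"
    using length_enc[of "undefined :: 'b \<times> 'c"] by (simp del: length_enc) simp
qed

definition sto :: "'a::reg \<Rightarrow> store" where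
  "sto x i = (if i < width TYPE('a) then enc x ! i else [])"

definition sz :: "'a::reg \<Rightarrow> nat" where
  "sz x = sum_list (map length (enc x))"

lemma sz_simps [simp]:
  "sz (xs :: 'a::symb list) = length xs" "sz n = n" "sz b = (if b then 1 else 0)"
  "sz (p :: 'b::reg \<times> 'c::reg) = sz (fst p) + sz (snd p)"
  by (auto simp: sz_def)

lemma sz_eq_sum: "width TYPE('a) \<le> W \<Longrightarrow> sz (x :: 'a::reg) = (\<Sum>i<W. length (sto x i))"
proof -
  assume W: "width TYPE('a) \<le> W"
  have "(\<Sum>i<W. length (sto x i)) = (\<Sum>i<width TYPE('a). length (enc x ! i))"
    using W by (intro sum.mono_neutral_cong_right) (auto simp: sto_def)
  also have "\<dots> = sz x"
    by (simp add: sz_def sum_list_sum_nth atLeast0LessThan)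
  finally show ?thesis by simp
qed

text \<open>A step pushes at most one symbol. Hence results of polynomial-time programs have
  polynomial size, with no separate analysis of the size.\<close>

lemma run_growth:
  "run c s t s' \<Longrightarrow> finite I \<Longrightarrow> (\<Sum>i\<in>I. length (s' i)) \<le> (\<Sum>i\<in>I. length (s i)) + t"
proof (induction rule: run.induct)
  case (run_Push v a s)
  have "(\<Sum>i\<in>I. length ((s(v := a # s v)) i)) \<le> (\<Sum>i\<in>I. length (s i) + (if i = v then 1 else 0))"
    by (intro sum_mono) auto
  also have "\<dots> \<le> (\<Sum>i\<in>I. length (s i)) + 1"
    using run_Push by (simp add: sum.distrib)
  finally show ?case .
next
  case (run_Pop s v a xs c i s1 d)
  have "(\<Sum>i\<in>I. length ((s(v := xs)) i)) \<le> (\<Sum>i\<in>I. length (s i))"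
    using run_Pop by (intro sum_mono) auto
  then show ?case using run_Pop by simp
qed auto

text \<open>Frame property: a program neither sees nor changes registers outside \<open>R\<close>,
  so it can run while other registers keep saved data.\<close>

lemma run_local:
  assumes "run c s t s'" "regs c \<subseteq> R" "\<And>v. v \<in> R \<Longrightarrow> S v = s v"
  shows "run c S t (\<lambda>v. if v \<in> R then s' v else S v)"
  using assms
proof (induction arbitrary: S rule: run.induct)
  case (run_Skip s)
  have "(\<lambda>v. if v \<in> R then s v else S v) = S" using run_Skip by auto
  then show ?case using run.run_Skip[of S] by simp
next
  case (run_Push v a s)
  have "(\<lambda>u. if u \<in> R then (s(v := a # s v)) u else S u) = S(v := a # S v)" using run_Push by auto
  then show ?case using run.run_Push[of v a S] by simp
next
  case (run_Seq c s i s1 d j s2)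
  have "run c S i (\<lambda>v. if v \<in> R then s1 v else S v)" using run_Seq.prems by (intro run_Seq.IH) auto
  moreover have "run d (\<lambda>v. if v \<in> R then s1 v else S v) j
      (\<lambda>v. if v \<in> R then s2 v else (if v \<in> R then s1 v else S v))"
    using run_Seq.prems by (intro run_Seq.IH) auto
  moreover have "(\<lambda>v. if v \<in> R then s2 v else (if v \<in> R then s1 v else S v)) = (\<lambda>v. if v \<in> R then s2 v else S v)"
    by auto
  ultimately show ?case by (metis run.run_Seq)
next
  case (run_Pop s v a xs c i s1 d)
  have "run c (S(v := xs)) i (\<lambda>u. if u \<in> R then s1 u else (S(v := xs)) u)"
    using run_Pop.prems by (intro run_Pop.IH) auto
  moreover have "(\<lambda>u. if u \<in> R then s1 u else (S(v := xs)) u) = (\<lambda>u. if u \<in> R then s1 u else S u)"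
    using run_Pop.prems by auto
  ultimately show ?case using run_Pop by (intro run.run_Pop) auto
next
  case (run_NoPop s v a d i s1 c)
  then show ?case by (intro run.run_NoPop) auto
next
  case (run_Done s v c)
  have "(\<lambda>v. if v \<in> R then s v else S v) = S" using run_Done by auto
  then show ?case using run.run_Done[of S v] run_Done by auto
next
  case (run_Loop s v c i s1 j s2)
  have "run c S i (\<lambda>v. if v \<in> R then s1 v else S v)" using run_Loop.prems by (intro run_Loop.IH) auto
  moreover have "run (While v c) (\<lambda>v. if v \<in> R then s1 v else S v) j
      (\<lambda>v. if v \<in> R then s2 v else (if v \<in> R then s1 v else S v))"
    using run_Loop.prems by (intro run_Loop.IH) auto
  moreover have "(\<lambda>v. if v \<in> R then s2 v else (if v \<in> R then s1 v else S v)) = (\<lambda>v. if v \<in> R then s2 v else S v)"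
    by auto
  moreover have "S v \<noteq> []" using run_Loop by auto
  ultimately show ?case by (metis run.run_Loop)
qed

fun ren :: "nat \<Rightarrow> com \<Rightarrow> com" where
  "ren k Skip = Skip"
| "ren k (Push v a) = Push (k + v) a"
| "ren k (Seq c d) = Seq (ren k c) (ren k d)"
| "ren k (IfPop v a c d) = IfPop (k + v) a (ren k c) (ren k d)"
| "ren k (While v c) = While (k + v) (ren k c)"

lemma coms_ren [simp]: "coms K (ren k c) = coms K c"
  by (induction c) auto

text \<open>Shifted by \<open>k\<close>, a program works on a second input stored above the first
  \<open>k\<close> registers, which stay as they are.\<close>

lemma run_ren:
  "run c s t s' \<Longrightarrow> run (ren k c) (\<lambda>u. if u < k then S u else s (u - k)) t
     (\<lambda>u. if u < k then S u else s' (u - k))"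
proof (induction rule: run.induct)
  case (run_Push v a s)
  have "(\<lambda>u. if u < k then S u else (s(v := a # s v)) (u - k)) =
      (\<lambda>u. if u < k then S u else s (u - k))(k + v := a # s v)" by (rule ext) auto
  then show ?case using run.run_Push[of "k + v" a "\<lambda>u. if u < k then S u else s (u - k)"] by simp
next
  case (run_Pop s v a xs c i s1 d)
  have "(\<lambda>u. if u < k then S u else (s(v := xs)) (u - k)) =
      (\<lambda>u. if u < k then S u else s (u - k))(k + v := xs)" by (rule ext) auto
  then show ?case using run_Pop by (auto intro!: run.run_Pop simp del: add_2_eq_Suc)
qed (auto intro: run.intros simp del: add_2_eq_Suc add_2_eq_Suc' One_nat_def)

lemma finite_regs [simp]: "finite (regs c)"
  by (induction c) auto

section \<open>Polynomial-time computability over a fixed alphabet\<close>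

locale alphabet =
  fixes K :: nat
  assumes K2: "2 \<le> K"
begin

definition ok :: "'a::reg \<Rightarrow> bool" where
  "ok x \<longleftrightarrow> (\<forall>l\<in>set (enc x). set l \<subseteq> {1..K})"

lemma ok_simps [simp]:
  "ok (xs :: nat list) \<longleftrightarrow> (\<forall>x\<in>set xs. x \<in> {1..K})" "ok (bs :: bool list)" "ok ([] :: 'a::symb list)"
  "ok (n :: nat)" "ok (b :: bool)" "ok (p :: 'b::reg \<times> 'c::reg) \<longleftrightarrow> ok (fst p) \<and> ok (snd p)"
  using K2 by (auto simp: ok_def)

lemma ok_sto: "ok x \<Longrightarrow> set (sto x i) \<subseteq> {1..K}"
  unfolding ok_def sto_def by auto

text \<open>The final store is exactly \<open>sto (f x)\<close>, so scratch registers have to be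
  emptied again; in return programs compose by mere sequencing. The alphabet size \<open>K\<close>
  is fixed because the parts of a program share one tape.\<close>

definition PT :: "('a::reg \<Rightarrow> 'b::reg) \<Rightarrow> bool" where
  "PT f \<longleftrightarrow> (\<exists>c p. coms K c \<and> pol p \<and> (\<forall>x. ok x \<longrightarrow> ok (f x) \<and>
     (\<exists>t \<le> p (sz x). run c (sto x) t (sto (f x)))))"

lemma PTI:
  assumes "coms K c" "pol p"
    "\<And>x. ok x \<Longrightarrow> ok (f x) \<and> (\<exists>t \<le> p (sz x). run c (sto x) t (sto (f x)))"
  shows "PT f"
  using assms unfolding PT_def by blast

lemma PTE:
  assumes "PT f"
  obtains c p where "coms K c" "pol p" "mono p"
    "\<And>x. ok x \<Longrightarrow> ok (f x)" "\<And>x. ok x \<Longrightarrow> \<exists>t \<le> p (sz x). run c (sto x) t (sto (f x))"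
proof -
  from assms obtain c p where c: "coms K c" "pol p" "\<And>x. ok x \<Longrightarrow> ok (f x)"
    and r: "\<And>x. ok x \<Longrightarrow> \<exists>t \<le> p (sz x). run c (sto x) t (sto (f x))"
    unfolding PT_def by blast
  obtain a e where p: "\<And>n. p n \<le> a * Suc n ^ e" by (rule polE[OF \<open>pol p\<close>]) blast
  have "\<exists>t \<le> a * Suc (sz x) ^ e. run c (sto x) t (sto (f x))" if "ok x" for x
    using r[OF that] p[of "sz x"] by (meson order_trans)
  moreover have "pol (\<lambda>n. a * Suc n ^ e)" by (intro pol_intros)
  moreover have "mono (\<lambda>n. a * Suc n ^ e)" by (intro monoI mult_le_mono2 power_mono) auto
  ultimately show ?thesis using that c by blast
qed

lemma PT_ok: "PT f \<Longrightarrow> ok x \<Longrightarrow> ok (f x)"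
  unfolding PT_def by blast

lemma PT_size:
  fixes f :: "'a::reg \<Rightarrow> 'b::reg"
  assumes "PT f"
  obtains g where "pol g" "mono g" "\<And>x. ok x \<Longrightarrow> sz (f x) \<le> g (sz x)"
proof -
  obtain c p where "coms K c" and p: "pol p" "mono p" and "\<And>x. ok x \<Longrightarrow> ok (f x)"
    and r: "\<And>x. ok x \<Longrightarrow> \<exists>t \<le> p (sz x). run c (sto x) t (sto (f x))"
    by (rule PTE[OF assms]) blast
  let ?W = "width TYPE('a) + width TYPE('b)"
  have "sz (f x) \<le> sz x + p (sz x)" if x: "ok x" for x
  proof -
    from r[OF x] obtain t where t: "t \<le> p (sz x)" "run c (sto x) t (sto (f x))" by blast
    from run_growth[OF t(2), of "{..<?W}"] t(1) show ?thesis
      by (simp flip: sz_eq_sum)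
  qed
  moreover have "pol (\<lambda>n. n + p n)" using p by (intro pol_intros)
  moreover have "mono (\<lambda>n. n + p n)" using p by (simp add: mono_def add_mono)
  ultimately show ?thesis using that by blast
qed

text \<open>For changes of type that leave the registers alone, such as reading bits as symbols or a
  unary number as a list of ones.\<close>

lemma PT_enc_eq:
  fixes f :: "'a::reg \<Rightarrow> 'b::reg"
  shows "(\<And>x. enc (f x) = enc x) \<Longrightarrow> PT f"
proof (rule PTI[of Skip "\<lambda>_. 0"])
  fix x :: 'a assume "\<And>x. enc (f x) = enc x" and "ok x"
  moreover have "width TYPE('a) = width TYPE('b)"
    using length_enc[of x] length_enc[of "f x"] \<open>\<And>x. enc (f x) = enc x\<close>[of x] by simp
  ultimately have "sto (f x) = sto x" "ok (f x)" by (auto simp: sto_def fun_eq_iff ok_def)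
  then show "ok (f x) \<and> (\<exists>t\<le>0. run Skip (sto x) t (sto (f x)))" by (auto intro: run.intros)
qed (auto intro: pol_intros)

lemma PT_comp:
  fixes f :: "'a::reg \<Rightarrow> 'b::reg" and g :: "'b \<Rightarrow> 'c::reg"
  assumes "PT g" "PT f" shows "PT (\<lambda>x. g (f x))"
proof -
  obtain c p where c: "coms K c" "pol p" "mono p" "\<And>x. ok x \<Longrightarrow> ok (f x)"
    "\<And>x. ok x \<Longrightarrow> \<exists>t \<le> p (sz x). run c (sto x) t (sto (f x))" by (rule PTE[OF \<open>PT f\<close>]) blast
  obtain d q where d: "coms K d" "pol q" "mono q" "\<And>x. ok x \<Longrightarrow> ok (g x)"
    "\<And>x. ok x \<Longrightarrow> \<exists>t \<le> q (sz x). run d (sto x) t (sto (g x))" by (rule PTE[OF \<open>PT g\<close>]) blast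
  obtain h where h: "pol h" "\<And>x. ok x \<Longrightarrow> sz (f x) \<le> h (sz x)" by (rule PT_size[OF \<open>PT f\<close>]) blast
  show ?thesis
  proof (rule PTI[of "Seq c d" "\<lambda>n. p n + q (h n)"])
    fix x :: 'a assume x: "ok x"
    from c(5)[OF x] obtain i where i: "i \<le> p (sz x)" "run c (sto x) i (sto (f x))" by blast
    from d(5)[OF c(4)[OF x]] obtain j where j: "j \<le> q (sz (f x))" "run d (sto (f x)) j (sto (g (f x)))"
      by blast
    have "i + j \<le> p (sz x) + q (h (sz x))"
      using i(1) j(1) monoD[OF d(3) h(2)[OF x]] by linarith
    then show "ok (g (f x)) \<and> (\<exists>t\<le>p (sz x) + q (h (sz x)). run (Seq c d) (sto x) t (sto (g (f x))))"
      using run_Seq[OF i(2) j(2)] c(4) d(4) x by blast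
  qed (use c d h in \<open>auto intro: pol_intros pol_comp\<close>)
qed

section \<open>Dispatch on symbols; transfer and copying of registers\<close>

fun popcase :: "nat \<Rightarrow> nat \<Rightarrow> (nat \<Rightarrow> com) \<Rightarrow> com \<Rightarrow> com" where
  "popcase 0 v f d = d"
| "popcase (Suc a) v f d = IfPop v (Suc a) (f (Suc a)) (popcase a v f d)"

lemma coms_popcase: "(\<And>a. a \<in> {1..k} \<Longrightarrow> coms K (f a)) \<Longrightarrow> coms K d \<Longrightarrow> k \<le> K \<Longrightarrow> coms K (popcase k v f d)"
  by (induction k) auto

lemma run_popcase:
  assumes "s v = a # xs" "a \<in> {1..k}" "run (f a) (s(v := xs)) i s'"
  shows "\<exists>t \<le> 2 * k + i. run (popcase k v f d) s t s'"
  using assms(2)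
proof (induction k)
  case (Suc k)
  show ?case
  proof (cases "a = Suc k")
    case True
    then have "run (popcase (Suc k) v f d) s (2 + i) s'" using assms by (auto intro: run_Pop simp del: add_2_eq_Suc)
    then show ?thesis by (intro exI[of _ "2 + i"]) simp
  next
    case False
    then obtain t where "t \<le> 2 * k + i" "run (popcase k v f d) s t s'" using Suc by auto
    then have "run (popcase (Suc k) v f d) s (2 + t) s'" using assms(1) False by (auto intro: run_NoPop simp del: add_2_eq_Suc)
    then show ?thesis using \<open>t \<le> 2 * k + i\<close> by (intro exI[of _ "2 + t"]) simp
  qed
qed simp

lemma run_popcase_Nil:
  assumes "s v = []" "run d s i s'"
  shows "\<exists>t \<le> 2 * k + i. run (popcase k v f d) s t s'"
proof (induction k)
  case (Suc k)
  then obtain t where "t \<le> 2 * k + i" "run (popcase k v f d) s t s'" by auto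
  then have "run (popcase (Suc k) v f d) s (2 + t) s'" using assms(1) by (auto intro: run_NoPop simp del: add_2_eq_Suc)
  then show ?case using \<open>t \<le> 2 * k + i\<close> by (intro exI[of _ "2 + t"]) simp
qed (use assms in auto)

text \<open>The loop consumes register \<open>v\<close>; the invariant is indexed by what remains of
  it, so the initial length bounds the number of rounds.\<close>

lemma run_while:
  assumes "set xs \<subseteq> {1..K}" "I xs s" "s v = xs"
    and step: "\<And>a ys s. a \<in> {1..K} \<Longrightarrow> I (a # ys) s \<Longrightarrow> s v = a # ys \<Longrightarrow>
      \<exists>t s'. t \<le> m \<and> run (f a) (s(v := ys)) t s' \<and> I ys s' \<and> s' v = ys"
  shows "\<exists>t s'. t \<le> length xs * (m + 2 * K + 2) + 1 \<and>
    run (While v (popcase K v f Skip)) s t s' \<and> I [] s' \<and> s' v = []"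
  using assms(1-3)
proof (induction xs arbitrary: s)
  case Nil
  then show ?case by (auto intro!: exI[of _ 1] exI[of _ s] run_Done)
next
  case (Cons a ys)
  then obtain i s1 where i: "i \<le> m" "run (f a) (s(v := ys)) i s1" "I ys s1" "s1 v = ys"
    using step[of a ys s] by auto
  from run_popcase[of s v a ys K f i s1 Skip] i(2) Cons.prems obtain j where
    j: "j \<le> 2 * K + i" "run (popcase K v f Skip) s j s1" by auto
  from Cons.IH[of s1] i Cons.prems obtain t s2 where t: "t \<le> length ys * (m + 2 * K + 2) + 1"
    "run (While v (popcase K v f Skip)) s1 t s2" "I [] s2" "s2 v = []" by auto
  have "run (While v (popcase K v f Skip)) s (2 + j + t) s2"
    using Cons.prems j t by (intro run_Loop) auto
  moreover have "2 + j + t \<le> length (a # ys) * (m + 2 * K + 2) + 1"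
    using i(1) j(1) t(1) by simp
  ultimately show ?case using t by blast
qed

text \<open>Popping and pushing reverses the contents. With several targets the program duplicates,
  with none it clears.\<close>

definition mvto :: "nat \<Rightarrow> nat list \<Rightarrow> com" where
  "mvto v ws = While v (popcase K v (\<lambda>a. foldr (\<lambda>w c. Seq (Push w a) c) ws Skip) Skip)"

lemma coms_mvto [simp]: "coms K (mvto v ws)"
proof -
  have "coms K (foldr (\<lambda>w c. Seq (Push w a) c) ws Skip)" if "a \<in> {1..K}" for a
    using that by (induction ws) auto
  then show ?thesis by (auto simp: mvto_def intro!: coms_popcase)
qed

lemma run_pushes:
  assumes "distinct ws"
  shows "run (foldr (\<lambda>w c. Seq (Push w a) c) ws Skip) s (length ws)
    (\<lambda>u. if u \<in> set ws then a # s u else s u)"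
  using assms
proof (induction ws arbitrary: s)
  case Nil
  then show ?case using run_Skip[of s] by simp
next
  case (Cons w ws)
  let ?s = "s(w := a # s w)"
  have "(\<lambda>u. if u \<in> set ws then a # ?s u else ?s u) = (\<lambda>u. if u \<in> set (w # ws) then a # s u else s u)"
    using Cons.prems by auto
  then show ?case using run_Seq[OF run_Push[of w a s] Cons.IH[of ?s]] Cons.prems by simp
qed

lemma run_mvto:
  assumes "distinct ws" "v \<notin> set ws" "set (s v) \<subseteq> {1..K}"
  shows "\<exists>t \<le> length (s v) * (length ws + 2 * K + 2) + 1. run (mvto v ws) s t
    (\<lambda>u. if u = v then [] else if u \<in> set ws then rev (s v) @ s u else s u)"
proof -
  define I where "I ys s' \<longleftrightarrow> (\<exists>zs. s v = zs @ ys \<and> (\<forall>u. u \<noteq> v \<longrightarrow> s' u = (if u \<in> set ws then rev zs @ s u else s u)))"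
    for ys s'
  have "\<exists>t s'. t \<le> length (s v) * (length ws + 2 * K + 2) + 1 \<and> run (mvto v ws) s t s' \<and> I [] s' \<and> s' v = []"
    unfolding mvto_def
  proof (rule run_while)
    fix a ys s' assume a: "a \<in> {1..K}" and I: "I (a # ys) s'" and "s' v = a # ys"
    let ?s = "\<lambda>u. if u \<in> set ws then a # (s'(v := ys)) u else (s'(v := ys)) u"
    from I obtain zs where zs: "s v = zs @ a # ys"
      "\<forall>u. u \<noteq> v \<longrightarrow> s' u = (if u \<in> set ws then rev zs @ s u else s u)" unfolding I_def by blast
    then have "I ys ?s" unfolding I_def by (intro exI[of _ "zs @ [a]"]) auto
    then show "\<exists>t s''. t \<le> length ws \<and> run (foldr (\<lambda>w c. Seq (Push w a) c) ws Skip) (s'(v := ys)) t s'' \<and> I ys s'' \<and> s'' v = ys"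
      using run_pushes[OF assms(1), of a "s'(v := ys)"] assms(2) by (intro exI[of _ "length ws"] exI[of _ ?s]) auto
  qed (use assms in \<open>auto simp: I_def\<close>)
  then obtain t s' where t: "t \<le> length (s v) * (length ws + 2 * K + 2) + 1" "run (mvto v ws) s t s'" "I [] s'" "s' v = []"
    by blast
  then have "s' = (\<lambda>u. if u = v then [] else if u \<in> set ws then rev (s v) @ s u else s u)"
    unfolding I_def by auto
  with t show ?thesis by blast
qed

text \<open>Two transfers through \<open>tmp\<close> restore the order. Listing \<open>v\<close>
  itself among the targets keeps the original, which turns the move into a copy.\<close>

definition mv :: "nat \<Rightarrow> nat \<Rightarrow> nat list \<Rightarrow> com" where
  "mv tmp v ws = Seq (mvto v [tmp]) (mvto tmp ws)"

lemma coms_mv [simp]: "coms K (mv tmp v ws)"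
  by (simp add: mv_def)

lemma run_mv:
  assumes "distinct ws" "tmp \<notin> set ws" "v \<noteq> tmp" "set (s v) \<subseteq> {1..K}" "s tmp = []" "length ws \<le> 2"
  shows "\<exists>t \<le> length (s v) * (4 * K + 7) + 2. run (mv tmp v ws) s t
    (\<lambda>u. if u \<in> set ws then (if u = v then s v else s v @ s u) else if u = v then [] else s u)"
proof -
  let ?s1 = "\<lambda>u. if u = v then [] else if u \<in> set [tmp] then rev (s v) @ s u else s u"
  have "\<exists>t \<le> length (s v) * (length [tmp] + 2 * K + 2) + 1. run (mvto v [tmp]) s t ?s1"
    using assms by (intro run_mvto) auto
  then obtain i where i: "i \<le> length (s v) * (2 * K + 3) + 1" "run (mvto v [tmp]) s i ?s1"
    by (auto simp: algebra_simps)
  let ?s2 = "\<lambda>u. if u = tmp then [] else if u \<in> set ws then rev (?s1 tmp) @ ?s1 u else ?s1 u"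
  have "\<exists>t \<le> length (?s1 tmp) * (length ws + 2 * K + 2) + 1. run (mvto tmp ws) ?s1 t ?s2"
    using assms by (intro run_mvto) auto
  then obtain j where j: "j \<le> length (s v) * (length ws + 2 * K + 2) + 1" "run (mvto tmp ws) ?s1 j ?s2"
    using assms by auto
  have "?s2 = (\<lambda>u. if u \<in> set ws then (if u = v then s v else s v @ s u) else if u = v then [] else s u)"
    using assms by auto
  moreover have "length (s v) * (length ws + 2 * K + 2) \<le> length (s v) * (2 * K + 4)"
    using assms(6) by (intro mult_le_mono2) simp
  then have "i + j \<le> length (s v) * (2 * K + 3) + length (s v) * (2 * K + 4) + 2"
    using i(1) j(1) by linarith
  then have "i + j \<le> length (s v) * (4 * K + 7) + 2"
    by (simp add: algebra_simps)
  ultimately show ?thesis using run_Seq[OF i(2) j(2)] unfolding mv_def by auto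
qed

primrec seqs :: "nat \<Rightarrow> (nat \<Rightarrow> com) \<Rightarrow> com" where
  "seqs 0 f = Skip"
| "seqs (Suc n) f = Seq (seqs n f) (f n)"

lemma coms_seqs [simp]: "(\<And>i. i < n \<Longrightarrow> coms K (f i)) \<Longrightarrow> coms K (seqs n f)"
  by (induction n) auto

lemma run_seqs:
  assumes "\<And>i. i < n \<Longrightarrow> \<exists>t \<le> m. run (f i) (S i) t (S (Suc i))"
  shows "\<exists>t \<le> n * m. run (seqs n f) (S 0) t (S n)"
  using assms
proof (induction n)
  case (Suc n)
  then obtain i where "i \<le> n * m" "run (seqs n f) (S 0) i (S n)" by auto
  moreover obtain j where "j \<le> m" "run (f n) (S n) j (S (Suc n))" using Suc.prems[of n] by auto
  ultimately show ?case by (intro exI[of _ "i + j"]) (auto intro: run_Seq)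
qed (auto intro: run_Skip)

lemma length_sto_le: "length (sto (x :: 'a::reg) i) \<le> sz x"
proof (cases "i < width TYPE('a)")
  case True
  then have "enc x ! i \<in> set (enc x)" using nth_mem[of i "enc x"] by simp
  then show ?thesis using True unfolding sz_def sto_def by (auto intro!: member_le_sum_list)
qed (simp add: sto_def)

text \<open>This makes it possible to use a value twice. A copy of the input is put above every
  register that \<open>f\<close> touches, the renamed program of \<open>g\<close> works on the copy,
  and its result is moved next to that of \<open>f\<close>. Register \<open>M\<close> lies in
  between as scratch space of the moves.\<close>

lemma PT_Pair:
  fixes f :: "'a::reg \<Rightarrow> 'b::reg" and g :: "'a \<Rightarrow> 'c::reg"
  assumes "PT f" "PT g" shows "PT (\<lambda>x. (f x, g x))"
proof -
  obtain c p where c: "coms K c" "pol p" "mono p" "\<And>x. ok x \<Longrightarrow> ok (f x)"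
    "\<And>x. ok x \<Longrightarrow> \<exists>t \<le> p (sz x). run c (sto x) t (sto (f x))" by (rule PTE[OF \<open>PT f\<close>]) blast
  obtain d q where d: "coms K d" "pol q" "mono q" "\<And>x. ok x \<Longrightarrow> ok (g x)"
    "\<And>x. ok x \<Longrightarrow> \<exists>t \<le> q (sz x). run d (sto x) t (sto (g x))" by (rule PTE[OF \<open>PT g\<close>]) blast
  obtain h where h: "pol h" "\<And>x. ok x \<Longrightarrow> sz (g x) \<le> h (sz x)" by (rule PT_size[OF \<open>PT g\<close>]) blast
  let ?a = "width TYPE('a)" and ?b = "width TYPE('b)" and ?c = "width TYPE('c)"
  obtain M where M: "regs c \<subseteq> {..<M}" "?a < M" "?b + ?c < M"
  proof -
    from finite_nat_bounded[OF finite_regs[of c]] obtain k where "regs c \<subseteq> {..<k}" by blast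
    then show ?thesis by (intro that[of "k + ?a + ?b + ?c + 1"]) auto
  qed
  define cp where "cp = seqs ?a (\<lambda>i. mv M i [i, Suc M + i])"
  define gather where "gather = seqs ?c (\<lambda>i. mv M (Suc M + i) [?b + i])"
  let ?p = "\<lambda>n. ?a * (n * (4 * K + 7) + 2) + (p n + (q n + ?c * (h n * (4 * K + 7) + 2)))"
  show ?thesis
  proof (rule PTI[of "Seq cp (Seq c (Seq (ren (Suc M) d) gather))" ?p])
    fix x :: 'a assume x: "ok x"
    \<comment> \<open>The store after \<open>n\<close> registers have been copied.\<close>
    define S where "S n = (\<lambda>u. if u < M then sto x u else if u > M \<and> u - Suc M < n then sto x (u - Suc M) else [])" for n
    have "\<exists>t \<le> ?a * (sz x * (4 * K + 7) + 2). run cp (S 0) t (S ?a)"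
      unfolding cp_def
    proof (rule run_seqs)
      fix i assume i: "i < ?a"
      have "\<exists>t \<le> length (S i i) * (4 * K + 7) + 2. run (mv M i [i, Suc M + i]) (S i) t
        (\<lambda>u. if u \<in> set [i, Suc M + i] then (if u = i then S i i else S i i @ S i u) else if u = i then [] else S i u)"
        using i M(2) ok_sto[OF x] by (intro run_mv) (auto simp: S_def)
      moreover have "(\<lambda>u. if u \<in> set [i, Suc M + i] then (if u = i then S i i else S i i @ S i u) else if u = i then [] else S i u)
        = S (Suc i)" using i M(2) by (auto simp: S_def fun_eq_iff)
      moreover have "length (S i i) \<le> sz x" using i M(2) length_sto_le[of x i] by (auto simp: S_def)
      then have "length (S i i) * (4 * K + 7) \<le> sz x * (4 * K + 7)" by (rule mult_le_mono1)
      ultimately show "\<exists>t\<le>sz x * (4 * K + 7) + 2. run (mv M i [i, Suc M + i]) (S i) t (S (Suc i))"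
        by (metis add_le_mono1 order_trans)
    qed
    moreover have "S 0 = sto x" using M(2) by (auto simp: S_def sto_def fun_eq_iff)
    ultimately obtain t1 where t1: "t1 \<le> ?a * (sz x * (4 * K + 7) + 2)" "run cp (sto x) t1 (S ?a)" by auto
    define S2 where "S2 = (\<lambda>u. if u < M then sto (f x) u else if u = M then [] else sto x (u - Suc M))"
    from c(5)[OF x] obtain t2 where t2: "t2 \<le> p (sz x)" "run c (sto x) t2 (sto (f x))" by blast
    have "run c (S ?a) t2 (\<lambda>v. if v \<in> {..<M} then sto (f x) v else S ?a v)"
      by (rule run_local[OF t2(2) M(1)]) (simp add: S_def)
    also have "(\<lambda>v. if v \<in> {..<M} then sto (f x) v else S ?a v) = S2"
      by (auto simp: S_def S2_def fun_eq_iff sto_def)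
    finally have t2': "run c (S ?a) t2 S2" .
    \<comment> \<open>The store after \<open>n\<close> registers of \<open>g x\<close> have been
      moved behind \<open>f x\<close>; \<open>?b + ?c < M\<close> keeps sources and targets
      apart.\<close>
    define S3 where "S3 n = (\<lambda>u. if u < ?b then sto (f x) u else if u < ?b + n then sto (g x) (u - ?b)
        else if u > M \<and> u - Suc M \<ge> n then sto (g x) (u - Suc M) else [])" for n
    from d(5)[OF x] obtain t3 where t3: "t3 \<le> q (sz x)" "run d (sto x) t3 (sto (g x))" by blast
    have "run (ren (Suc M) d) (\<lambda>u. if u < Suc M then S2 u else sto x (u - Suc M)) t3
        (\<lambda>u. if u < Suc M then S2 u else sto (g x) (u - Suc M))"
      by (rule run_ren[OF t3(2)])
    also have "(\<lambda>u. if u < Suc M then S2 u else sto x (u - Suc M)) = S2"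
      by (auto simp: S2_def fun_eq_iff)
    also have "(\<lambda>u. if u < Suc M then S2 u else sto (g x) (u - Suc M)) = S3 0"
      using M(3) by (auto simp: S2_def S3_def fun_eq_iff sto_def)
    finally have t3': "run (ren (Suc M) d) S2 t3 (S3 0)" .
    have okg: "ok (g x)" by (rule d(4)[OF x])
    have "\<exists>t \<le> ?c * (sz (g x) * (4 * K + 7) + 2). run gather (S3 0) t (S3 ?c)"
      unfolding gather_def
    proof (rule run_seqs)
      fix i assume i: "i < ?c"
      have "\<exists>t \<le> length (S3 i (Suc M + i)) * (4 * K + 7) + 2. run (mv M (Suc M + i) [?b + i]) (S3 i) t
        (\<lambda>u. if u \<in> set [?b + i] then (if u = Suc M + i then S3 i (Suc M + i) else S3 i (Suc M + i) @ S3 i u)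
          else if u = Suc M + i then [] else S3 i u)"
        using i M(3) ok_sto[OF okg] by (intro run_mv) (auto simp: S3_def)
      moreover have "(\<lambda>u. if u \<in> set [?b + i] then (if u = Suc M + i then S3 i (Suc M + i) else S3 i (Suc M + i) @ S3 i u)
          else if u = Suc M + i then [] else S3 i u) = S3 (Suc i)"
        using i M(3) by (auto simp: S3_def fun_eq_iff)
      moreover have "length (S3 i (Suc M + i)) \<le> sz (g x)" using i M(3) length_sto_le[of "g x" i] by (auto simp: S3_def)
      then have "length (S3 i (Suc M + i)) * (4 * K + 7) \<le> sz (g x) * (4 * K + 7)" by (rule mult_le_mono1)
      ultimately show "\<exists>t\<le>sz (g x) * (4 * K + 7) + 2. run (mv M (Suc M + i) [?b + i]) (S3 i) t (S3 (Suc i))"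
        by (metis add_le_mono1 order_trans)
    qed
    then obtain t4 where t4: "t4 \<le> ?c * (sz (g x) * (4 * K + 7) + 2)" "run gather (S3 0) t4 (S3 ?c)" by auto
    have "S3 ?c = sto (f x, g x)"
      using M(3) by (auto simp: S3_def sto_def fun_eq_iff nth_append)
    then have "run (Seq cp (Seq c (Seq (ren (Suc M) d) gather))) (sto x) (t1 + (t2 + (t3 + t4))) (sto (f x, g x))"
      using run_Seq[OF t1(2) run_Seq[OF t2' run_Seq[OF t3' t4(2)]]] by simp
    moreover have "?c * (sz (g x) * (4 * K + 7) + 2) \<le> ?c * (h (sz x) * (4 * K + 7) + 2)"
      using h(2)[OF x] by (intro mult_le_mono2 add_le_mono1 mult_le_mono1)
    then have "t1 + (t2 + (t3 + t4)) \<le> ?p (sz x)"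
      using t1(1) t2(1) t3(1) t4(1) by linarith
    ultimately show "ok (f x, g x) \<and> (\<exists>t\<le>?p (sz x). run (Seq cp (Seq c (Seq (ren (Suc M) d) gather))) (sto x) t (sto (f x, g x)))"
      using c(4)[OF x] okg by auto
  qed (use c d h in \<open>auto simp: cp_def gather_def intro!: pol_intros\<close>)
qed

end

lemma map_sy_nat [simp]: "map sy (xs :: nat list) = xs"
  by (induction xs) auto

context alphabet
begin

named_theorems PT_intros

lemma ex_le_mono: "\<exists>t \<le> a. Q t \<Longrightarrow> a \<le> b \<Longrightarrow> \<exists>t \<le> b. Q t" for a b :: nat
  by (meson order_trans)

section \<open>Projections, constants, case distinction and iteration\<close>

lemma run_clear:
  assumes "\<And>i. i < n \<Longrightarrow> set (s (k + i)) \<subseteq> {1..K} \<and> length (s (k + i)) \<le> m"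
  shows "\<exists>t \<le> n * (m * (2 * K + 2) + 1).
    run (seqs n (\<lambda>i. mvto (k + i) [])) s t (\<lambda>u. if k \<le> u \<and> u < k + n then [] else s u)"
proof -
  define S where "S i = (\<lambda>u. if k \<le> u \<and> u < k + i then [] else s u)" for i
  have "\<exists>t \<le> n * (m * (2 * K + 2) + 1). run (seqs n (\<lambda>i. mvto (k + i) [])) (S 0) t (S n)"
  proof (rule run_seqs)
    fix i assume i: "i < n"
    have Si: "S i (k + i) = s (k + i)" by (simp add: S_def)
    have "\<exists>t \<le> length (S i (k + i)) * (length ([] :: nat list) + 2 * K + 2) + 1. run (mvto (k + i) []) (S i) t
        (\<lambda>u. if u = k + i then [] else if u \<in> set [] then rev (S i (k + i)) @ S i u else S i u)"
      using assms[OF i] Si by (intro run_mvto) auto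
    moreover have "(\<lambda>u. if u = k + i then [] else if u \<in> set [] then rev (S i (k + i)) @ S i u else S i u) = S (Suc i)"
      by (auto simp: S_def fun_eq_iff)
    moreover have "length (S i (k + i)) * (length ([] :: nat list) + 2 * K + 2) \<le> m * (2 * K + 2)"
      using assms[OF i] Si by (intro mult_le_mono) auto
    ultimately show "\<exists>t \<le> m * (2 * K + 2) + 1. run (mvto (k + i) []) (S i) t (S (Suc i))"
      by (metis add_le_mono1 order_trans)
  qed
  moreover have "S 0 = s" by (auto simp: S_def fun_eq_iff)
  ultimately show ?thesis by (simp add: S_def)
qed

lemma PT_id [PT_intros]: "PT (\<lambda>x. x)"
  by (rule PT_enc_eq) simp

lemma PT_fst_base: "PT (fst :: 'a::reg \<times> 'b::reg \<Rightarrow> 'a)"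
proof (rule PTI)
  let ?a = "width TYPE('a)" and ?b = "width TYPE('b)"
  let ?c = "seqs ?b (\<lambda>i. mvto (?a + i) [])"
  show "coms K ?c" by simp
  show "pol (\<lambda>n. ?b * (n * (2 * K + 2) + 1))" by (intro pol_intros)
  fix x :: "'a \<times> 'b" assume x: "ok x"
  have "\<exists>t \<le> ?b * (sz x * (2 * K + 2) + 1). run ?c (sto x) t (\<lambda>u. if ?a \<le> u \<and> u < ?a + ?b then [] else sto x u)"
    using ok_sto[OF x] length_sto_le[of x] by (intro run_clear) blast
  moreover have "(\<lambda>u. if ?a \<le> u \<and> u < ?a + ?b then [] else sto x u) = sto (fst x)"
    by (auto simp: sto_def fun_eq_iff nth_append)
  ultimately show "ok (fst x) \<and> (\<exists>t \<le> ?b * (sz x * (2 * K + 2) + 1). run ?c (sto x) t (sto (fst x)))"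
    using x by simp
qed

lemma PT_snd_base: "PT (snd :: 'a::reg \<times> 'b::reg \<Rightarrow> 'b)"
proof (rule PTI)
  let ?a = "width TYPE('a)" and ?b = "width TYPE('b)"
  let ?c = "seqs ?a (\<lambda>i. mvto (0 + i) [])"
  let ?d = "seqs ?b (\<lambda>i. if ?a = 0 then Skip else mv (?a + ?b) (?a + i) [i])"
  show "coms K (Seq ?c ?d)" by simp
  let ?p = "\<lambda>n. ?a * (n * (2 * K + 2) + 1) + ?b * (n * (4 * K + 7) + 2)"
  show "pol ?p" by (intro pol_intros)
  fix x :: "'a \<times> 'b" assume x: "ok x"
  define S where "S n = (\<lambda>u. if u < n then sto (snd x) u else if u < ?a + n then [] else sto (snd x) (u - ?a))" for n
  have "\<exists>t \<le> ?a * (sz x * (2 * K + 2) + 1). run ?c (sto x) t (\<lambda>u. if 0 \<le> u \<and> u < 0 + ?a then [] else sto x u)"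
    using ok_sto[OF x] length_sto_le[of x] by (intro run_clear) blast
  moreover have "(\<lambda>u. if 0 \<le> u \<and> u < 0 + ?a then [] else sto x u) = S 0"
    by (auto simp: S_def sto_def fun_eq_iff nth_append)
  ultimately obtain i where i: "i \<le> ?a * (sz x * (2 * K + 2) + 1)" "run ?c (sto x) i (S 0)" by auto
  have "\<exists>t \<le> ?b * (sz x * (4 * K + 7) + 2). run ?d (S 0) t (S ?b)"
  proof (rule run_seqs)
    fix i assume i: "i < ?b"
    show "\<exists>t \<le> sz x * (4 * K + 7) + 2. run (if ?a = 0 then Skip else mv (?a + ?b) (?a + i) [i]) (S i) t (S (Suc i))"
    proof (cases "?a = 0")
      case True
      then have "S (Suc i) = S i" by (auto simp: S_def fun_eq_iff)
      then show ?thesis using True by (auto intro: run_Skip)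
    next
      case False
      have 1: "\<exists>t \<le> length (S i (?a + i)) * (4 * K + 7) + 2. run (mv (?a + ?b) (?a + i) [i]) (S i) t
        (\<lambda>u. if u \<in> set [i] then (if u = ?a + i then S i (?a + i) else S i (?a + i) @ S i u)
          else if u = ?a + i then [] else S i u)"
        using i False ok_sto[of "snd x"] x by (intro run_mv) (auto simp: S_def sto_def)
      have 2: "(\<lambda>u. if u \<in> set [i] then (if u = ?a + i then S i (?a + i) else S i (?a + i) @ S i u)
          else if u = ?a + i then [] else S i u) = S (Suc i)"
        using i False by (auto simp: S_def fun_eq_iff)
      have "length (S i (?a + i)) \<le> sz x"
        using length_sto_le[of "snd x" i] by (auto simp: S_def)
      then have "length (S i (?a + i)) * (4 * K + 7) + 2 \<le> sz x * (4 * K + 7) + 2" by simp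
      from ex_le_mono[OF 1[unfolded 2] this] show ?thesis using False by simp
    qed
  qed
  then obtain j where j: "j \<le> ?b * (sz x * (4 * K + 7) + 2)" "run ?d (S 0) j (S ?b)" by blast
  have "S ?b = sto (snd x)" by (auto simp: S_def fun_eq_iff sto_def)
  then show "ok (snd x) \<and> (\<exists>t \<le> ?p (sz x). run (Seq ?c ?d) (sto x) t (sto (snd x)))"
    using run_Seq[OF i(2) j(2)] i(1) j(1) x by (auto intro!: exI[of _ "i + j"])
qed

lemmas PT_fst [PT_intros] = PT_comp[OF PT_fst_base]
lemmas PT_snd [PT_intros] = PT_comp[OF PT_snd_base]
lemmas [PT_intros] = PT_Pair

lemma PT_const:
  fixes y :: "'b::reg"
  assumes "ok y"
  shows "PT (\<lambda>x :: 'a::reg. y)"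
proof (rule PTI)
  let ?a = "width TYPE('a)" and ?b = "width TYPE('b)"
  define f where "f i = foldr (\<lambda>a c. Seq c (Push i a)) (enc y ! i) Skip" for i
  let ?c = "seqs ?a (\<lambda>i. mvto (0 + i) [])"
  have "coms K (foldr (\<lambda>a c. Seq c (Push i a)) xs Skip)" if "set xs \<subseteq> {1..K}" for i xs
    using that by (induction xs) auto
  then show "coms K (Seq ?c (seqs ?b f))"
    using assms nth_mem[of _ "enc y"] unfolding f_def ok_def by auto
  let ?p = "\<lambda>n. ?a * (n * (2 * K + 2) + 1) + ?b * sz y"
  show "pol ?p" by (intro pol_intros)
  fix x :: 'a assume x: "ok x"
  have "\<exists>t \<le> ?a * (sz x * (2 * K + 2) + 1). run ?c (sto x) t (\<lambda>u. if 0 \<le> u \<and> u < 0 + ?a then [] else sto x u)"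
    using ok_sto[OF x] length_sto_le[of x] by (intro run_clear) blast
  moreover have "(\<lambda>u. if 0 \<le> u \<and> u < 0 + ?a then [] else sto x u) = (\<lambda>_. [])"
    by (auto simp: sto_def fun_eq_iff)
  ultimately obtain i where i: "i \<le> ?a * (sz x * (2 * K + 2) + 1)" "run ?c (sto x) i (\<lambda>_. [])" by auto
  define S where "S n = (\<lambda>u. if u < n then sto y u else [])" for n
  have push: "run (foldr (\<lambda>a c. Seq c (Push v a)) xs Skip) s (length xs) (s(v := xs @ s v))" for v xs s
  proof (induction xs)
    case (Cons a xs)
    have eq: "(s(v := xs @ s v))(v := a # (s(v := xs @ s v)) v) = s(v := (a # xs) @ s v)" by (rule ext) simp
    show ?case using run_Seq[OF Cons.IH run_Push[of v a]] unfolding eq by (simp add: fun_upd_def)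
  qed (use run_Skip[of s] in simp)
  have "\<exists>t \<le> ?b * sz y. run (seqs ?b f) (S 0) t (S ?b)"
  proof (rule run_seqs)
    fix i assume i: "i < ?b"
    then have "(S i)(i := enc y ! i @ S i i) = S (Suc i)" by (auto simp: S_def fun_eq_iff sto_def less_Suc_eq)
    moreover have "length (enc y ! i) \<le> sz y" using length_sto_le[of y i] i by (simp add: sto_def)
    ultimately show "\<exists>t \<le> sz y. run (f i) (S i) t (S (Suc i))"
      using push[of i "enc y ! i" "S i"] unfolding f_def by auto
  qed
  moreover have "S 0 = (\<lambda>_. [])" "S ?b = sto y" by (auto simp: S_def sto_def fun_eq_iff)
  ultimately obtain j where j: "j \<le> ?b * sz y" "run (seqs ?b f) (\<lambda>_. []) j (sto y)" by auto
  show "ok y \<and> (\<exists>t \<le> ?p (sz x). run (Seq ?c (seqs ?b f)) (sto x) t (sto y))"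
    using run_Seq[OF i(2) j(2)] i(1) j(1) assms by (auto intro!: exI[of _ "i + j"])
qed

lemma PT_const_nat [PT_intros]: "PT (\<lambda>_. n :: nat)" and PT_const_bool [PT_intros]: "PT (\<lambda>_. b :: bool)"
  and PT_const_bools [PT_intros]: "PT (\<lambda>_. bs :: bool list)" and PT_Nil [PT_intros]: "PT (\<lambda>_. [] :: 'b::symb list)"
  by (auto intro!: PT_const)

lemma PT_Cons_base: "a \<in> {1..K} \<Longrightarrow> PT (\<lambda>xs :: nat list. a # xs)"
proof (rule PTI[of "Push 0 a" "\<lambda>_. 1"])
  fix xs :: "nat list" assume "ok xs" "a \<in> {1..K}"
  moreover have "(sto xs)(0 := a # sto xs 0) = sto (a # xs)" by (auto simp: sto_def fun_eq_iff)
  ultimately show "ok (a # xs) \<and> (\<exists>t\<le>1. run (Push 0 a) (sto xs) t (sto (a # xs)))"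
    using run_Push[of 0 a "sto xs"] by (auto intro!: exI[of _ 1])
qed (auto intro: pol_intros)

lemma PT_syms [PT_intros]: "PT f \<Longrightarrow> PT (\<lambda>x. map sy (f x :: bool list))"
  by (rule PT_comp[of "map sy"]) (auto intro!: PT_enc_eq)

lemma PT_replicate1 [PT_intros]: "PT f \<Longrightarrow> PT (\<lambda>x. replicate (f x) (Suc 0))"
  by (rule PT_comp[of "\<lambda>n. replicate n (Suc 0)"]) (auto intro!: PT_enc_eq)

lemma PT_flag: "PT f \<Longrightarrow> PT (\<lambda>x. if f x then [Suc 0] else [])"
  by (rule PT_comp[of "\<lambda>b. if b then [Suc 0] else []"]) (auto intro!: PT_enc_eq)

text \<open>The sum of the individual time bounds serves all programs of the family, so the symbol
  that selects the program does not influence the bound.\<close>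

lemma PT_choice:
  fixes g :: "nat \<Rightarrow> 'a::reg \<Rightarrow> 'b::reg"
  assumes "\<And>a. a \<in> I \<Longrightarrow> PT (g a)" "finite I"
  obtains c p where "pol p" "mono p" "\<And>a. a \<in> I \<Longrightarrow> coms K (c a)"
    "\<And>a x. a \<in> I \<Longrightarrow> ok x \<Longrightarrow> ok (g a x)"
    "\<And>a x. a \<in> I \<Longrightarrow> ok x \<Longrightarrow> \<exists>t \<le> p (sz x). run (c a) (sto x) t (sto (g a x))"
proof -
  have "\<forall>a\<in>I. \<exists>cp. coms K (fst cp) \<and> pol (snd cp) \<and> mono (snd cp) \<and> (\<forall>x. ok x \<longrightarrow> ok (g a x)) \<and>
      (\<forall>x. ok x \<longrightarrow> (\<exists>t \<le> snd cp (sz x). run (fst cp) (sto x) t (sto (g a x))))"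
  proof
    fix a assume "a \<in> I"
    show "\<exists>cp. coms K (fst cp) \<and> pol (snd cp) \<and> mono (snd cp) \<and> (\<forall>x. ok x \<longrightarrow> ok (g a x)) \<and>
      (\<forall>x. ok x \<longrightarrow> (\<exists>t \<le> snd cp (sz x). run (fst cp) (sto x) t (sto (g a x))))"
      by (rule PTE[OF assms(1)[OF \<open>a \<in> I\<close>]]) (metis fst_conv snd_conv)
  qed
  from bchoice[OF this] obtain cp where cp: "\<forall>a\<in>I. coms K (fst (cp a)) \<and> pol (snd (cp a)) \<and> mono (snd (cp a)) \<and>
      (\<forall>x. ok x \<longrightarrow> ok (g a x)) \<and>
      (\<forall>x. ok x \<longrightarrow> (\<exists>t \<le> snd (cp a) (sz x). run (fst (cp a)) (sto x) t (sto (g a x))))"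
    by (rule exE)
  have 1: "coms K (fst (cp a))" "pol (snd (cp a))" "mono (snd (cp a))" if "a \<in> I" for a
    using bspec[OF cp that] by simp_all
  have 2: "ok (g a x)" "\<exists>t \<le> snd (cp a) (sz x). run (fst (cp a)) (sto x) t (sto (g a x))"
    if "a \<in> I" "ok x" for a and x :: 'a
    using bspec[OF cp that(1)] that(2) by simp_all
  let ?p = "\<lambda>n. \<Sum>a\<in>I. snd (cp a) n"
  show ?thesis
  proof (rule that)
    show "pol ?p" by (intro pol_intros 1)
    show "mono ?p" by (intro monoI sum_mono monoD[OF 1(3)])
    show "coms K (fst (cp a))" if "a \<in> I" for a by (rule 1(1)[OF that])
    show "ok (g a x)" if "a \<in> I" "ok x" for a and x :: 'a by (rule 2(1)[OF that])
    fix a and x :: 'a assume a: "a \<in> I" and x: "ok x"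
    have "snd (cp a) (sz x) \<le> ?p (sz x)" using a assms(2) by (intro member_le_sum) auto
    from ex_le_mono[OF 2(2)[OF a x] this]
    show "\<exists>t \<le> ?p (sz x). run (fst (cp a)) (sto x) t (sto (g a x))" .
  qed
qed

lemma PT_case_base:
  fixes f :: "'a::reg \<Rightarrow> 'b::reg" and g :: "nat \<Rightarrow> nat list \<times> 'a \<Rightarrow> 'b"
  assumes "PT f" "\<And>a. a \<in> {1..K} \<Longrightarrow> PT (g a)"
  shows "PT (\<lambda>p. case fst p of [] \<Rightarrow> f (snd p) | a # l \<Rightarrow> g a (l, snd p))" (is "PT ?F")
proof -
  have "PT (\<lambda>p :: nat list \<times> 'a. f (snd p))" by (rule PT_comp[OF assms(1) PT_snd_base])
  then obtain d q where d: "coms K d" "pol q" "mono q" "\<And>x :: nat list \<times> 'a. ok x \<Longrightarrow> ok (f (snd x))"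
    "\<And>x :: nat list \<times> 'a. ok x \<Longrightarrow> \<exists>t \<le> q (sz x). run d (sto x) t (sto (f (snd x)))"
    by (rule PTE) blast
  obtain c p where c: "pol p" "mono p" "\<And>a. a \<in> {1..K} \<Longrightarrow> coms K (c a)"
    "\<And>a x. a \<in> {1..K} \<Longrightarrow> ok x \<Longrightarrow> ok (g a x)"
    "\<And>a x. a \<in> {1..K} \<Longrightarrow> ok x \<Longrightarrow> \<exists>t \<le> p (sz x). run (c a) (sto x) t (sto (g a x))"
    by (rule PT_choice[of "{1..K}" g, OF assms(2)]) auto
  show ?thesis
  proof (rule PTI[of "popcase K 0 c d" "\<lambda>n. 2 * K + (p n + q n)"])
    fix x :: "nat list \<times> 'a" assume x: "ok x"
    obtain l y where xl: "x = (l, y)" by force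
    show "ok (?F x) \<and> (\<exists>t \<le> 2 * K + (p (sz x) + q (sz x)). run (popcase K 0 c d) (sto x) t (sto (?F x)))"
    proof (cases l)
      case Nil
      from d(5)[OF x] obtain i where i: "i \<le> q (sz x)" "run d (sto x) i (sto (f y))" using xl by auto
      have "sto x 0 = []" using xl Nil by (simp add: sto_def)
      from run_popcase_Nil[OF this i(2), of K c] obtain t where
        "t \<le> 2 * K + i" "run (popcase K 0 c d) (sto x) t (sto (f y))" by blast
      then show ?thesis using i(1) d(4)[OF x] xl Nil by (auto intro!: exI[of _ t])
    next
      case (Cons a l')
      then have a: "a \<in> {1..K}" and ok: "ok (l', y)" using x xl by auto
      from c(5)[OF this] obtain i where i: "i \<le> p (sz (l', y))" "run (c a) (sto (l', y)) i (sto (g a (l', y)))"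
        by blast
      have "(sto x)(0 := l') = sto (l', y)"
        using xl Cons by (auto simp: sto_def fun_eq_iff nth_Cons split: nat.splits)
      moreover have "sto x 0 = a # l'" using xl Cons by (simp add: sto_def)
      ultimately obtain t where t: "t \<le> 2 * K + i" "run (popcase K 0 c d) (sto x) t (sto (g a (l', y)))"
        using run_popcase[of "sto x" 0 a l' K c i "sto (g a (l', y))" d] i(2) a by auto
      have "p (sz (l', y)) \<le> p (sz x)" using xl Cons by (intro monoD[OF c(2)]) simp
      then show ?thesis using t i(1) c(4)[OF a ok] xl Cons by (auto intro!: exI[of _ t])
    qed
  qed (use c d in \<open>auto intro!: pol_intros coms_popcase\<close>)
qed

lemma PT_case_syms:
  assumes "PT l" "PT h" "PT f" "\<And>a. a \<in> {1..K} \<Longrightarrow> PT (g a)"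
  shows "PT (\<lambda>x. case l x of [] \<Rightarrow> f (h x) | a # as \<Rightarrow> g a (as, h x))"
proof -
  have "PT (\<lambda>p. case fst p of [] \<Rightarrow> f (snd p) | a # l \<Rightarrow> g a (l, snd p))"
    by (rule PT_case_base[OF assms(3)]) (rule assms(4))
  from PT_comp[OF this PT_Pair[OF assms(1,2)], unfolded fst_conv snd_conv] show ?thesis .
qed

text \<open>A truth value is an empty or a one-symbol register, so a conditional is a case
  distinction on a list.\<close>

lemma PT_if [PT_intros]:
  assumes "PT p" "PT f" "PT g"
  shows "PT (\<lambda>x. if p x then f x else g x)"
proof -
  have "PT (\<lambda>x. case (if p x then [Suc 0] else []) of [] \<Rightarrow> g x | a # as \<Rightarrow> f (snd (as, x)))"
    by (rule PT_case_syms[OF PT_flag[OF assms(1)] PT_id assms(3), of "\<lambda>_ p. f (snd p)"])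
      (intro PT_comp[OF assms(2)] PT_snd_base)
  moreover have "(\<lambda>x. case (if p x then [Suc 0] else []) of [] \<Rightarrow> g x | a # as \<Rightarrow> f (snd (as, x))) =
      (\<lambda>x. if p x then f x else g x)" by auto
  ultimately show ?thesis by simp
qed

text \<open>The list is moved to a register \<open>X\<close> beyond those of all loop bodies. The
  bound \<open>G\<close> on all intermediate values has to be assumed: polynomial bounds for the
  single steps would still allow the accumulator to grow exponentially.\<close>

lemma PT_foldl_base:
  fixes step :: "'a::reg \<Rightarrow> nat \<Rightarrow> 'a"
  assumes "\<And>b. b \<in> {1..K} \<Longrightarrow> PT (\<lambda>a. step a b)" "pol G" "mono G"
    "\<And>a xs. ok a \<Longrightarrow> ok xs \<Longrightarrow> sz (foldl step a xs) \<le> G (sz a + length xs)"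
  shows "PT (\<lambda>p. foldl step (fst p) (snd p))"
proof -
  obtain c p where c: "pol p" "mono p" "\<And>b. b \<in> {1..K} \<Longrightarrow> coms K (c b)"
    "\<And>b x. b \<in> {1..K} \<Longrightarrow> ok x \<Longrightarrow> ok (step x b)"
    "\<And>b x. b \<in> {1..K} \<Longrightarrow> ok x \<Longrightarrow> \<exists>t \<le> p (sz x). run (c b) (sto x) t (sto (step x b))"
    by (rule PT_choice[of "{1..K}" "\<lambda>b a. step a b", OF assms(1)]) auto
  let ?w = "width TYPE('a)"
  obtain X where X: "(\<Union>b\<in>{1..K}. regs (c b)) \<subseteq> {..<X}" "?w < X"
  proof -
    have "finite (\<Union>b\<in>{1..K}. regs (c b))" by auto
    from finite_nat_bounded[OF this] obtain k where "(\<Union>b\<in>{1..K}. regs (c b)) \<subseteq> {..<k}" by blast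
    then show ?thesis by (intro that[of "k + ?w + 1"]) auto
  qed
  let ?loop = "While X (popcase K X c Skip)"
  let ?p = "\<lambda>n. (n * (4 * K + 7) + 2) + (n * (p (G n) + 2 * K + 2) + 1)"
  have ok_fold: "ok (foldl step a xs)" if "ok a" "ok xs" for a xs
    using that
  proof (induction xs arbitrary: a)
    case (Cons b xs)
    then show ?case using c(4)[of b a] by simp
  qed simp
  show ?thesis
  proof (rule PTI[of "Seq (mv (Suc X) ?w [X]) ?loop" ?p])
    fix x :: "'a \<times> nat list" assume x: "ok x"
    obtain a xs where ax: "x = (a, xs)" by force
    with x have ok: "ok a" "ok xs" by auto
    have xw: "sto x ?w = xs" using ax by (simp add: sto_def nth_append)
    have "\<exists>t \<le> length (sto x ?w) * (4 * K + 7) + 2. run (mv (Suc X) ?w [X]) (sto x) t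
        (\<lambda>u. if u \<in> set [X] then (if u = ?w then sto x ?w else sto x ?w @ sto x u)
          else if u = ?w then [] else sto x u)"
      using X(2) ok_sto[OF x] by (intro run_mv) (auto simp: sto_def)
    moreover have "(\<lambda>u. if u \<in> set [X] then (if u = ?w then sto x ?w else sto x ?w @ sto x u)
          else if u = ?w then [] else sto x u) = (sto a)(X := xs)"
      using X(2) ax by (auto simp: sto_def fun_eq_iff nth_append)
    ultimately obtain i where i: "i \<le> length xs * (4 * K + 7) + 2"
      "run (mv (Suc X) ?w [X]) (sto x) i ((sto a)(X := xs))" using xw by auto
    define I where "I ys s \<longleftrightarrow> (\<exists>zs. xs = zs @ ys \<and> s = (sto (foldl step a zs))(X := ys))" for ys s
    have "\<exists>t s'. t \<le> length xs * (p (G (sz x)) + 2 * K + 2) + 1 \<and> run ?loop ((sto a)(X := xs)) t s' \<and> I [] s' \<and> s' X = []"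
    proof (rule run_while)
      show "I xs ((sto a)(X := xs))" unfolding I_def by (intro exI[of _ "[]"]) simp
      show "set xs \<subseteq> {1..K}" using ok by auto
      fix b ys s assume b: "b \<in> {1..K}" and "I (b # ys) s"
      then obtain zs where zs: "xs = zs @ b # ys" "s = (sto (foldl step a zs))(X := b # ys)"
        unfolding I_def by blast
      then have okz: "ok zs" using ok by auto
      from c(5)[OF b ok_fold[OF ok(1) okz]] obtain t where t: "t \<le> p (sz (foldl step a zs))"
        "run (c b) (sto (foldl step a zs)) t (sto (foldl step a (zs @ [b])))" by auto
      have "sz (foldl step a zs) \<le> G (sz a + length zs)" by (rule assms(4)[OF ok(1) okz])
      also have "\<dots> \<le> G (sz x)" using ax zs by (intro monoD[OF assms(3)]) simp
      finally have "p (sz (foldl step a zs)) \<le> p (G (sz x))" by (rule monoD[OF c(2)])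
      then have t': "t \<le> p (G (sz x))" using t(1) by simp
      have "run (c b) (s(X := ys)) t
          (\<lambda>v. if v \<in> {..<X} then sto (foldl step a (zs @ [b])) v else (s(X := ys)) v)"
        using zs by (intro run_local[OF t(2) order_trans[OF UN_upper[OF b] X(1)]]) auto
      also have "(\<lambda>v. if v \<in> {..<X} then sto (foldl step a (zs @ [b])) v else (s(X := ys)) v) =
          (sto (foldl step a (zs @ [b])))(X := ys)" using X zs by (auto simp: fun_eq_iff sto_def)
      finally have "run (c b) (s(X := ys)) t ((sto (foldl step a (zs @ [b])))(X := ys))" .
      moreover have "I ys ((sto (foldl step a (zs @ [b])))(X := ys))"
        unfolding I_def using zs by (intro exI[of _ "zs @ [b]"]) simp
      ultimately show "\<exists>t s'. t \<le> p (G (sz x)) \<and> run (c b) (s(X := ys)) t s' \<and> I ys s' \<and> s' X = ys"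
        using t' by (intro exI[of _ t] exI[of _ "(sto (foldl step a (zs @ [b])))(X := ys)"]) simp
    qed simp
    then obtain j s' where j: "j \<le> length xs * (p (G (sz x)) + 2 * K + 2) + 1"
      "run ?loop ((sto a)(X := xs)) j s'" "I [] s'" by blast
    have "s' = sto (foldl step a xs)"
      using j(3) X(2) by (auto simp: I_def sto_def fun_eq_iff)
    then have "run (Seq (mv (Suc X) ?w [X]) ?loop) (sto x) (i + j) (sto (foldl step a xs))"
      using run_Seq[OF i(2) j(2)] by simp
    moreover have "length xs * (4 * K + 7) \<le> sz x * (4 * K + 7)"
      "length xs * (p (G (sz x)) + 2 * K + 2) \<le> sz x * (p (G (sz x)) + 2 * K + 2)"
      using ax by (intro mult_le_mono1; simp)+
    then have "i + j \<le> ?p (sz x)" using i(1) j(1) by linarith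
    ultimately show "ok (foldl step (fst x) (snd x)) \<and>
        (\<exists>t \<le> ?p (sz x). run (Seq (mv (Suc X) ?w [X]) ?loop) (sto x) t (sto (foldl step (fst x) (snd x))))"
      using ok_fold[OF ok] ax by auto
  next
    show "pol ?p" by (intro pol_intros pol_comp[OF c(1) assms(2)])
  qed (use c(3) in \<open>auto intro!: coms_popcase\<close>)
qed

text \<open>The parameter \<open>e\<close> is carried along unchanged. A step may add only an amount
  that depends on \<open>e\<close>, so the accumulator stays within
  \<open>sz a + length ys * g (sz e)\<close>, and this supplies the bound on intermediate
  values.\<close>

lemma PT_foldl_syms:
  fixes step :: "'e::reg \<Rightarrow> 'a::reg \<Rightarrow> nat \<Rightarrow> 'a"
  assumes "\<And>b. b \<in> {1..K} \<Longrightarrow> PT (\<lambda>p. step (fst p) (snd p) b)" "pol g" "mono g"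
    "\<And>e a b. ok e \<Longrightarrow> ok a \<Longrightarrow> b \<in> {1..K} \<Longrightarrow> sz (step e a b) \<le> sz a + g (sz e)"
    "PT e" "PT i" "PT xs"
  shows "PT (\<lambda>x. foldl (step (e x)) (i x) (xs x))"
proof -
  let ?st = "\<lambda>p b. (fst p, step (fst p) (snd p) b)"
  have fold: "foldl ?st (e, a) ys = (e, foldl (step e) a ys)" for e a ys
    by (induction ys arbitrary: a) auto
  have okf: "ok (foldl (step e) a ys)" if "ok e" "ok a" "ok ys" for e a ys
    using that
  proof (induction ys arbitrary: a)
    case (Cons b ys)
    then have "ok (step e a b)" using PT_ok[OF assms(1), of b "(e, a)"] by simp
    then show ?case using Cons by simp
  qed simp
  have size: "sz (foldl (step e) a ys) \<le> sz a + length ys * g (sz e)" if "ok e" "ok a" "ok ys" for e a ys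
    using that
  proof (induction ys arbitrary: a)
    case (Cons b ys)
    have "ok (step e a b)" using okf[of e a "[b]"] Cons.prems by simp
    then have "sz (foldl (step e) (step e a b) ys) \<le> sz (step e a b) + length ys * g (sz e)"
      using Cons by simp
    then show ?case using assms(4)[of e a b] Cons.prems by simp
  qed simp
  have "PT (\<lambda>p. foldl ?st (fst p) (snd p))"
  proof (rule PT_foldl_base[where G = "\<lambda>n. n + n * g n"])
    show "pol (\<lambda>n. n + n * g n)" using assms(2) by (intro pol_intros)
    show "mono (\<lambda>n. n + n * g n)" by (intro monoI add_mono mult_le_mono monoD[OF assms(3)])
    show "PT (\<lambda>a. (fst a, step (fst a) (snd a) b))" if "b \<in> {1..K}" for b
      using assms(1)[OF that] by (intro PT_Pair PT_fst_base)
    fix a :: "'e \<times> 'a" and ys :: "nat list" assume "ok a" "ok ys"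
    then have "sz (foldl (step (fst a)) (snd a) ys) \<le> sz (snd a) + length ys * g (sz (fst a))"
      by (intro size) auto
    also have "\<dots> \<le> sz (snd a) + (sz a + length ys) * g (sz a + length ys)"
      by (intro add_left_mono mult_le_mono monoD[OF assms(3)]) auto
    finally show "sz (foldl ?st a ys) \<le> (sz a + length ys) + (sz a + length ys) * g (sz a + length ys)"
      using fold[of "fst a" "snd a" ys] by simp
  qed
  from PT_comp[OF this PT_Pair[OF PT_Pair[OF assms(5,6)] assms(7)]]
  have "PT (\<lambda>x. foldl ?st (e x, i x) (xs x))" by simp
  from PT_comp[OF PT_snd_base this] show ?thesis by (simp add: fold)
qed

end

section \<open>Machines for polynomial-time functions\<close>

definition coins :: "nat \<Rightarrow> bool list pmf" where
  "coins m = replicate_pmf m (bernoulli_pmf (1/2))"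

lemma coins_0 [simp]: "coins 0 = return_pmf []"
  by (simp add: coins_def)

lemma coins_Suc: "coins (Suc m) = bind_pmf (bernoulli_pmf (1/2)) (\<lambda>b. map_pmf ((#) b) (coins m))"
  by (simp add: coins_def map_pmf_def)

lemma finite_bitstrings [simp]: "finite {bs :: bool list. length bs = m}"
  using finite_lists_length_eq[of "UNIV :: bool set" m] by simp

lemma card_bitstrings [simp]: "card {bs :: bool list. length bs = m} = 2 ^ m"
  using card_lists_length_eq[of "UNIV :: bool set" m] by simp

lemma bitstrings_nonempty [simp]: "{bs :: bool list. length bs = m} \<noteq> {}"
  using Ex_list_of_length[of m] by auto

lemma pmf_bitstrings: "pmf (pmf_of_set {bs :: bool list. length bs = m}) w = (if length w = m then 1 / 2 ^ m else 0)"
  by (subst pmf_of_set[OF bitstrings_nonempty finite_bitstrings]) simp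

text \<open>The machine model tosses bit by bit, whereas the probability estimates count uniform
  strings.\<close>

lemma coins_eq: "coins m = pmf_of_set {bs. length bs = m}"
proof (induction m)
  case (Suc m)
  show ?case
  proof (rule pmf_eqI)
    fix w :: "bool list"
    have "pmf (coins (Suc m)) w = (pmf (map_pmf ((#) True) (coins m)) w + pmf (map_pmf ((#) False) (coins m)) w) / 2"
      by (simp add: coins_Suc pmf_bind)
    also have "\<dots> = pmf (pmf_of_set {bs. length bs = Suc m}) w"
    proof (cases w)
      case Nil
      then have "pmf (map_pmf ((#) b) (coins m)) w = 0" for b
        by (subst pmf_eq_0_set_pmf) auto
      then show ?thesis using Nil by (simp add: pmf_bitstrings)
    next
      case (Cons a v)
      have "pmf (map_pmf ((#) a) (coins m)) w = pmf (coins m) v"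
        unfolding Cons by (rule pmf_map_inj') (simp add: inj_def)
      moreover have "pmf (map_pmf ((#) (\<not> a)) (coins m)) w = 0"
        using Cons by (subst pmf_eq_0_set_pmf) auto
      ultimately show ?thesis using Cons by (cases a) (auto simp: Suc pmf_bitstrings)
    qed
    finally show "pmf (coins (Suc m)) w = pmf (pmf_of_set {bs. length bs = Suc m}) w" .
  qed
qed (simp add: pmf_of_set_singleton)

text \<open>All coins may be drawn in advance. A probabilistic run becomes a deterministic fold over
  the coin string, which can be simulated and whose outcomes can be counted.\<close>

lemma prun_eq: "prun P T c = map_pmf (foldl (pstep P) c) (coins T)"
  by (induction T arbitrary: c)
    (simp_all add: coins_Suc map_bind_pmf pmf.map_comp o_def pstep_def)

lemma prun_add: "prun P (i + j) c = bind_pmf (prun P i c) (prun P j)"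
  by (induction i arbitrary: c) (auto simp: bind_return_pmf bind_assoc_pmf)

lemma set_coins [simp]: "set_pmf (coins m) = {bs. length bs = m}"
  unfolding coins_eq by (rule set_pmf_of_set[OF bitstrings_nonempty finite_bitstrings])

lemma reach_prun: "reach P T c c' \<Longrightarrow> prun P T c = return_pmf c'"
  unfolding prun_eq reach_def
  by (subst map_pmf_cong[OF refl, of _ _ "\<lambda>_. c'"]) simp_all

lemma foldl_const_step: "foldl (pstep (M, M)) c w = (step M ^^ length w) c"
  by (induction w arbitrary: c) (simp_all add: pstep_def funpow_swap1)

lemma reach_funpow: "reach (M, M) T c c' \<Longrightarrow> (step M ^^ T) c = c'"
  unfolding reach_def foldl_const_step by (drule spec[of _ "replicate T True"]) simp

lemma halted_funpow: "halted M c \<Longrightarrow> (step M ^^ k) c = c"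
  by (induction k) (auto simp: step_def)

lemma halted_foldl:
  "halted (fst P) c \<Longrightarrow> halted (snd P) c \<Longrightarrow> foldl (pstep P) c w = c"
  by (induction w) (auto simp: pstep_def step_def)

sublocale tracks \<subseteq> alphabet K
  by standard (rule K2)

context tracks
begin

lemma wr_less: "a \<le> K \<Longrightarrow> wr v a x < A"
proof -
  assume "a \<le> K"
  then have "set ((dec_sym x)[v := a]) \<subseteq> {..<B}"
    using set_digs[of B V x] set_update_subset_insert[of "dec_sym x" v a] by (auto simp: less_Suc_eq_le)
  from code_less[OF this] show ?thesis unfolding wr_def by simp
qed

definition shape_rows :: "nat \<Rightarrow> tm \<Rightarrow> bool" where
  "shape_rows m rs \<longleftrightarrow> (\<forall>r\<in>set rs. length r = A \<and> (\<forall>(q, s, d)\<in>set r. q \<le> m \<and> s < A))"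

lemma shape_rowI: "(\<And>x q s d. x < A \<Longrightarrow> f x = (q, s, d) \<Longrightarrow> q \<le> m \<and> s < A) \<Longrightarrow> shape_rows m [row f]"
  unfolding shape_rows_def row_def by force

lemma shape_rows_append: "shape_rows m (rs @ rs') \<longleftrightarrow> shape_rows m rs \<and> shape_rows m rs'"
  by (auto simp: shape_rows_def)

lemma shape_rows_Cons: "shape_rows m (r # rs) \<longleftrightarrow> shape_rows m [r] \<and> shape_rows m rs"
  by (auto simp: shape_rows_def)

lemma shape_compile: "coms K c \<Longrightarrow> p + clen c \<le> m \<Longrightarrow> shape_rows m (compile p c)"
proof (induction c arbitrary: p)
  case Skip
  then show ?case by (simp add: shape_rows_def)
next
  case (Push v a)
  then show ?case
    by (auto simp: shape_rows_Cons[of _ _ "[_]"] scan_right_def go_home_def intro!: shape_rowI wr_less split: if_splits)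
next
  case (Seq c d)
  then show ?case by (simp add: shape_rows_append)
next
  case (IfPop v a c d)
  have "shape_rows m [row (scan_right p v (\<lambda>x. (p + 1, x, MoveL)))]"
    "shape_rows m [row (\<lambda>x. if dec_sym x ! v = a then (p + 2, wr v 0 x, MoveL) else (p + 3, x, Stay))]"
    "shape_rows m [row (go_home (p + 2) (p + 4))]"
    "shape_rows m [row (go_home (p + 3) (p + 5 + clen c))]"
    "shape_rows m [row (\<lambda>x. (p + 5 + clen c + clen d, x, Stay))]"
    using IfPop.prems
    by (auto simp: scan_right_def go_home_def intro!: shape_rowI wr_less split: if_splits)
  moreover have "shape_rows m (compile (p + 4) c)" "shape_rows m (compile (p + 5 + clen c) d)"
    using IfPop by auto
  ultimately show ?case
    by (simp add: shape_rows_def ball_Un)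
next
  case (While v c)
  have "shape_rows m [row (\<lambda>x. (if dec_sym x ! v \<noteq> 0 then p + 1 else p + 2 + clen c, x, Stay))]"
    "shape_rows m [row (\<lambda>x. (p, x, Stay))]"
    using While.prems by (auto intro!: shape_rowI split: if_splits)
  moreover have "shape_rows m (compile (p + 1) c)"
    using While by auto
  ultimately show ?case
    by (simp add: shape_rows_def ball_Un)
qed

lemma tm_shape_compile: "coms K c \<Longrightarrow> 1 \<le> clen c \<Longrightarrow> tm_shape (clen c) A (compile 0 c)"
proof -
  assume c: "coms K c" "1 \<le> clen c"
  have "B \<le> A" using power_increasing[of 1 V B] V1 by simp
  then have "3 \<le> A" using K2 by simp
  then show ?thesis
    using shape_compile[OF c(1), of 0 "clen c"] c(2) by (simp add: tm_shape_def shape_rows_def)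
qed

lemma valid_sto: "ok x \<Longrightarrow> valid (sto x)"
  using ok_sto by (auto simp: valid_def)

lemma siz_sto: "width TYPE('a) \<le> V \<Longrightarrow> siz (sto (x :: 'a::reg)) = sz x"
  by (simp add: siz_def sz_eq_sum)

lemma tp_bits: "tp (sto (bs :: bool list)) i =
  (if 0 \<le> i \<and> i < int (length bs) then (if rev bs ! nat i then 2 else 1) else 0)"
proof (cases "i < 0")
  case False
  have "[0..<V] = 0 # [1..<V]" using V1 by (simp add: upt_rec)
  moreover have "map (\<lambda>v. track (sto bs v) (nat i)) [1..<V] = replicate (V - 1) 0"
    by (auto simp: sto_def track_def list_eq_iff_nth_eq)
  ultimately have "tp (sto bs) i = track (sto bs 0) (nat i)"
    using False by (simp add: tp_def)
  also have "\<dots> = (if i < int (length bs) then (if rev bs ! nat i then 2 else 1) else 0)"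
    using False by (auto simp: sto_def track_def rev_map)
  finally show ?thesis using False by simp
qed (simp add: tp_def)

text \<open>Cell 0 holds the bottom of a register. This is where the reversals in the statements
  about compiled machines come from.\<close>

lemma init_config_eq: "init_config w = conf 0 0 (sto (rev w))"
  by (auto simp: init_config_def conf_def tp_bits fun_eq_iff)

lemma tape_output_conf: "tape_output (conf q h (sto (bs :: bool list))) = rev bs"
proof -
  have L: "(LEAST n. tp (sto bs) (int n) \<notin> {1, 2}) = length bs"
    by (rule Least_equality) (auto simp: tp_bits split: if_splits)
  have "map (\<lambda>i. tp (sto bs) (int i) = 2) [0..<length bs] = rev bs"
    by (rule nth_equalityI) (auto simp: tp_bits)
  then show ?thesis
    by (simp only: tape_output_def conf_def config.select_convs L)
qed

end

lemma (in alphabet) PT_tm: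
  fixes f :: "bool list \<Rightarrow> bool list"
  assumes "PT f"
  obtains M p where "wf_tm M" "pol p" "\<And>w T. p (length w) \<le> T \<Longrightarrow> tm_result M w T = Some (rev (f (rev w)))"
proof -
  obtain c p where c: "coms K c" "pol p" "mono p" "\<And>x. ok x \<Longrightarrow> ok (f x)"
    "\<And>x. ok x \<Longrightarrow> \<exists>t \<le> p (sz x). run c (sto x) t (sto (f x))" by (rule PTE[OF assms]) blast
  obtain X where X: "regs c \<subseteq> {..<X}" "1 \<le> X"
  proof -
    from finite_nat_bounded[OF finite_regs[of c]] obtain k where "regs c \<subseteq> {..<k}" by blast
    then show ?thesis by (intro that[of "k + 1"]) auto
  qed
  \<comment> \<open>The loop on the untouched register \<open>X\<close> does nothing; it guarantees
    at least one row, which \<open>tm_shape\<close> demands even if \<open>c\<close> is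
    \<open>Skip\<close>.\<close>
  define c' where "c' = Seq c (While X Skip)"
  interpret tracks K "Suc X" by standard (use K2 in auto)
  let ?M = "compile 0 c'"
  let ?t = "\<lambda>n. p n + 1" let ?T = "\<lambda>n. ?t n * (2 * (n + ?t n) + 4)"
  show ?thesis
  proof (rule that)
    have "tm_shape (clen c') A ?M" using c(1) by (intro tm_shape_compile) (auto simp: c'_def)
    then show "wf_tm ?M" unfolding wf_tm_def by blast
    show "pol ?T" using c(2) by (intro pol_intros)
    fix w :: "bool list" and T assume T: "?T (length w) \<le> T"
    from c(5)[of "rev w"] obtain t where t: "t \<le> p (length w)" "run c (sto (rev w)) t (sto (f (rev w)))" by auto
    have "run c' (sto (rev w)) (t + 1) (sto (f (rev w)))"
      unfolding c'_def using X by (intro run_Seq[OF t(2)] run_Done) (simp add: sto_def)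
    moreover have "regs c' \<subseteq> {..<Suc X}" "coms K c'" using X c(1) by (auto simp: c'_def)
    moreover have "code_at ?M 0 (compile 0 c')" unfolding code_at_def by auto
    moreover have "siz (sto (rev w)) = length w" by (subst siz_sto) auto
    ultimately obtain T' where T': "T' \<le> (t + 1) * (2 * (length w + (t + 1)) + 4)"
      "reach (?M, ?M) T' (conf 0 0 (sto (rev w))) (conf (clen c') 0 (sto (f (rev w))))"
      using compile_correct[of c' "sto (rev w)" "t + 1" "sto (f (rev w))" "(?M, ?M)" 0 "2 * (length w + (t + 1)) + 4"]
      by (auto simp: valid_sto)
    have "(t + 1) * (2 * (length w + (t + 1)) + 4) \<le> ?T (length w)"
      using t(1) by (intro mult_le_mono add_le_mono) auto
    then have "T' \<le> T" using T'(1) T by linarith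
    then obtain k where k: "T = k + T'" by (metis le_add_diff_inverse2)
    have "halted ?M (conf (clen c') 0 (sto (f (rev w))))" by (simp add: halted_def conf_def)
    moreover from this have "(step ?M ^^ T) (init_config w) = conf (clen c') 0 (sto (f (rev w)))"
      unfolding k funpow_add o_apply init_config_eq reach_funpow[OF T'(2)] by (rule halted_funpow)
    ultimately show "tm_result ?M w T = Some (rev (f (rev w)))"
      by (simp add: tm_result_def Let_def tape_output_conf)
  qed
qed

context tracks
begin

section \<open>Drawing coins into a register\<close>

definition flip_loop :: "bool \<Rightarrow> com" where
  "flip_loop b = While 2 (IfPop 2 1 (Push 1 (sy b)) Skip)"

lemma clen_flip_loop [simp]: "clen (flip_loop b) = 9"
  by (simp add: flip_loop_def)

lemma compile_flip_loop: "compile p (flip_loop b) =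
  [row (\<lambda>x. (if dec_sym x ! 2 \<noteq> 0 then p + 1 else p + 9, x, Stay)),
   row (scan_right (p + 1) 2 (\<lambda>x. (p + 2, x, MoveL))),
   row (\<lambda>x. if dec_sym x ! 2 = 1 then (p + 3, wr 2 0 x, MoveL) else (p + 4, x, Stay)),
   row (go_home (p + 3) (p + 5)),
   row (go_home (p + 4) (p + 8)),
   row (scan_right (p + 5) 1 (\<lambda>x. (p + 6, wr 1 (sy b) x, MoveL))),
   row (go_home (p + 6) (p + 7)),
   row (\<lambda>x. (p + 8, x, Stay)),
   row (\<lambda>x. (p, x, Stay))]"
  by (simp add: flip_loop_def eval_nat_numeral cong: if_cong)

definition flip_store :: "nat list \<Rightarrow> bool list \<Rightarrow> nat \<Rightarrow> store" where
  "flip_store xs w m = (\<lambda>i. if i = 0 then xs else if i = 1 then map sy w else if i = 2 then replicate m 1 else [])"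

text \<open>The two tables differ only in the symbol that the \<open>Push\<close> of the loop body writes, so exactly
  one coin per iteration is used, and the running time does not depend on the coins.\<close>
lemma prun_flip_loop:
  assumes "code_at (fst P) p (compile p (flip_loop False))" "code_at (snd P) p (compile p (flip_loop True))"
    "set xs \<subseteq> {1..K}" "3 \<le> V"
  shows "\<exists>T \<le> (m + 1) * (8 * (n + m) + 20). \<forall>w. length w = n \<longrightarrow>
    prun P T (conf p 0 (flip_store xs w m)) =
      map_pmf (\<lambda>v. conf (p + 9) 0 (flip_store xs (rev v @ w) 0)) (coins m)"
proof -
  have rows: "both P (\<lambda>x. (if dec_sym x ! 2 \<noteq> 0 then p + 1 else p + 9, x, Stay)) p"
    "both P (scan_right (p + 1) 2 (\<lambda>x. (p + 1 + 1, x, MoveL))) (p + 1)"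
    "both P (\<lambda>x. if dec_sym x ! 2 = 1 then (p + 1 + 2, wr 2 0 x, MoveL) else (p + 1 + 3, x, Stay)) (p + 1 + 1)"
    "both P (go_home (p + 1 + 2) (p + 5)) (p + 1 + 2)"
    "both P (go_home (p + 6) (p + 7)) (p + 6)"
    "both P (\<lambda>x. (p + 8, x, Stay)) (p + 7)"
    "both P (\<lambda>x. (p, x, Stay)) (p + 8)"
    using assms(1,2) unfolding compile_flip_loop code_at_Cons by (simp_all add: eval_nat_numeral cong: if_cong)
  define tab where "tab b = (if b then snd P else fst P)" for b
  have push_row: "p + 5 < length (tab b)" "tab b ! (p + 5) = row (scan_right (p + 5) 1 (\<lambda>x. (p + 6, wr 1 (sy b) x, MoveL)))" for b
    using assms(1,2) unfolding compile_flip_loop code_at_Cons by (auto simp: tab_def eval_nat_numeral)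
  show ?thesis
proof (induction m arbitrary: n)
  case 0
  have "reach P 1 (conf p 0 (flip_store xs w 0)) (conf (p + 9) 0 (flip_store xs w 0))" for w
  proof -
    have "valid (flip_store xs w 0)" using assms(3) K2 by (auto simp: valid_def flip_store_def)
    from reach_test[OF rows(1) this] assms(4) show ?thesis by (simp add: flip_store_def)
  qed
  then have "prun P 1 (conf p 0 (flip_store xs w 0)) = return_pmf (conf (p + 9) 0 (flip_store xs w 0))" for w
    by (rule reach_prun)
  then show ?case by (intro exI[of _ 1]) (simp del: prun.simps One_nat_def)
next
  case (Suc m)
  \<comment> \<open>One round: test, pop, scan to the end of track 1, write, walk home and two
    jumps. Only the write depends on the coin.\<close>
  let ?t = "(1 + (2 * Suc m + 2) + n) + Suc (Suc n + 1 + 1)"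
  have iter: "prun P ?t (conf p 0 (flip_store xs w (Suc m))) =
      map_pmf (\<lambda>b. conf p 0 (flip_store xs (b # w) m)) (bernoulli_pmf (1/2))" if w: "length w = n" for w
  proof -
    let ?s = "flip_store xs w (Suc m)" and ?s1 = "flip_store xs w m"
    have v: "valid ?s" "valid ?s1" "valid (flip_store xs (b # w) m)" for b
      using assms(3) K2 by (auto simp: valid_def flip_store_def)
    have "reach P 1 (conf p 0 ?s) (conf (if ?s 2 \<noteq> [] then p + 1 else p + 9) 0 ?s)"
      using assms(4) by (intro reach_test rows v) auto
    then have 1: "reach P 1 (conf p 0 ?s) (conf (p + 1) 0 ?s)" by (simp add: flip_store_def)
    have "reach P (2 * length (?s 2) + 2) (conf (p + 1) 0 ?s) (conf (p + 5) 0 (?s(2 := replicate m 1)))"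
      using assms(4) by (intro reach_Pop[OF rows(2,3,4)] v) (auto simp: flip_store_def)
    moreover have "?s(2 := replicate m 1) = ?s1" by (auto simp: flip_store_def fun_eq_iff)
    ultimately have 2: "reach P (2 * Suc m + 2) (conf (p + 1) 0 ?s) (conf (p + 5) 0 ?s1)"
      by (simp add: flip_store_def)
    have scan: "reach P i (conf (p + 5) 0 ?s1) (conf (p + 5) (int i) ?s1)" if "i \<le> n" for i
      using that
    proof (induction i)
      case (Suc i)
      have "track (?s1 1) i \<in> {1..K}"
        using Suc.prems w validD[OF v(2), of 1] assms(4) by (intro track_in) (auto simp: flip_store_def)
      then have nz: "dec_sym (tp ?s1 (int i)) ! 1 \<noteq> 0"
        using assms(4) v(2) by (simp add: dec_tp_nth)
      have "step (tab b) (conf (p + 5) (int i) ?s1) = conf (p + 5) (int i + 1) ?s1" for b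
        using step_row[where T = "tp ?s1" and h = "int i", OF push_row[of b] tp_less[OF v(2)], of "p + 5" "tp ?s1 (int i)" MoveR] nz
        by (simp add: scan_right_def conf_def)
      from this[of True] this[of False]
      have "reach P 1 (conf (p + 5) (int i) ?s1) (conf (p + 5) (int i + 1) ?s1)"
        by (intro reach_1) (simp_all add: tab_def)
      from reach_trans[OF Suc.IH this] Suc.prems show ?case by (simp add: add.commute)
    qed simp
    have flip: "step (tab b) (conf (p + 5) (int n) ?s1) = conf (p + 6) (int n - 1) (flip_store xs (b # w) m)" for b
    proof -
      have "dec_sym (tp ?s1 (int n)) ! 1 = 0"
        using assms(4) v(2) w by (simp add: dec_tp_nth flip_store_def track_def)
      then have "step (tab b) (conf (p + 5) (int n) ?s1) =
          \<lparr>state = p + 6, head = int n + shift MoveL, tape = (tp ?s1)(int n := wr 1 (sy b) (tp ?s1 (int n)))\<rparr>"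
        using step_row[where T = "tp ?s1" and h = "int n", OF push_row[of b] tp_less[OF v(2)]]
        by (simp add: scan_right_def conf_def)
      also have "(tp ?s1)(int n := wr 1 (sy b) (tp ?s1 (int n))) = tp (?s1(1 := map sy (b # w)))"
        using assms(4) v(2) w by (intro tp_update) (auto simp: track_Cons flip_store_def)
      also have "?s1(1 := map sy (b # w)) = flip_store xs (b # w) m"
        by (auto simp: flip_store_def fun_eq_iff)
      finally show ?thesis by (simp add: conf_def)
    qed
    have home: "reach P (Suc n + 1 + 1) (conf (p + 6) (int n - 1) (flip_store xs (b # w) m)) (conf p 0 (flip_store xs (b # w) m))" for b
    proof -
      have "reach P (Suc n) (conf (p + 6) (int n - 1) (flip_store xs (b # w) m)) (conf (p + 7) 0 (flip_store xs (b # w) m))"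
        using assms(4) w by (intro reach_home rows v tp_nonzero[OF v(3), of 1]) (auto simp: flip_store_def)
      from reach_trans[OF reach_trans[OF this reach_goto[OF rows(6) v(3)]] reach_goto[OF rows(7) v(3)]]
      show ?thesis .
    qed
    have "prun P (1 + (2 * Suc m + 2) + n) (conf p 0 ?s) = return_pmf (conf (p + 5) (int n) ?s1)"
      by (rule reach_prun) (rule reach_trans[OF reach_trans[OF 1 2] scan[OF order_refl]])
    moreover have "prun P (Suc (Suc n + 1 + 1)) (conf (p + 5) (int n) ?s1) =
        map_pmf (\<lambda>b. conf p 0 (flip_store xs (b # w) m)) (bernoulli_pmf (1/2))"
      unfolding prun.simps(2) flip[unfolded tab_def] reach_prun[OF home]
      by (simp add: map_pmf_def)
    ultimately show ?thesis by (subst prun_add) (simp add: bind_return_pmf)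
  qed
  obtain T where T: "T \<le> (m + 1) * (8 * (Suc n + m) + 20)" and
    rec: "\<And>w. length w = Suc n \<Longrightarrow> prun P T (conf p 0 (flip_store xs w m)) =
      map_pmf (\<lambda>v. conf (p + 9) 0 (flip_store xs (rev v @ w) 0)) (coins m)"
    using Suc.IH[of "Suc n"] by blast
  have "prun P (?t + T) (conf p 0 (flip_store xs w (Suc m))) =
      map_pmf (\<lambda>v. conf (p + 9) 0 (flip_store xs (rev v @ w) 0)) (coins (Suc m))" if w: "length w = n" for w
  proof -
    have "prun P (?t + T) (conf p 0 (flip_store xs w (Suc m))) =
        bind_pmf (bernoulli_pmf (1/2)) (\<lambda>b. prun P T (conf p 0 (flip_store xs (b # w) m)))"
      unfolding prun_add[of P ?t T] iter[OF w] bind_map_pmf ..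
    also have "\<dots> = bind_pmf (bernoulli_pmf (1/2))
        (\<lambda>b. map_pmf (\<lambda>v. conf (p + 9) 0 (flip_store xs (rev v @ b # w) 0)) (coins m))"
      using rec w by simp
    also have "\<dots> = map_pmf (\<lambda>v. conf (p + 9) 0 (flip_store xs (rev v @ w) 0)) (coins (Suc m))"
      by (simp add: coins_Suc map_bind_pmf pmf.map_comp o_def)
    finally show ?thesis .
  qed
  moreover have "?t + T \<le> (Suc m + 1) * (8 * (n + Suc m) + 20)"
    using T by simp
  ultimately show ?case by blast
qed
qed

end

lemma polynomial_fun_pol: "polynomial_fun (\<lambda>n. a * Suc n ^ e)"
  unfolding polynomial_fun_def
  by (rule exI[of _ "smult (real a) ([:1, 1:] ^ e)"]) (simp add: poly_power)

lemma reach_halted: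
  assumes "reach P i c c'" "halted (fst P) c'" "halted (snd P) c'" "i \<le> T"
  shows "reach P T c c'"
proof -
  have "reach P (T - i) c' c'" using halted_foldl[OF assms(2,3)] by (simp add: reach_def)
  from reach_trans[OF assms(1) this] show ?thesis using assms(4) by simp
qed

text \<open>The initial program leaves \<open>(x, [], R x)\<close>: the input, an empty register for
  the coins and a counter. The tables have the same shape and differ only in the symbol pushed by
  \<open>flip_loop\<close>. A run that ends early idles in the halting state, so the step count can
  be rounded up to a polynomial in \<open>length x\<close>.\<close>

lemma (in alphabet) PT_ppt:
  fixes f :: "bool list \<times> bool list \<Rightarrow> bool list" and R :: "bool list \<Rightarrow> nat"
  assumes "PT f" "PT R"
  shows "PPT (\<lambda>x. map_pmf (\<lambda>w. rev (f (rev x, rev w))) (coins (R (rev x))))"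
proof -
  let ?h = "\<lambda>x :: bool list. (x, [] :: bool list, R x)"
  have "PT ?h" by (intro PT_intros assms)
  then obtain c p where c: "coms K c" "pol p" "mono p" "\<And>x. ok x \<Longrightarrow> ok (?h x)"
    "\<And>x. ok x \<Longrightarrow> \<exists>t \<le> p (sz x). run c (sto x) t (sto (?h x))" by (rule PTE) blast
  obtain d q where d: "coms K d" "pol q" "mono q" "\<And>x. ok x \<Longrightarrow> ok (f x)"
    "\<And>x. ok x \<Longrightarrow> \<exists>t \<le> q (sz x). run d (sto x) t (sto (f x))" by (rule PTE[OF assms(1)]) blast
  obtain g where g: "pol g" "mono g" "\<And>x. ok x \<Longrightarrow> sz (R x) \<le> g (sz x)" by (rule PT_size[OF assms(2)]) blast
  obtain X where X: "regs c \<union> regs d \<subseteq> {..<X}" "3 \<le> X"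
  proof -
    have "finite (regs c \<union> regs d)" by simp
    from finite_nat_bounded[OF this] obtain k where "regs c \<union> regs d \<subseteq> {..<k}" by blast
    then show ?thesis by (intro that[of "k + 3"]) auto
  qed
  interpret tracks K X by standard (use K2 X in auto)
  define cc where "cc b = Seq c (Seq (flip_loop b) d)" for b
  let ?P = "(compile 0 (cc False), compile 0 (cc True))"
  let ?e = "clen c + 9 + clen d"
  have cc: "coms K (cc b)" "clen (cc b) = ?e" for b
    using c(1) d(1) K2 by (auto simp: cc_def flip_loop_def)
  have at: "code_at (compile 0 (cc b)) 0 (compile 0 c)"
    "code_at (compile 0 (cc b)) (clen c) (compile (clen c) (flip_loop b))"
    "code_at (compile 0 (cc b)) (clen c + 9) (compile (clen c + 9) d)" for b
  proof -
    have "code_at (compile 0 (cc b)) 0 (compile 0 (cc b))" unfolding code_at_def by auto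
    then show "code_at (compile 0 (cc b)) 0 (compile 0 c)"
      "code_at (compile 0 (cc b)) (clen c) (compile (clen c) (flip_loop b))"
      "code_at (compile 0 (cc b)) (clen c + 9) (compile (clen c + 9) d)"
      unfolding cc_def by (simp_all add: code_at_append)
  qed
  let ?T1 = "\<lambda>n. p n * (2 * (n + p n) + 4)"
  let ?T2 = "\<lambda>n. (g n + 1) * (8 * (0 + g n) + 20)"
  let ?T3 = "\<lambda>n. q (n + g n) * (2 * (n + g n + q (n + g n)) + 4)"
  have "pol (\<lambda>n. q (n + g n))" by (rule pol_comp[OF d(2)]) (intro pol_intros g)
  then have "pol (\<lambda>n. ?T1 n + ?T2 n + ?T3 n)" by (intro pol_intros c g)
  then obtain a e where ae: "\<And>n. ?T1 n + ?T2 n + ?T3 n \<le> a * Suc n ^ e" by (rule polE) blast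
  let ?Q = "\<lambda>n. a * Suc n ^ e"
  have main: "prun ?P (?Q (length x)) (init_config x) =
      map_pmf (\<lambda>v. conf ?e 0 (sto (f (rev x, rev v)))) (coins (R (rev x)))" for x
  proof -
    let ?n = "length x" and ?r = "R (rev x)"
    from g(3)[of "rev x"] have r: "?r \<le> g ?n" by simp
    from c(5)[of "rev x"] obtain t1 where t1: "t1 \<le> p ?n" "run c (sto (rev x)) t1 (sto (?h (rev x)))" by auto
    have s1: "siz (sto (rev x)) = ?n" using X(2) by (subst siz_sto) auto
    obtain T1 where "T1 \<le> t1 * (2 * (?n + t1) + 4)" and
      T1: "reach ?P T1 (conf 0 0 (sto (rev x))) (conf (clen c) 0 (sto (?h (rev x))))"
      using compile_correct[OF t1(2) c(1), of ?P 0 "2 * (?n + t1) + 4"] X(1) at(1) s1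
      by (auto simp: valid_sto)
    moreover have "t1 * (2 * (?n + t1) + 4) \<le> ?T1 ?n" using t1(1) by (intro mult_le_mono add_le_mono) auto
    ultimately have T1': "T1 \<le> ?T1 ?n" by linarith
    have fs: "sto (?h (rev x)) = flip_store (map sy (rev x)) [] ?r"
      by (auto simp: sto_def flip_store_def fun_eq_iff nth_Cons split: nat.splits)
    have "set (map sy (rev x)) \<subseteq> {1..K}" using K2 by auto
    from prun_flip_loop[of ?P "clen c" "map sy (rev x)" ?r 0, OF _ _ this X(2)]
    obtain T2 where "T2 \<le> (?r + 1) * (8 * (0 + ?r) + 20)" and
      T2: "prun ?P T2 (conf (clen c) 0 (flip_store (map sy (rev x)) [] ?r)) =
        map_pmf (\<lambda>v. conf (clen c + 9) 0 (flip_store (map sy (rev x)) (rev v @ []) 0)) (coins ?r)"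
      using at(2) by auto
    moreover have "(?r + 1) * (8 * (0 + ?r) + 20) \<le> ?T2 ?n" using r by (intro mult_le_mono add_le_mono) auto
    ultimately have T2': "T2 \<le> ?T2 ?n" by linarith
    have fs': "flip_store (map sy (rev x)) (rev v @ []) 0 = sto (rev x, rev v)" for v
      by (auto simp: sto_def flip_store_def fun_eq_iff nth_Cons split: nat.splits)
    have hlt: "halted (fst ?P) (conf ?e 0 s)" "halted (snd ?P) (conf ?e 0 s)" for s
      by (simp_all add: halted_def conf_def cc)
    have T3: "reach ?P (?Q ?n - T1 - T2) (conf (clen c + 9) 0 (sto (rev x, rev v))) (conf ?e 0 (sto (f (rev x, rev v))))"
      if v: "length v = ?r" for v
    proof -
      have "sz (rev x, rev v) = ?n + ?r" using v by simp
      with d(5)[of "(rev x, rev v)"] obtain t3 where t3: "t3 \<le> q (?n + ?r)"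
        "run d (sto (rev x, rev v)) t3 (sto (f (rev x, rev v)))" by auto
      have "siz (sto (rev x, rev v)) = ?n + ?r" using X(2) v by (subst siz_sto) auto
      then obtain T3 where T3: "T3 \<le> t3 * (2 * (?n + ?r + t3) + 4)"
        "reach ?P T3 (conf (clen c + 9) 0 (sto (rev x, rev v))) (conf ?e 0 (sto (f (rev x, rev v))))"
        using compile_correct[OF t3(2) d(1), of ?P "clen c + 9" "2 * (?n + ?r + t3) + 4"] X(1) at(3)
        by (auto simp: valid_sto)
      have "t3 \<le> q (?n + g ?n)" using t3(1) monoD[OF d(3), of "?n + ?r" "?n + g ?n"] r by simp
      then have "t3 * (2 * (?n + ?r + t3) + 4) \<le> ?T3 ?n" using r by (intro mult_le_mono add_le_mono) auto
      then have "T3 \<le> ?Q ?n - T1 - T2" using T3(1) T1' T2' ae[of ?n] by linarith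
      from reach_halted[OF T3(2) hlt this] show ?thesis .
    qed
    let ?T3 = "?Q ?n - T1 - T2"
    have Q: "T1 + (T2 + ?T3) = ?Q ?n" using T1' T2' ae[of ?n] by linarith
    have later: "prun ?P (T2 + ?T3) = (\<lambda>c. bind_pmf (prun ?P T2 c) (prun ?P ?T3))"
      by (rule ext) (rule prun_add)
    have "prun ?P (?Q ?n) (init_config x) =
        bind_pmf (prun ?P T1 (init_config x)) (\<lambda>c. bind_pmf (prun ?P T2 c) (prun ?P (?Q ?n - T1 - T2)))"
      using prun_add[of ?P T1 "T2 + ?T3" "init_config x"] unfolding Q later .
    also have "\<dots> = bind_pmf (coins ?r) (\<lambda>v. prun ?P (?Q ?n - T1 - T2) (conf (clen c + 9) 0 (sto (rev x, rev v))))"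
      unfolding init_config_eq reach_prun[OF T1] bind_return_pmf fs T2 fs' bind_map_pmf ..
    also have "\<dots> = bind_pmf (coins ?r) (\<lambda>v. return_pmf (conf ?e 0 (sto (f (rev x, rev v)))))"
      by (intro bind_pmf_cong refl reach_prun T3) simp
    finally show ?thesis by (simp add: map_pmf_def)
  qed
  have "wf_ptm ?P"
    unfolding wf_ptm_def fst_conv snd_conv using tm_shape_compile[OF cc(1)] cc(2) by (metis le_add2 one_le_numeral order_trans add.assoc add.commute)
  moreover have "\<forall>x. (\<forall>c\<in>set_pmf (prun ?P (?Q (length x)) (init_config x)). halted (fst ?P) c) \<and>
      map_pmf (\<lambda>w. rev (f (rev x, rev w))) (coins (R (rev x))) =
        map_pmf tape_output (prun ?P (?Q (length x)) (init_config x))"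
    unfolding main pmf.map_comp o_def tape_output_conf
    by (auto simp: halted_def conf_def cc)
  ultimately show ?thesis
    unfolding PPT_def using polynomial_fun_pol by blast
qed

section \<open>Closure properties\<close>

primrec loop :: "(nat \<Rightarrow> 'a \<Rightarrow> 'a) \<Rightarrow> nat \<Rightarrow> 'a \<Rightarrow> 'a" where
  "loop f 0 a = a"
| "loop f (Suc n) a = f n (loop f n a)"

context alphabet
begin

lemma PT_foldl:
  fixes step :: "'e::reg \<Rightarrow> 'a::reg \<Rightarrow> bool \<Rightarrow> 'a"
  assumes "\<And>b. PT (\<lambda>p. step (fst p) (snd p) b)" "pol g" "mono g"
    "\<And>e a b. ok e \<Longrightarrow> ok a \<Longrightarrow> sz (step e a b) \<le> sz a + g (sz e)"
    "PT e" "PT i" "PT xs"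
  shows "PT (\<lambda>x. foldl (step (e x)) (i x) (xs x))"
proof -
  have "PT (\<lambda>x. foldl ((\<lambda>e a k. step e a (k = 2)) (e x)) (i x) (map sy (xs x)))"
    by (rule PT_foldl_syms[where g = g]) (use assms in \<open>auto intro!: PT_intros\<close>)
  moreover have "foldl (\<lambda>a k. step e a (k = 2)) i (map sy xs) = foldl (step e) i xs" for e i xs
    by (induction xs arbitrary: i) auto
  ultimately show ?thesis by simp
qed

lemma PT_funpow:
  fixes step :: "'e::reg \<Rightarrow> 'a::reg \<Rightarrow> 'a"
  assumes "PT (\<lambda>p. step (fst p) (snd p))" "pol g" "mono g"
    "\<And>e a. ok e \<Longrightarrow> ok a \<Longrightarrow> sz (step e a) \<le> sz a + g (sz e)"
    "PT e" "PT i" "PT n"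
  shows "PT (\<lambda>x. (step (e x) ^^ n x) (i x))"
proof -
  have "PT (\<lambda>x. foldl ((\<lambda>e a k. step e a) (e x)) (i x) (replicate (n x) (Suc 0)))"
    by (rule PT_foldl_syms[where g = g]) (use assms in \<open>auto intro!: PT_intros\<close>)
  moreover have "foldl (\<lambda>a k. step e a) i (replicate n (Suc 0)) = (step e ^^ n) i" for e i n
    by (induction n arbitrary: i) (auto simp: funpow_swap1)
  ultimately show ?thesis by simp
qed

lemma PT_Suc [PT_intros]: "PT f \<Longrightarrow> PT (\<lambda>x. Suc (f x))"
proof (rule PT_comp[of Suc], rule PTI[of "Push 0 1" "\<lambda>_. 1"])
  fix n :: nat
  have "(sto n)(0 := 1 # sto n 0) = sto (Suc n)" by (auto simp: sto_def fun_eq_iff)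
  then show "ok (Suc n) \<and> (\<exists>t\<le>1. run (Push 0 1) (sto n) t (sto (Suc n)))"
    using run_Push[of 0 1 "sto n"] by (auto intro!: exI[of _ 1])
qed (use K2 in \<open>auto intro: pol_intros\<close>)

lemma PT_Cons_const: "a \<in> {1..K} \<Longrightarrow> PT f \<Longrightarrow> PT (\<lambda>x. (a :: nat) # f x)"
  by (rule PT_comp[OF PT_Cons_base])

lemma PT_Cons_bool: "PT (\<lambda>bs. (b :: bool) # bs)"
proof (rule PTI[of "Push 0 (sy b)" "\<lambda>_. 1"])
  fix bs :: "bool list"
  have "(sto bs)(0 := sy b # sto bs 0) = sto (b # bs)" by (auto simp: sto_def fun_eq_iff)
  then show "ok (b # bs) \<and> (\<exists>t\<le>1. run (Push 0 (sy b)) (sto bs) t (sto (b # bs)))"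
    using run_Push[of 0 "sy b" "sto bs"] by (auto intro!: exI[of _ 1])
qed (use K2 in \<open>auto intro: pol_intros\<close>)

lemma PT_Cons [PT_intros]: "PT p \<Longrightarrow> PT l \<Longrightarrow> PT (\<lambda>x. (p x :: bool) # l x)"
proof -
  assume "PT p" "PT l"
  then have "PT (\<lambda>x. if p x then True # l x else False # l x)"
    by (intro PT_if PT_comp[OF PT_Cons_bool])
  moreover have "(if p x then True # l x else False # l x) = p x # l x" for x by simp
  ultimately show ?thesis by simp
qed

lemma PT_Not [PT_intros]: "PT p \<Longrightarrow> PT (\<lambda>x. \<not> p x)"
  and PT_conj [PT_intros]: "PT p \<Longrightarrow> PT q \<Longrightarrow> PT (\<lambda>x. p x \<and> q x)"
  and PT_disj [PT_intros]: "PT p \<Longrightarrow> PT q \<Longrightarrow> PT (\<lambda>x. p x \<or> q x)"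
  and PT_iff [PT_intros]: "PT p \<Longrightarrow> PT q \<Longrightarrow> PT (\<lambda>x. p x = q x)"
proof -
  assume p: "PT p"
  have "PT (\<lambda>x. if p x then False else True)" by (intro PT_intros p)
  then show not: "PT (\<lambda>x. \<not> p x)" by (simp add: if_bool_eq_conj)
  assume q: "PT q"
  have "PT (\<lambda>x. if p x then q x else False)" by (intro PT_intros p q)
  moreover have "(\<lambda>x. if p x then q x else False) = (\<lambda>x. p x \<and> q x)" by auto
  ultimately show "PT (\<lambda>x. p x \<and> q x)" by simp
  have "PT (\<lambda>x. if p x then True else q x)" by (intro PT_intros p q)
  moreover have "(\<lambda>x. if p x then True else q x) = (\<lambda>x. p x \<or> q x)" by auto
  ultimately show "PT (\<lambda>x. p x \<or> q x)" by simp
  have "PT (\<lambda>x. if p x then q x else if q x then False else True)" by (intro PT_intros p q)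
  moreover have "(\<lambda>x. if p x then q x else if q x then False else True) = (\<lambda>x. p x = q x)" by auto
  ultimately show "PT (\<lambda>x. p x = q x)" by simp
qed

lemma PT_rev [PT_intros]: "PT l \<Longrightarrow> PT (\<lambda>x. rev (l x :: bool list))"
proof -
  assume l: "PT l"
  have "PT (\<lambda>x. foldl ((\<lambda>(e :: bool) acc b. b # acc) True) [] (l x))"
    by (rule PT_foldl[where g = "\<lambda>_. 1"]) (auto intro!: PT_intros pol_intros monoI l)
  moreover have "foldl (\<lambda>acc b. b # acc) zs xs = rev xs @ zs" for xs zs :: "bool list"
    by (induction xs arbitrary: zs) auto
  ultimately show ?thesis by simp
qed

lemma PT_append [PT_intros]: "PT k \<Longrightarrow> PT l \<Longrightarrow> PT (\<lambda>x. k x @ l x :: bool list)"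
proof -
  assume k: "PT k" and l: "PT l"
  have "PT (\<lambda>x. foldl ((\<lambda>(e :: bool) acc b. b # acc) True) (l x) (rev (k x)))"
    by (rule PT_foldl[where g = "\<lambda>_. 1"]) (auto intro!: PT_intros pol_intros monoI k l)
  moreover have "foldl (\<lambda>acc b. b # acc) zs xs = rev xs @ zs" for xs zs :: "bool list"
    by (induction xs arbitrary: zs) auto
  ultimately show ?thesis by simp
qed

lemma PT_rev_syms: "PT l \<Longrightarrow> PT (\<lambda>x. rev (l x :: nat list))"
proof -
  assume l: "PT l"
  have "PT (\<lambda>x. foldl ((\<lambda>(e :: bool) acc b. b # acc) True) [] (l x))"
    by (rule PT_foldl_syms[where g = "\<lambda>_. 1"]) (auto intro!: PT_intros PT_Cons_const pol_intros monoI l)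
  moreover have "foldl (\<lambda>acc b. b # acc) zs xs = rev xs @ zs" for xs zs :: "nat list"
    by (induction xs arbitrary: zs) auto
  ultimately show ?thesis by simp
qed

lemma PT_append_syms: "PT k \<Longrightarrow> PT l \<Longrightarrow> PT (\<lambda>x. k x @ l x :: nat list)"
proof -
  assume k: "PT k" and l: "PT l"
  have "PT (\<lambda>x. foldl ((\<lambda>(e :: bool) acc b. b # acc) True) (l x) (rev (k x)))"
    by (rule PT_foldl_syms[where g = "\<lambda>_. 1"])
      (auto intro!: PT_intros PT_Cons_const PT_rev_syms pol_intros monoI k l)
  moreover have "foldl (\<lambda>acc b. b # acc) zs xs = rev xs @ zs" for xs zs :: "nat list"
    by (induction xs arbitrary: zs) auto
  ultimately show ?thesis by simp
qed

lemma PT_tl_syms: "PT l \<Longrightarrow> PT (\<lambda>x. tl (l x :: nat list))"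
proof -
  assume l: "PT l"
  have "PT (\<lambda>x. case l x of [] \<Rightarrow> (\<lambda>_. []) True | a # as \<Rightarrow> (\<lambda>_ p. fst p) a (as, True))"
    by (rule PT_case_syms) (intro PT_intros l)+
  moreover have "(\<lambda>x. case l x of [] \<Rightarrow> (\<lambda>_. []) True | a # as \<Rightarrow> (\<lambda>_ p. fst p) a (as, True)) = (\<lambda>x. tl (l x))"
    by (auto split: list.split)
  ultimately show ?thesis by simp
qed

lemma PT_bits_of_syms: "PT l \<Longrightarrow> PT (\<lambda>x. map (\<lambda>a. a = 2) (l x :: nat list))"
proof -
  assume l: "PT l"
  have "PT (\<lambda>x. rev (foldl ((\<lambda>(e :: bool) acc b. (b = 2) # acc) True) [] (l x)))"
    by (rule PT_rev, rule PT_foldl_syms[where g = "\<lambda>_. 1"]) (auto intro!: PT_intros pol_intros monoI l)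
  moreover have "foldl (\<lambda>acc b. (b = 2) # acc) zs xs = rev (map (\<lambda>a. a = 2) xs) @ zs" for xs :: "nat list" and zs
    by (induction xs arbitrary: zs) auto
  ultimately show ?thesis by simp
qed

lemma PT_tl [PT_intros]: "PT l \<Longrightarrow> PT (\<lambda>x. tl (l x :: bool list))"
proof -
  assume l: "PT l"
  have "PT (\<lambda>x. map (\<lambda>a. a = 2) (tl (map sy (l x))))"
    by (intro PT_bits_of_syms PT_tl_syms PT_intros l)
  moreover have "map (\<lambda>a. a = 2) (tl (map sy l)) = tl l" for l :: "bool list"
    by (cases l) (auto simp: map_idI)
  ultimately show ?thesis by simp
qed

lemma PT_hd [PT_intros]: "PT l \<Longrightarrow> PT (\<lambda>x. hd (l x :: bool list))"
proof -
  assume l: "PT l"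
  have "PT (\<lambda>x. case map sy (l x) of [] \<Rightarrow> (\<lambda>_. hd []) True | a # as \<Rightarrow> (\<lambda>a _. a = 2) a (as, True))"
    by (rule PT_case_syms) (intro PT_intros l)+
  moreover have "(case map sy l of [] \<Rightarrow> (\<lambda>_. hd []) True | a # as \<Rightarrow> (\<lambda>a _. a = 2) a (as, True)) = hd l" for l :: "bool list"
    by (cases l) auto
  ultimately show ?thesis by simp
qed

lemma PT_null_syms: "PT l \<Longrightarrow> PT (\<lambda>x. (l x :: nat list) = [])"
proof -
  assume l: "PT l"
  have "PT (\<lambda>x. case l x of [] \<Rightarrow> (\<lambda>_. True) True | a # as \<Rightarrow> (\<lambda>a _. False) a (as, True))"
    by (rule PT_case_syms) (intro PT_intros l)+
  moreover have "(case l of [] \<Rightarrow> (\<lambda>_. True) True | a # as \<Rightarrow> (\<lambda>a _. False) a (as, True)) = (l = [])" for l :: "nat list"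
    by (cases l) auto
  ultimately show ?thesis by simp
qed

lemma PT_null [PT_intros]: "PT l \<Longrightarrow> PT (\<lambda>x. (l x :: bool list) = [])"
  using PT_null_syms[of "\<lambda>x. map sy (l x)"] by (auto intro: PT_intros)

lemma PT_length_syms: "PT l \<Longrightarrow> PT (\<lambda>x. length (l x :: nat list))"
proof -
  assume l: "PT l"
  have "PT (\<lambda>x. foldl ((\<lambda>(e :: bool) n b. Suc n) True) 0 (l x))"
    by (rule PT_foldl_syms[where g = "\<lambda>_. 1"]) (auto intro!: PT_intros pol_intros monoI l)
  moreover have "foldl (\<lambda>n b. Suc n) m xs = m + length xs" for xs :: "nat list" and m
    by (induction xs arbitrary: m) auto
  ultimately show ?thesis by simp
qed

lemma PT_length [PT_intros]: "PT l \<Longrightarrow> PT (\<lambda>x. length (l x :: bool list))"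
  using PT_length_syms[of "\<lambda>x. map sy (l x)"] by (auto intro: PT_intros)

lemma PT_pred: "PT n \<Longrightarrow> PT (\<lambda>x. n x - Suc 0)"
  using PT_length_syms[OF PT_tl_syms[OF PT_replicate1[of n]]] by simp

lemma PT_add [PT_intros]: "PT m \<Longrightarrow> PT n \<Longrightarrow> PT (\<lambda>x. m x + n x :: nat)"
proof -
  assume m: "PT m" and n: "PT n"
  have "PT (\<lambda>x. ((\<lambda>(e :: bool) k. Suc k) True ^^ m x) (n x))"
    by (rule PT_funpow[where g = "\<lambda>_. 1"]) (auto intro!: PT_intros pol_intros monoI m n)
  then show ?thesis by simp
qed

lemma PT_diff [PT_intros]: "PT m \<Longrightarrow> PT n \<Longrightarrow> PT (\<lambda>x. m x - n x :: nat)"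
proof -
  assume m: "PT m" and n: "PT n"
  have "PT (\<lambda>x. ((\<lambda>(e :: bool) k. k - Suc 0) True ^^ n x) (m x))"
    by (rule PT_funpow[where g = "\<lambda>_. 0"]) (auto intro!: PT_intros PT_pred pol_intros monoI m n)
  moreover have "((\<lambda>k. k - Suc 0) ^^ n) m = m - n" for m n by (induction n) auto
  ultimately show ?thesis by simp
qed

lemma PT_mult [PT_intros]: "PT m \<Longrightarrow> PT n \<Longrightarrow> PT (\<lambda>x. m x * n x :: nat)"
proof -
  assume m: "PT m" and n: "PT n"
  have "PT (\<lambda>x. ((\<lambda>e k. k + e) (n x) ^^ m x) 0)"
    by (rule PT_funpow[where g = "\<lambda>n. n"]) (auto intro!: PT_intros pol_intros monoI m n)
  moreover have "((\<lambda>k. k + n) ^^ m) 0 = m * n" for m n :: nat by (induction m) auto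
  ultimately show ?thesis by simp
qed

lemma PT_power [PT_intros]: "PT m \<Longrightarrow> PT (\<lambda>x. m x ^ k :: nat)"
  by (induction k) (auto intro: PT_intros)

lemma PT_le [PT_intros]: "PT m \<Longrightarrow> PT n \<Longrightarrow> PT (\<lambda>x. (m x :: nat) \<le> n x)"
proof -
  assume m: "PT m" and n: "PT n"
  have "PT (\<lambda>x. replicate (m x - n x) (Suc 0) = [])"
    by (intro PT_null_syms PT_intros m n)
  then show ?thesis by simp
qed

lemma PT_eq_nat [PT_intros]: "PT m \<Longrightarrow> PT n \<Longrightarrow> PT (\<lambda>x. (m x :: nat) = n x)"
  unfolding order_eq_iff[where 'a = nat] by (intro PT_intros)

lemma PT_less [PT_intros]: "PT m \<Longrightarrow> PT n \<Longrightarrow> PT (\<lambda>x. (m x :: nat) < n x)"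
  unfolding Suc_le_eq[symmetric] by (intro PT_intros)

lemma PT_min [PT_intros]: "PT m \<Longrightarrow> PT n \<Longrightarrow> PT (\<lambda>x. min (m x) (n x) :: nat)"
  unfolding min_def by (intro PT_intros)

lemma PT_drop [PT_intros]: "PT n \<Longrightarrow> PT l \<Longrightarrow> PT (\<lambda>x. drop (n x) (l x :: bool list))"
proof -
  assume n: "PT n" and l: "PT l"
  have "PT (\<lambda>x. ((\<lambda>(e :: bool) k. tl k) True ^^ n x) (l x))"
    by (rule PT_funpow[where g = "\<lambda>_. 0"]) (auto intro!: PT_intros pol_intros monoI n l)
  moreover have "((\<lambda>k. tl k) ^^ n) l = drop n l" for n and l :: "bool list"
    by (induction n) (auto simp: tl_drop drop_Suc)
  ultimately show ?thesis by simp
qed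

lemma PT_drop_syms: "PT n \<Longrightarrow> PT l \<Longrightarrow> PT (\<lambda>x. drop (n x) (l x :: nat list))"
proof -
  assume n: "PT n" and l: "PT l"
  have "PT (\<lambda>x. ((\<lambda>(e :: bool) k. tl k) True ^^ n x) (l x))"
    by (rule PT_funpow[where g = "\<lambda>_. 0"]) (auto intro!: PT_intros PT_tl_syms pol_intros monoI n l)
  moreover have "((\<lambda>k. tl k) ^^ n) l = drop n l" for n and l :: "nat list"
    by (induction n) (auto simp: tl_drop drop_Suc)
  ultimately show ?thesis by simp
qed

lemma PT_take [PT_intros]: "PT n \<Longrightarrow> PT l \<Longrightarrow> PT (\<lambda>x. take (n x) (l x :: bool list))"
proof -
  assume n: "PT n" and l: "PT l"
  have "PT (\<lambda>x. rev (drop (length (l x) - n x) (rev (l x))))" by (intro PT_intros n l)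
  moreover have "rev (drop (length l - n) (rev l)) = take n l" for n and l :: "bool list"
    by (cases "n \<le> length l") (simp_all add: drop_rev)
  ultimately show ?thesis by simp
qed

lemma PT_replicate [PT_intros]: "PT n \<Longrightarrow> PT b \<Longrightarrow> PT (\<lambda>x. replicate (n x) (b x :: bool))"
proof -
  assume n: "PT n" and b: "PT b"
  have "PT (\<lambda>x. ((\<lambda>e k. e # k) (b x) ^^ n x) [])"
    by (rule PT_funpow[where g = "\<lambda>_. 1"]) (auto intro!: PT_intros pol_intros monoI n b)
  moreover have "((\<lambda>k. b # k) ^^ n) [] = replicate n b" for n and b :: bool by (induction n) auto
  ultimately show ?thesis by simp
qed

lemma PT_eq_list [PT_intros]: "PT k \<Longrightarrow> PT l \<Longrightarrow> PT (\<lambda>x. (k x :: bool list) = l x)"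
proof -
  assume k: "PT k" and l: "PT l"
  define st where "st = (\<lambda>(e :: bool) (p :: bool \<times> bool list) b. (fst p \<and> snd p \<noteq> [] \<and> hd (snd p) = b, tl (snd p)))"
  let ?F = "\<lambda>x. foldl (st True) (True, l x) (k x)"
  have "PT ?F"
    by (rule PT_foldl[where g = "\<lambda>_. 0"]) (auto intro!: PT_intros pol_intros monoI k l simp: st_def)
  then have "PT (\<lambda>x. fst (?F x) \<and> snd (?F x) = [])" by (intro PT_intros)
  moreover have "(fst (foldl (st True) (b, ys) xs) \<and> snd (foldl (st True) (b, ys) xs) = []) \<longleftrightarrow> b \<and> xs = ys" for xs ys b
  proof (induction xs arbitrary: ys b)
    case (Cons x xs)
    then show ?case by (cases ys) (auto simp: st_def)
  qed auto
  ultimately show ?thesis by simp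
qed

lemma PT_loop:
  fixes step :: "'e::reg \<Rightarrow> nat \<Rightarrow> 'a::reg \<Rightarrow> 'a"
  assumes "PT (\<lambda>p. step (fst p) (fst (snd p)) (snd (snd p)))" "pol g" "mono g"
    "\<And>e i a. ok e \<Longrightarrow> ok a \<Longrightarrow> sz (step e i a) \<le> sz a + g (sz e)"
    "PT e" "PT i" "PT n"
  shows "PT (\<lambda>x. loop (step (e x)) (n x) (i x))"
proof -
  let ?st = "\<lambda>e p. (Suc (fst p), step e (fst p) (snd p))"
  have fp: "(?st e ^^ n) (0, a) = (n, loop (step e) n a)" for e n a
    by (induction n) auto
  have "PT (\<lambda>x. (?st (e x) ^^ n x) (0, i x))"
  proof (rule PT_funpow[where g = "\<lambda>n. Suc (g n)"])
    show "mono (\<lambda>n. Suc (g n))" by (intro monoI Suc_le_mono[THEN iffD2] monoD[OF assms(3)])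
  qed (use assms in \<open>auto intro!: PT_intros pol_intros\<close>)
  from PT_comp[OF PT_snd_base this] show ?thesis unfolding fp by simp
qed

end

section \<open>Simulating machines\<close>

type_synonym sconf = "nat list \<times> nat list \<times> nat list"

text \<open>Simulated configuration: the state \<open>q\<close> as the singleton \<open>[Suc q]\<close>, and the tape cells from
  some negative position on as a zipper with entries \<open>Suc s\<close>; the head scans the first
  entry of the right list.\<close>

definition act :: "nat \<times> nat \<times> move \<Rightarrow> nat list \<Rightarrow> nat list \<Rightarrow> sconf" where
  "act e l r = (case e of (q, s, d) \<Rightarrow>
     (case d of MoveL \<Rightarrow> (case l of [] \<Rightarrow> ([Suc q], [], Suc s # r) | c # l' \<Rightarrow> ([Suc q], l', c # Suc s # r))
      | MoveR \<Rightarrow> ([Suc q], Suc s # l, r)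
      | Stay \<Rightarrow> ([Suc q], l, Suc s # r)))"

definition sstep :: "nat \<Rightarrow> tm \<Rightarrow> sconf \<Rightarrow> sconf" where
  "sstep k M c = (case c of (q, l, r) \<Rightarrow>
     (case q of [] \<Rightarrow> c
      | a # as \<Rightarrow> if length M < a then c else
        (case r of [] \<Rightarrow> act (M ! (a - 1) ! 0) l []
         | b # r' \<Rightarrow> if k < b then c else act (M ! (a - 1) ! (b - 1)) l r')))"

definition cell :: "nat list \<Rightarrow> nat \<Rightarrow> nat" where
  "cell xs j = (if j < length xs then xs ! j - 1 else 0)"

text \<open>List position \<open>j\<close> stands for tape cell \<open>j - D\<close>, so
  \<open>D\<close> cells are stored to the left of cell 0. The head moves left by at most one cell
  per step; a simulation of at most \<open>D\<close> steps from the initial configuration therefore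
  never runs out of the left list.\<close>

definition srel :: "nat \<Rightarrow> nat \<Rightarrow> config \<Rightarrow> sconf \<Rightarrow> bool" where
  "srel k D c s \<longleftrightarrow> (case s of (q, l, r) \<Rightarrow> q = [Suc (state c)] \<and> int (length l) = int D + head c \<and>
     set l \<union> set r \<subseteq> {1..k} \<and> (\<forall>j. tape c (int j - int D) = cell (rev l @ r) j))"

lemma cell_append: "cell (xs @ ys) j = (if j < length xs then cell xs j else cell ys (j - length xs))"
  by (auto simp: cell_def nth_append)

lemma cell_drop: "cell (drop D ys) i = cell ys (i + D)"
  by (auto simp: cell_def add.commute less_diff_conv)

lemma srel_act:
  assumes "srel k D c ([Suc p], l, r)" "q \<le> m" "s < k" "0 < length l"
  shows "srel k D \<lparr>state = q, head = head c + shift d, tape = (tape c)(head c := s)\<rparr> (act (q, s, d) l (tl r))"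
proof -
  let ?T = "(tape c)(head c := s)"
  from assms(1) have l: "int (length l) = int D + head c" and set: "set l \<union> set r \<subseteq> {1..k}"
    and tape: "\<And>j. tape c (int j - int D) = cell (rev l @ r) j" by (auto simp: srel_def)
  have set': "set (tl r) \<subseteq> {1..k}" using set by (cases r) auto
  have T: "?T (int j - int D) = cell (rev l @ Suc s # tl r) j" for j
  proof -
    consider "j < length l" | "j = length l" | "j > length l" by linarith
    then show ?thesis
    proof cases
      case 1
      then have "int j - int D \<noteq> head c" using l by auto
      then show ?thesis using 1 by (simp add: tape cell_append)
    next
      case 2
      then have "int j - int D = head c" using l by auto
      then show ?thesis using 2 by (simp add: cell_def nth_append)
    next
      case 3
      then have "int j - int D \<noteq> head c" using l by auto
      moreover have "cell r (j - length l) = cell (Suc s # tl r) (j - length l)"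
        using 3 by (cases r) (auto simp: cell_def nth_Cons split: nat.splits)
      ultimately show ?thesis using 3 by (simp add: tape cell_append)
    qed
  qed
  obtain a l' where al: "l = a # l'" using assms(4) by (cases l) auto
  show ?thesis
  proof (cases d)
    case MoveL
    then show ?thesis using l set set' T assms(3) al by (auto simp: srel_def act_def simp del: fun_upd_apply)
  next
    case MoveR
    then show ?thesis using l set set' T assms(3) by (auto simp: srel_def act_def simp del: fun_upd_apply)
  next
    case Stay
    then show ?thesis using l set set' T assms(3) by (auto simp: srel_def act_def simp del: fun_upd_apply)
  qed
qed

lemma srel_step:
  assumes "srel k D c s" "tm_shape m k M" "state c \<le> m" "- int D < head c"
  shows "srel k D (step M c) (sstep k M s) \<and> state (step M c) \<le> m \<and> head c - 1 \<le> head (step M c)"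
proof -
  from assms(2) have M: "length M = m" "3 \<le> k" "\<And>row. row \<in> set M \<Longrightarrow> length row = k"
    "\<And>row q s d. row \<in> set M \<Longrightarrow> (q, s, d) \<in> set row \<Longrightarrow> q \<le> m \<and> s < k"
    unfolding tm_shape_def by auto
  obtain l r where s: "s = ([Suc (state c)], l, r)" using assms(1) by (auto simp: srel_def)
  show ?thesis
  proof (cases "halted M c")
    case True
    then show ?thesis using assms(1,3) s by (auto simp: step_def sstep_def halted_def)
  next
    case False
    then have st: "state c < m" using M(1) by (simp add: halted_def)
    then have row: "M ! state c \<in> set M" using M(1) by simp
    from assms(1) s have l: "int (length l) = int D + head c" and set: "set l \<union> set r \<subseteq> {1..k}"
      and tape: "\<And>j. tape c (int j - int D) = cell (rev l @ r) j" by (auto simp: srel_def)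
    have b: "tape c (head c) = cell r 0" using tape[of "length l"] l by (simp add: cell_append)
    have bk: "tape c (head c) < k" using b set M(2) by (cases r) (auto simp: cell_def)
    obtain q' s' d where e: "M ! state c ! tape c (head c) = (q', s', d)" by (cases "M ! state c ! tape c (head c)")
    have "(q', s', d) \<in> set (M ! state c)" using e bk M(3)[OF row] nth_mem[of "tape c (head c)" "M ! state c"] by simp
    from M(4)[OF row this] have qs: "q' \<le> m" "s' < k" by auto
    have "sstep k M s = act (M ! state c ! tape c (head c)) l (tl r)"
      using s st M(1) b set by (cases r) (auto simp: sstep_def cell_def)
    moreover have "srel k D \<lparr>state = q', head = head c + shift d, tape = (tape c)(head c := s')\<rparr> (act (q', s', d) l (tl r))"
      using assms(1,4) s l qs by (intro srel_act[where m = m and p = "state c"]) auto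
    moreover have "- 1 \<le> shift d" by (cases d) auto
    ultimately show ?thesis using False e qs by (simp add: step_def)
  qed
qed

definition pick :: "ptm \<Rightarrow> bool \<Rightarrow> tm" where
  "pick P b = (if b then snd P else fst P)"

text \<open>The premise on the head is a budget: at least as many cells are stored to its left as
  there are steps to come.\<close>

lemma srel_run:
  assumes "tm_shape m k (fst P)" "tm_shape m k (snd P)"
  shows "srel k D c s \<Longrightarrow> state c \<le> m \<Longrightarrow> int (length w) - int D \<le> head c \<Longrightarrow>
    srel k D (foldl (pstep P) c w) (foldl (\<lambda>s b. sstep k (pick P b) s) s w)"
proof (induction w arbitrary: c s)
  case (Cons b w)
  have "tm_shape m k (pick P b)" using assms by (simp add: pick_def)
  from srel_step[OF Cons.prems(1) this Cons.prems(2)] Cons.prems(3)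
  have "srel k D (pstep P c b) (sstep k (pick P b) s)" "state (pstep P c b) \<le> m" "head c - 1 \<le> head (pstep P c b)"
    by (auto simp: pstep_def pick_def)
  with Cons show ?case by simp
qed simp

definition sinit :: "nat \<Rightarrow> bool list \<Rightarrow> sconf" where
  "sinit D x = ([1], replicate D 1, map (\<lambda>b. if b then 3 else 2) x)"

lemma srel_init: "3 \<le> k \<Longrightarrow> srel k D (init_config x) (sinit D x)"
proof -
  have "nat (int j - int D) = j - D" for j by simp
  then show "3 \<le> k \<Longrightarrow> srel k D (init_config x) (sinit D x)"
    by (auto simp: srel_def sinit_def init_config_def cell_def nth_append)
qed

text \<open>Entries are successors of tape symbols, so 2 and 3 stand for the bits 0 and 1.\<close>

definition bits_prefix :: "nat list \<Rightarrow> bool list" where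
  "bits_prefix xs = map (\<lambda>a. a = 3) (takeWhile (\<lambda>a. a = 2 \<or> a = 3) xs)"

definition soutput :: "nat \<Rightarrow> sconf \<Rightarrow> bool list" where
  "soutput D s = bits_prefix (drop D (rev (fst (snd s)) @ snd (snd s)))"

lemma srel_output: "srel k D c s \<Longrightarrow> tape_output c = soutput D s"
proof -
  assume *: "srel k D c s"
  define xs where "xs = drop D (rev (fst (snd s)) @ snd (snd s))"
  let ?ys = "rev (fst (snd s)) @ snd (snd s)"
  have pos: "\<forall>x\<in>set ?ys. 1 \<le> x" using * by (auto simp: srel_def split: prod.splits)
  have tape: "tape c (int i) = cell xs i" for i
  proof -
    have "\<forall>j. tape c (int j - int D) = cell ?ys j" using * by (auto simp: srel_def split: prod.splits)
    from spec[OF this, of "i + D"] show ?thesis unfolding xs_def cell_drop by simp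
  qed
  have pos': "\<forall>x\<in>set xs. 1 \<le> x" using pos in_set_dropD unfolding xs_def by fast
  let ?n = "length (takeWhile (\<lambda>a. a = 2 \<or> a = 3) xs)"
  have "(LEAST n. tape c (int n) \<notin> {1, 2}) = ?n"
  proof (rule Least_equality)
    show "tape c (int ?n) \<notin> {1, 2}"
      using nth_length_takeWhile[of "\<lambda>a. a = 2 \<or> a = 3" xs] by (auto simp: tape cell_def)
    fix n assume n: "tape c (int n) \<notin> {1, 2}"
    show "?n \<le> n"
    proof (rule ccontr)
      assume "\<not> ?n \<le> n"
      then have "n < ?n" by simp
      then have "xs ! n = 2 \<or> xs ! n = 3"
        using set_takeWhileD[OF nth_mem[OF \<open>n < ?n\<close>]] takeWhile_nth[OF \<open>n < ?n\<close>] by simp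
      moreover have "n < length xs" by (rule order_less_le_trans[OF \<open>n < ?n\<close> length_takeWhile_le])
      ultimately show False using n by (auto simp: tape cell_def)
    qed
  qed
  moreover have "map (\<lambda>i. tape c (int i) = 2) [0..<?n] = bits_prefix xs"
  proof (rule nth_equalityI)
    fix i assume "i < length (map (\<lambda>i. tape c (int i) = 2) [0..<?n])"
    then have i: "i < ?n" by simp
    then have "i < length xs" by (rule order_less_le_trans[OF _ length_takeWhile_le])
    then show "map (\<lambda>i. tape c (int i) = 2) [0..<?n] ! i = bits_prefix xs ! i"
      using i takeWhile_nth[OF i] set_takeWhileD[OF nth_mem[OF i]] by (auto simp: bits_prefix_def tape cell_def)
  qed (simp add: bits_prefix_def)
  ultimately show ?thesis by (simp add: tape_output_def soutput_def xs_def)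
qed

context alphabet
begin

lemma PT_act:
  assumes "q < K" "s < K"
  shows "PT (\<lambda>p. act (q, s, d) (fst p) (snd p))"
proof (cases d)
  case MoveL
  have ok: "ok [Suc q]" "Suc s \<in> {1..K}" using assms by auto
  have "PT (\<lambda>p. case fst p of [] \<Rightarrow> (\<lambda>r. ([Suc q], [], Suc s # r)) (snd p)
      | c # l' \<Rightarrow> (\<lambda>c x. ([Suc q], fst x, c # Suc s # snd x)) c (l', snd p))"
    by (rule PT_case_syms) (auto intro!: PT_intros PT_const PT_Cons_const ok)
  moreover have "(\<lambda>p. case fst p of [] \<Rightarrow> (\<lambda>r. ([Suc q], [], Suc s # r)) (snd p)
      | c # l' \<Rightarrow> (\<lambda>c x. ([Suc q], fst x, c # Suc s # snd x)) c (l', snd p)) = (\<lambda>p. act (q, s, d) (fst p) (snd p))"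
    by (auto simp: act_def MoveL split: list.split)
  ultimately show ?thesis by simp
next
  case MoveR
  then show ?thesis using assms by (auto simp: act_def intro!: PT_intros PT_const PT_Cons_const)
next
  case Stay
  then show ?thesis using assms by (auto simp: act_def intro!: PT_intros PT_const PT_Cons_const)
qed

text \<open>The machine is a constant, so one step is a finite dispatch on the state and the scanned
  symbol. Both are single symbols of the simulating alphabet, shifted by one, whence
  \<open>m < K\<close> and \<open>k < K\<close>.\<close>

lemma PT_sstep:
  assumes "tm_shape m k M" "m < K" "k < K"
  shows "PT (sstep k M)"
proof -
  have M: "length M = m" "\<And>row. row \<in> set M \<Longrightarrow> length row = k" "3 \<le> k"
    "\<And>row q s d. row \<in> set M \<Longrightarrow> (q, s, d) \<in> set row \<Longrightarrow> q \<le> m \<and> s < k"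
    using assms(1) unfolding tm_shape_def by auto
  have act: "PT (\<lambda>p. act (M ! i ! j) (fst p) (snd p))" if "i < m" "j < k" for i j
  proof -
    obtain q s d where e: "M ! i ! j = (q, s, d)" by (cases "M ! i ! j")
    have "M ! i \<in> set M" using that M(1) by simp
    then have "q \<le> m \<and> s < k" using M(4)[of "M ! i" q s d] M(2)[of "M ! i"] that e nth_mem[of j "M ! i"] by simp
    then show ?thesis unfolding e using assms by (intro PT_act) auto
  qed
  have inner: "PT (\<lambda>c. case snd (snd c) of [] \<Rightarrow> (\<lambda>c. act (M ! (a - 1) ! 0) (fst (snd c)) []) c
      | b # r' \<Rightarrow> (\<lambda>b y. if k < b then snd y else act (M ! (a - 1) ! (b - 1)) (fst (snd (snd y))) (fst y)) b (r', c))"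
    if a: "a \<in> {1..m}" for a
  proof (rule PT_case_syms)
    show "PT (\<lambda>c :: sconf. act (M ! (a - 1) ! 0) (fst (snd c)) [])"
    proof -
      have P: "PT (\<lambda>c :: sconf. (fst (snd c), [] :: nat list))" by (intro PT_intros)
      have "a - 1 < m" "0 < k" using a M(3) by auto
      from PT_comp[OF act[OF this] P] show ?thesis by simp
    qed
    fix b assume b: "b \<in> {1..K}"
    show "PT (\<lambda>y :: nat list \<times> sconf. if k < b then snd y else act (M ! (a - 1) ! (b - 1)) (fst (snd (snd y))) (fst y))"
    proof (cases "k < b")
      case True
      then show ?thesis by (auto intro!: PT_intros)
    next
      case False
      have P: "PT (\<lambda>y :: nat list \<times> sconf. (fst (snd (snd y)), fst y))" by (intro PT_intros)
      have "a - 1 < m" "b - 1 < k" using a b False by auto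
      from PT_comp[OF act[OF this] P] show ?thesis using False by simp
    qed
  qed (intro PT_intros)+
  define G where "G a c = (if m < a then c else
      (case snd (snd c) of [] \<Rightarrow> (\<lambda>c. act (M ! (a - 1) ! 0) (fst (snd c)) []) c
      | b # r' \<Rightarrow> (\<lambda>b y. if k < b then snd y else act (M ! (a - 1) ! (b - 1)) (fst (snd (snd y))) (fst y)) b (r', c)))"
    for a and c :: sconf
  have G: "PT (G a)" if "a \<in> {1..K}" for a
  proof (cases "m < a")
    case True
    then have "G a = (\<lambda>c. c)" by (simp add: G_def fun_eq_iff)
    then show ?thesis by (simp add: PT_id)
  next
    case False
    have "G a = (\<lambda>c. case snd (snd c) of [] \<Rightarrow> (\<lambda>c. act (M ! (a - 1) ! 0) (fst (snd c)) []) c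
      | b # r' \<Rightarrow> (\<lambda>b y. if k < b then snd y else act (M ! (a - 1) ! (b - 1)) (fst (snd (snd y))) (fst y)) b (r', c))"
      unfolding G_def using False by (simp only: if_False)
    then show ?thesis using inner[of a] that False by (simp only:) simp
  qed
  have "PT (\<lambda>c. case fst c of [] \<Rightarrow> (\<lambda>x. x) c | a # as \<Rightarrow> (\<lambda>a y. G a (snd y)) a (as, c))"
    by (rule PT_case_syms) (auto intro!: PT_intros PT_comp[OF G])
  moreover have "(\<lambda>c. case fst c of [] \<Rightarrow> (\<lambda>x. x) c | a # as \<Rightarrow> (\<lambda>a y. G a (snd y)) a (as, c)) = sstep k M"
    by (auto simp: fun_eq_iff sstep_def G_def M(1) split: list.split)
  ultimately show ?thesis by simp
qed

lemma sz_sstep: "sz (sstep k M c) \<le> sz c + 2"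
proof -
  obtain q l r where c: "c = (q, l, r)" by (rule prod_cases3)
  have act: "sz (act e l r) \<le> length l + length r + 3" for e l r
    by (cases e; cases "snd (snd e)"; cases l) (auto simp: act_def)
  have sz: "sz (q, l, r) = length q + length l + length r" for q l r :: "nat list" by simp
  show ?thesis unfolding c
    by (cases q; cases r) (auto simp: sstep_def sz simp del: sz_simps(4) intro!: order_trans[OF act])
qed

lemma PT_bits_prefix: "PT l \<Longrightarrow> PT (\<lambda>x. bits_prefix (l x))"
proof -
  assume l: "PT l"
  define st where "st = (\<lambda>(e :: bool) (p :: bool \<times> bool list) (a :: nat).
    if fst p \<and> (a = 2 \<or> a = 3) then (True, (a = 3) # snd p) else (False, snd p))"
  have "PT (\<lambda>x. foldl (st True) (True, []) (l x))"
    by (rule PT_foldl_syms[where g = "\<lambda>_. 1"]) (auto simp: st_def intro!: PT_intros pol_intros monoI l)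
  then have "PT (\<lambda>x. rev (snd (foldl (st True) (True, []) (l x))))" by (intro PT_intros)
  moreover have False: "snd (foldl (st True) (False, zs) xs) = zs" for xs zs
    by (induction xs) (auto simp: st_def)
  have "snd (foldl (st True) (True, zs) xs) = rev (bits_prefix xs) @ zs" for xs zs
  proof (induction xs arbitrary: zs)
    case (Cons a xs)
    then show ?case using False by (auto simp: st_def bits_prefix_def)
  qed (simp add: bits_prefix_def)
  ultimately show ?thesis by simp
qed

lemma PT_sinit:
  assumes "3 \<le> K" "PT n" "PT y"
  shows "PT (\<lambda>x. sinit (n x) (y x))"
proof -
  have "PT (\<lambda>x. foldl ((\<lambda>(e :: bool) acc b. (if b then 3 else 2 :: nat) # acc) True) [] (rev (y x)))"
    using assms by (intro PT_foldl[where g = "\<lambda>_. 1"]) (auto intro!: PT_intros PT_Cons_const pol_intros monoI)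
  moreover have "foldl (\<lambda>acc b. (if b then 3 else 2) # acc) zs xs = rev (map (\<lambda>b. if b then 3 else 2) xs) @ zs"
    for xs and zs :: "nat list"
    by (induction xs arbitrary: zs) auto
  ultimately have "PT (\<lambda>x. map (\<lambda>b. if b then 3 else 2 :: nat) (y x))" by (simp flip: rev_map)
  then show ?thesis unfolding sinit_def One_nat_def using K2 by (intro PT_intros PT_const assms) auto
qed

text \<open>The length of \<open>w\<close> is the number of steps and hence also a sufficient number
  of blanks on the left. With equal tables the same statement covers deterministic machines, where
  \<open>w\<close> is just a clock.\<close>

lemma PT_sim:
  assumes "tm_shape m k (fst P)" "tm_shape m k (snd P)" "m < K" "k < K" "PT y" "PT w"
  shows "PT (\<lambda>x. tape_output (foldl (pstep P) (init_config (y x)) (w x)))"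
proof -
  have k: "3 \<le> k" using assms(1) by (simp add: tm_shape_def)
  have eq: "tape_output (foldl (pstep P) (init_config y) w) =
      soutput (length w) (foldl (\<lambda>s b. sstep k (pick P b) s) (sinit (length w) y) w)" for y w
    by (intro srel_output[of k] srel_run[OF assms(1,2)] srel_init k) (simp_all add: init_config_def)
  have pick: "tm_shape m k (pick P b)" for b using assms by (simp add: pick_def)
  have "PT (\<lambda>x. foldl ((\<lambda>(e :: bool) s b. sstep k (pick P b) s) True) (sinit (length (w x)) (y x)) (w x))"
  proof (rule PT_foldl[where g = "\<lambda>_. 2" and e = "\<lambda>_. True" and step = "\<lambda>e s b. sstep k (pick P b) s"])
    show "PT (\<lambda>p :: bool \<times> sconf. sstep k (pick P b) (snd p))" for b
      by (intro PT_comp[OF PT_sstep[OF pick assms(3,4)]] PT_intros)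
    show "sz (sstep k (pick P b) a) \<le> sz a + 2" for a b by (rule sz_sstep)
  qed (use assms k in \<open>auto intro!: PT_intros PT_sinit pol_intros monoI\<close>)
  then show ?thesis unfolding eq soutput_def
    by (intro PT_bits_prefix PT_drop_syms PT_append_syms PT_rev_syms PT_intros assms)
qed

end

section \<open>Exact evaluation of polynomials\<close>

text \<open>The coefficients of a polynomial with natural values need not be integers; repeated differences
  write it as a difference of iterated sums of constants.\<close>

definition shift_diff :: "real poly \<Rightarrow> real poly" where
  "shift_diff p = pcompose p [:1, 1:] - p"

lemma poly_shift_diff: "poly (shift_diff p) (real n) = poly p (real (Suc n)) - poly p (real n)"
  by (simp add: shift_diff_def poly_pcompose)

lemma degree_shift_diff: "degree p \<noteq> 0 \<Longrightarrow> degree (shift_diff p) < degree p"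
proof -
  assume d: "degree p \<noteq> 0"
  let ?q = "pcompose p [:1, 1:]"
  have deg: "degree ?q = degree p" by (simp add: degree_pcompose)
  have "lead_coeff ?q = lead_coeff p" by (subst lead_coeff_comp) simp_all
  then have "coeff (?q - p) (degree p) = 0" using deg by simp
  moreover have "degree (?q - p) \<le> degree p" using degree_diff_le[of ?q "degree p" p] deg by simp
  ultimately show ?thesis using d unfolding shift_diff_def
    by (metis degree_0 leading_coeff_0_iff le_neq_implies_less gr0I)
qed

context alphabet
begin

lemma PT_sum:
  fixes g :: "nat \<Rightarrow> nat"
  assumes "PT g" shows "PT (\<lambda>n. \<Sum>i<n. g i)"
proof -
  obtain h where h: "pol h" "mono h" "\<And>n. g n \<le> h n"
    by (rule PT_size[OF assms]) simp
  \<comment> \<open>The index is below \<open>n\<close> anyway. Capping it makes the growth of a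
    step bounded in terms of the parameter for all indices, as the loop rule demands.\<close>
  have "PT (\<lambda>n. loop ((\<lambda>e i a. a + g (min i e)) n) n 0)"
  proof (rule PT_loop[where g = h and step = "\<lambda>e i a. a + g (min i e)" and e = "\<lambda>n. n"])
    show "PT (\<lambda>p. snd (snd p) + g (min (fst (snd p)) (fst p)))"
      by (intro PT_comp[OF assms] PT_intros)
    fix e i a :: nat
    have "g (min i e) \<le> h e" using h(3)[of "min i e"] monoD[OF h(2), of "min i e" e] by simp
    then show "sz (a + g (min i e)) \<le> sz a + h (sz e)" by simp
  qed (use h in \<open>auto intro!: PT_intros\<close>)
  moreover have "loop (\<lambda>i a. a + g (min i n)) m 0 = (\<Sum>i<m. g i)" if "m \<le> n" for m n
    using that by (induction m) auto
  ultimately show ?thesis by simp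
qed

lemma PT_int_poly:
  assumes "\<And>n :: nat. poly p (real n) \<in> \<int>"
  shows "\<exists>g h. PT g \<and> PT h \<and> (\<forall>n. poly p (real n) = real (g n) - real (h n))"
  using assms
proof (induction "degree p" arbitrary: p rule: less_induct)
  case less
  obtain z where z: "poly p 0 = real_of_int z" using less.prems[of 0] by (auto elim: Ints_cases)
  show ?case
  proof (cases "degree p = 0")
    case True
    then have "poly p (real n) = real_of_int z" for n using z by (auto elim: degree_eq_zeroE)
    then have "poly p (real n) = real (nat z) - real (nat (- z))" for n by simp
    moreover have "PT (\<lambda>_ :: nat. nat z)" "PT (\<lambda>_ :: nat. nat (- z))" by (intro PT_intros)+
    ultimately show ?thesis by (intro exI[of _ "\<lambda>_. nat z"] exI[of _ "\<lambda>_. nat (- z)"]) simp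
  next
    case False
    have "poly (shift_diff p) (real n) \<in> \<int>" for n
      unfolding poly_shift_diff by (intro Ints_diff less.prems)
    from less.hyps[OF degree_shift_diff[OF False] this] obtain g h where gh: "PT g" "PT h"
      "\<And>n. poly (shift_diff p) (real n) = real (g n) - real (h n)" by blast
    have "poly p (real n) = real (nat z + (\<Sum>i<n. g i)) - real (nat (- z) + (\<Sum>i<n. h i))" for n
    proof (induction n)
      case (Suc n)
      then show ?case using gh(3)[of n] unfolding poly_shift_diff by simp
    qed (use z in simp)
    moreover have "PT (\<lambda>n. nat z + (\<Sum>i<n. g i))" "PT (\<lambda>n. nat (- z) + (\<Sum>i<n. h i))"
      by (intro PT_intros PT_sum gh)+
    ultimately show ?thesis by (intro exI[of _ "\<lambda>n. nat z + (\<Sum>i<n. g i)"] exI[of _ "\<lambda>n. nat (- z) + (\<Sum>i<n. h i)"]) simp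
  qed
qed

lemma PT_polynomial_fun:
  assumes "polynomial_fun t" shows "PT t"
proof -
  obtain p where p: "\<And>n. real (t n) = poly p (real n)" using assms unfolding polynomial_fun_def by blast
  have "poly p (real n) \<in> \<int>" for n unfolding p[symmetric] by simp
  from PT_int_poly[OF this] obtain g h where gh: "PT g" "PT h" "\<And>n. poly p (real n) = real (g n) - real (h n)"
    by blast
  have "t n = g n - h n" for n using gh(3)[of n] p[of n] by linarith
  then have "t = (\<lambda>n. g n - h n)" by blast
  then show ?thesis using PT_diff[OF gh(1,2)] by simp
qed

end

section \<open>Bit strings and hashing\<close>

lemma nat_of_bits_simps [simp]: "nat_of_bits [] = 0" "nat_of_bits (b # bs) = of_bool b + 2 * nat_of_bits bs"
  by (simp_all add: nat_of_bits_def)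

fun inc :: "bool list \<Rightarrow> bool list" where
  "inc [] = [True]"
| "inc (False # bs) = True # bs"
| "inc (True # bs) = False # inc bs"

definition bits :: "nat \<Rightarrow> bool list" where
  "bits n = (inc ^^ n) []"

definition lg :: "nat \<Rightarrow> nat" where
  "lg n = length (bits n)"

lemma nat_of_bits_inc: "nat_of_bits (inc bs) = Suc (nat_of_bits bs)"
  by (induction bs rule: inc.induct) auto

lemma nat_of_bits_bits [simp]: "nat_of_bits (bits n) = n"
  unfolding bits_def by (induction n) (auto simp: nat_of_bits_inc)

lemma inc_last: "inc bs \<noteq> [] \<and> ((bs = [] \<or> last bs) \<longrightarrow> last (inc bs))"
  by (induction bs rule: inc.induct) (auto split: if_splits)

lemma length_inc: "length (inc bs) \<le> Suc (length bs)"
  by (induction bs rule: inc.induct) auto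

lemma nat_of_bits_less: "nat_of_bits bs < 2 ^ length bs"
  by (induction bs) auto

lemma nat_of_bits_last: "bs \<noteq> [] \<Longrightarrow> last bs \<Longrightarrow> 2 ^ length bs \<le> 2 * nat_of_bits bs"
  by (induction bs) (auto split: if_splits)

lemma lg_power: "lg (2 ^ m) = Suc m"
proof -
  have "bits n = [] \<or> last (bits n)" for n
    unfolding bits_def by (induction n) (use inc_last in auto)
  moreover have "bits (2 ^ m) \<noteq> []" using nat_of_bits_bits[of "2 ^ m"] by fastforce
  ultimately have "2 ^ lg (2 ^ m) \<le> 2 * (2 ^ m :: nat)"
    using nat_of_bits_last[of "bits (2 ^ m)"] by (auto simp: lg_def)
  then have "lg (2 ^ m) \<le> Suc m" using power_le_imp_le_exp[of 2 "lg (2 ^ m)" "Suc m"] by simp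
  moreover have "(2 :: nat) ^ m < 2 ^ lg (2 ^ m)"
    using nat_of_bits_less[of "bits (2 ^ m)"] by (simp add: lg_def)
  then have "m < lg (2 ^ m)" by simp
  ultimately show ?thesis by simp
qed

text \<open>The value of a bit list may be exponential in its length, too large for a unary
  register. Taking the minimum in every step keeps all intermediate values below the cap.\<close>

definition capval :: "nat \<Rightarrow> bool list \<Rightarrow> nat" where
  "capval m bs = foldr (\<lambda>b v. min m (of_bool b + 2 * v)) bs 0"

lemma capval_eq: "capval m bs = min m (nat_of_bits bs)"
  unfolding capval_def by (induction bs) auto

text \<open>Inverse to the padding \<open>0...01p\<close>: the first 1 is a marker, so descriptions
  of different lengths below \<open>l\<close> can all be written with exactly \<open>l\<close>
  bits.\<close>

definition strip :: "bool list \<Rightarrow> bool list" where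
  "strip w = tl (dropWhile Not w)"

definition padw :: "nat \<Rightarrow> bool list \<Rightarrow> bool list" where
  "padw l p = replicate (l - Suc (length p)) False @ True # p"

lemma length_padw: "length p < l \<Longrightarrow> length (padw l p) = l"
  by (simp add: padw_def)

lemma strip_padw: "strip (padw l p) = p"
proof -
  have "dropWhile Not (replicate m False @ True # p) = True # p" for m
    by (induction m) auto
  then show ?thesis by (simp add: strip_def padw_def)
qed

lemma length_strip: "length (strip w) \<le> length w"
  unfolding strip_def using length_dropWhile_le[of Not w] by simp

definition xorl :: "bool list \<Rightarrow> bool list \<Rightarrow> bool list" where
  "xorl a b = map2 (\<noteq>) a b"

lemma length_xorl [simp]: "length (xorl a b) = min (length a) (length b)"
  by (simp add: xorl_def)

lemma xorl_left_commute:
  "length a = k \<Longrightarrow> length b = k \<Longrightarrow> length c = k \<Longrightarrow> xorl a (xorl b c) = xorl b (xorl a c)"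
  by (rule nth_equalityI) (auto simp: xorl_def)

lemma xorl_cancel: "length a = length b \<Longrightarrow> xorl (xorl a b) b = a"
  by (rule nth_equalityI) (auto simp: xorl_def)

text \<open>The sum over GF(2) of the \<open>k\<close>-bit columns of \<open>z\<close> selected by \<open>w\<close>, added to \<open>r\<close>.\<close>
fun hash :: "nat \<Rightarrow> bool list \<Rightarrow> bool list \<Rightarrow> bool list \<Rightarrow> bool list" where
  "hash k z [] r = r"
| "hash k z (b # w) r = hash k (drop k z) w (if b then xorl (take k z) r else r)"

definition repl :: "nat \<Rightarrow> nat \<Rightarrow> bool list \<Rightarrow> bool list \<Rightarrow> bool list" where
  "repl k i a z = take (i * k) z @ a @ drop (Suc i * k) z"

lemma length_hash: "length z = k * length w \<Longrightarrow> length r = k \<Longrightarrow> length (hash k z w r) = k"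
  by (induction w arbitrary: z r) auto

lemma hash_xorl:
  "length z = k * length w \<Longrightarrow> length r = k \<Longrightarrow> length a = k \<Longrightarrow>
    hash k z w (xorl a r) = xorl a (hash k z w r)"
proof (induction w arbitrary: z r)
  case (Cons b w)
  have "xorl (take k z) (xorl a r) = xorl a (xorl (take k z) r)"
    using Cons.prems by (intro xorl_left_commute[of _ k]) auto
  then show ?case using Cons by auto
qed simp

text \<open>The hash is affine in each column: \<open>g\<close> collects the contributions of
  \<open>r\<close> and of the other columns, and column \<open>i\<close> enters exactly if bit
  \<open>i\<close> of \<open>w\<close> is set.\<close>

lemma hash_repl:
  assumes "length z = k * length w" "length r = k" "i < length w"
  shows "\<exists>g. length g = k \<and> (\<forall>a. length a = k \<longrightarrow> hash k (repl k i a z) w r = (if w ! i then xorl a g else g))"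
  using assms
proof (induction w arbitrary: z r i)
  case (Cons b w)
  show ?case
  proof (cases i)
    case 0
    have "hash k (repl k i a z) (b # w) r = (if b then xorl a (hash k (drop k z) w r) else hash k (drop k z) w r)"
      if "length a = k" for a
      using that Cons.prems 0 hash_xorl[of "drop k z" k w r a] by (simp add: repl_def)
    then show ?thesis using 0 Cons.prems length_hash[of "drop k z" k w r]
      by (intro exI[of _ "hash k (drop k z) w r"]) auto
  next
    case (Suc j)
    let ?r = "if b then xorl (take k z) r else r"
    have "length ?r = k" using Cons.prems by simp
    then obtain g where g: "length g = k"
      "\<forall>a. length a = k \<longrightarrow> hash k (repl k j a (drop k z)) w ?r = (if w ! j then xorl a g else g)"
      using Cons.IH[of "drop k z" ?r j] Cons.prems Suc by auto
    have "take k (repl k i a z) = take k z" "drop k (repl k i a z) = repl k j a (drop k z)" for a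
      using Suc Cons.prems by (auto simp: repl_def add.commute min_def take_drop)
    then show ?thesis using g Suc by (intro exI[of _ g]) auto
  qed
qed simp

text \<open>The tape is read after \<open>s\<close> steps whether or not the machine has halted.
  This is total and easy to simulate, and it is the true output once \<open>s\<close> is large
  enough.\<close>

definition urun :: "tm \<Rightarrow> nat \<Rightarrow> bool list \<Rightarrow> bool list" where
  "urun M s y = tape_output ((step M ^^ s) (init_config y))"

context alphabet
begin

lemma PT_inc: "PT l \<Longrightarrow> PT (\<lambda>x. inc (l x))"
proof -
  assume l: "PT l"
  define st where "st = (\<lambda>(e :: bool) (p :: bool \<times> bool list) b. (fst p \<and> b, (fst p \<noteq> b) # snd p))"
  define fin where "fin p = rev (if fst p then True # snd p else snd p)" for p :: "bool \<times> bool list"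
  have "PT (\<lambda>x. foldl (st True) (True, []) (l x))"
    by (rule PT_foldl[where g = "\<lambda>_. 2" and e = "\<lambda>_. True"]) (auto simp: st_def intro!: PT_intros pol_intros monoI l)
  moreover have "PT fin" unfolding fin_def by (intro PT_intros)
  ultimately have "PT (\<lambda>x. fin (foldl (st True) (True, []) (l x)))" by (rule PT_comp[rotated])
  moreover have "foldl (st True) (False, zs) xs = (False, rev xs @ zs)" for xs zs
    by (induction xs arbitrary: zs) (auto simp: st_def)
  then have "fin (foldl (st True) (True, zs) xs) = rev zs @ inc xs" for xs zs
    by (induction xs arbitrary: zs rule: inc.induct) (auto simp: st_def fin_def)
  ultimately show ?thesis by simp
qed

lemma PT_bits [PT_intros]: "PT n \<Longrightarrow> PT (\<lambda>x. bits (n x))"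
proof -
  assume n: "PT n"
  have "PT (\<lambda>x. ((\<lambda>(e :: bool) l. inc l) True ^^ n x) [])"
    by (rule PT_funpow[where g = "\<lambda>_. 1" and e = "\<lambda>_. True" and step = "\<lambda>e l. inc l"])
      (use length_inc in \<open>auto intro!: PT_intros PT_inc pol_intros monoI n\<close>)
  then show ?thesis by (simp add: bits_def)
qed

lemma PT_lg [PT_intros]: "PT n \<Longrightarrow> PT (\<lambda>x. lg (n x))"
  unfolding lg_def by (intro PT_intros)

lemma PT_capval [PT_intros]: "PT m \<Longrightarrow> PT l \<Longrightarrow> PT (\<lambda>x. capval (m x) (l x))"
proof -
  assume m: "PT m" and l: "PT l"
  let ?st = "\<lambda>m v b. min m ((if b then 1 else 0) + 2 * v) :: nat"
  have "PT (\<lambda>x. foldl (?st (m x)) 0 (rev (l x)))"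
  proof (rule PT_foldl[where g = "\<lambda>n. n" and step = ?st])
    show "PT (\<lambda>p. ?st (fst p) (snd p) b)" for b by (intro PT_intros)
  qed (auto intro!: PT_intros pol_intros monoI m l)
  then show ?thesis by (simp add: capval_def foldr_conv_foldl of_bool_def)
qed

lemma PT_dropWhile_Not: "PT l \<Longrightarrow> PT (\<lambda>x. dropWhile Not (l x))"
proof -
  assume l: "PT l"
  define st where "st = (\<lambda>(e :: bool) (p :: bool \<times> bool list) b. if fst p \<or> b then (True, b # snd p) else p)"
  have "PT (\<lambda>x. foldl (st True) (False, []) (l x))"
    by (rule PT_foldl[where g = "\<lambda>_. 2" and e = "\<lambda>_. True"]) (auto simp: st_def intro!: PT_intros pol_intros monoI l)
  then have "PT (\<lambda>x. rev (snd (foldl (st True) (False, []) (l x))))" by (intro PT_intros)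
  moreover have "foldl (st True) (True, zs) xs = (True, rev xs @ zs)" for xs zs
    by (induction xs arbitrary: zs) (auto simp: st_def)
  then have "rev (snd (foldl (st True) (False, []) xs)) = dropWhile Not xs" for xs
    by (induction xs) (auto simp: st_def)
  ultimately show ?thesis by simp
qed

lemma PT_strip [PT_intros]: "PT l \<Longrightarrow> PT (\<lambda>x. strip (l x))"
  unfolding strip_def by (intro PT_intros PT_dropWhile_Not)

lemma PT_xorl [PT_intros]: "PT a \<Longrightarrow> PT b \<Longrightarrow> PT (\<lambda>x. xorl (a x) (b x))"
proof -
  assume a: "PT a" and b: "PT b"
  define st where "st = (\<lambda>(e :: bool) (p :: bool list \<times> bool list) b.
    (tl (fst p), if fst p = [] then snd p else (b \<noteq> hd (fst p)) # snd p))"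
  have "PT (\<lambda>x. foldl (st True) (b x, []) (a x))"
    by (rule PT_foldl[where g = "\<lambda>_. 2" and e = "\<lambda>_. True"]) (auto simp: st_def intro!: PT_intros pol_intros monoI a b)
  then have "PT (\<lambda>x. rev (snd (foldl (st True) (b x, []) (a x))))" by (intro PT_intros)
  moreover have "rev (snd (foldl (st True) (ys, zs) xs)) = rev zs @ xorl xs ys" for xs ys zs
  proof (induction xs arbitrary: ys zs)
    case (Cons x xs)
    then show ?case by (cases ys) (auto simp: st_def xorl_def)
  qed (simp add: xorl_def)
  ultimately show ?thesis by simp
qed

lemma PT_hash [PT_intros]: "PT k \<Longrightarrow> PT z \<Longrightarrow> PT w \<Longrightarrow> PT r \<Longrightarrow> PT (\<lambda>x. hash (k x) (z x) (w x) (r x))"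
proof -
  assume k: "PT k" and z: "PT z" and w: "PT w" and r: "PT r"
  let ?st = "\<lambda>k (p :: bool list \<times> bool list) b. (drop k (fst p), if b then xorl (take k (fst p)) (snd p) else snd p)"
  have "PT (\<lambda>x. snd (foldl (?st (k x)) (z x, r x) (w x)))"
  proof (rule PT_snd, rule PT_foldl[where g = "\<lambda>_. 0" and step = ?st])
    show "PT (\<lambda>p. ?st (fst p) (snd p) b)" for b by (intro PT_intros)
  qed (auto intro!: PT_intros pol_intros monoI k z w r)
  moreover have "snd (foldl (?st k) (z, r) w) = hash k z w r" for k z r w
    by (induction w arbitrary: z r) auto
  ultimately show ?thesis by simp
qed

lemma PT_prefix_ones [PT_intros]: "PT l \<Longrightarrow> PT (\<lambda>x. length (takeWhile id (l x)))"
proof -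
  assume l: "PT l"
  define st where "st = (\<lambda>(e :: bool) (p :: bool \<times> nat) b. if fst p \<and> b then (True, Suc (snd p)) else (False, snd p))"
  have "PT (\<lambda>x. foldl (st True) (True, 0) (l x))"
    by (rule PT_foldl[where g = "\<lambda>_. 1" and e = "\<lambda>_. True"]) (auto simp: st_def intro!: PT_intros pol_intros monoI l)
  then have "PT (\<lambda>x. snd (foldl (st True) (True, 0) (l x)))" by (intro PT_intros)
  moreover have "snd (foldl (st True) (False, n) xs) = n" for xs n
    by (induction xs) (auto simp: st_def)
  then have "snd (foldl (st True) (True, n) xs) = n + length (takeWhile id xs)" for xs n
    by (induction xs arbitrary: n) (auto simp: st_def)
  ultimately show ?thesis by simp
qed

lemma PT_map_upt:
  assumes "PT (\<lambda>p. f (fst p) (snd p))" "PT e" "PT n"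
  shows "PT (\<lambda>x. map (f (e x)) [0..<n x] :: bool list)"
proof -
  have "PT (\<lambda>x. loop ((\<lambda>e i acc. f e i # acc) (e x)) (n x) [])"
  proof (rule PT_loop[where g = "\<lambda>_. 1" and step = "\<lambda>e i acc. f e i # acc"])
    show "PT (\<lambda>p. f (fst p) (fst (snd p)) # snd (snd p))"
    proof (rule PT_Cons)
      have "PT (\<lambda>p. (fst p, fst (snd p)))" by (intro PT_intros)
      from PT_comp[OF assms(1) this] show "PT (\<lambda>p. f (fst p) (fst (snd p)))" by simp
    qed (intro PT_intros)
  qed (use assms in \<open>auto intro!: PT_intros pol_intros monoI\<close>)
  then have "PT (\<lambda>x. rev (loop (\<lambda>i acc. f (e x) i # acc) (n x) []))" by (intro PT_intros)
  moreover have "rev (loop (\<lambda>i acc. f e i # acc) n []) = map (f e) [0..<n]" for e n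
    by (induction n) auto
  ultimately show ?thesis by simp
qed

lemma PT_urun:
  assumes "tm_shape m k M" "m < K" "k < K" "PT s" "PT y"
  shows "PT (\<lambda>x. urun M (s x) (y x))"
proof -
  have "PT (\<lambda>x. tape_output (foldl (pstep (M, M)) (init_config (y x)) (replicate (s x) False)))"
    using assms by (intro PT_sim[of m k] PT_intros) auto
  then show ?thesis by (simp add: urun_def foldl_const_step)
qed

end

section \<open>The search\<close>

text \<open>A minimum in which 0 means that no description has been found yet; the lengths found are
  stored increased by one.\<close>

definition mn :: "nat \<Rightarrow> nat \<Rightarrow> nat" where
  "mn v b = (if v = 0 then b else if b = 0 \<or> v < b then v else b)"

text \<open>With \<open>m\<close> one more than the true complexity, this is the one-sided
  correctness that verification gives to every intermediate result.\<close>

definition good_val :: "nat \<Rightarrow> nat \<Rightarrow> bool" where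
  "good_val m b \<longleftrightarrow> b = 0 \<or> m \<le> b"

lemma loop_good:
  assumes "\<And>i b. i < n \<Longrightarrow> good_val m b \<Longrightarrow> good_val m (f i b)" "good_val m b"
  shows "good_val m (loop f n b)"
  using assms by (induction n) auto

text \<open>\<open>m\<close> is the least nonzero value that a good result can have, so one hit is
  enough and the other rounds cannot spoil it.\<close>

lemma loop_hit:
  assumes "\<And>i b. i < n \<Longrightarrow> good_val m b \<Longrightarrow> good_val m (f i b)" "good_val m b"
    "\<And>i. i < n \<Longrightarrow> f i m = m" "i < n" "\<And>b. good_val m b \<Longrightarrow> f i b = m"
  shows "loop f n b = m"
  using assms
proof (induction n)
  case (Suc n)
  have "good_val m (loop f n b)" using Suc.prems by (intro loop_good) auto
  then show ?case using Suc by (cases "i = n") auto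
qed simp

locale reconstruction =
  fixes U :: tm and t :: "nat \<Rightarrow> nat" and c C aq eq :: nat
begin

definition kk :: "nat \<Rightarrow> nat" where "kk n = C * lg n"

text \<open>The constant \<open>c\<close> is the overhead of copying, so a shortest description has
  at most \<open>n + c\<close> bits; the additional bit is the marker of
  \<open>padw\<close>.\<close>

definition LL :: "nat \<Rightarrow> nat" where "LL n = n + c + 1"

text \<open>Here \<open>aq\<close> and \<open>eq\<close> bound the overhead of \<open>U\<close>:
  this many steps serve every description of at most \<open>LL n\<close> bits that is emulated for
  \<open>t n\<close> steps.\<close>

definition usteps :: "nat \<Rightarrow> nat" where "usteps n = aq * Suc (LL n + t n) ^ eq"

definition uout :: "nat \<Rightarrow> bool list \<Rightarrow> bool list" where
  "uout n p = urun U (usteps n) (univ_input p (t n))"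

definition ones :: "bool list \<Rightarrow> nat" where "ones w = length (takeWhile id w)"

text \<open>Decodes the header, \<open>m\<close> ones followed by a zero, as \<open>2 ^ m\<close>.
  The cap by the length of the input keeps the unary number small and cuts off nothing on the
  intended inputs, which are longer than \<open>2 ^ m\<close>.\<close>

definition dim :: "bool list \<Rightarrow> nat" where
  "dim w = capval (length w) (replicate (ones w) False @ [True])"

definition rebuild :: "nat \<Rightarrow> bool list \<Rightarrow> bool list" where
  "rebuild n v = tl (uout n (strip (take (LL n) v))) @ take (kk n * LL n) (drop (LL n) v) @
     hash (kk n) (take (kk n * LL n) (drop (LL n) v)) (take (LL n) v) (replicate (kk n) False) @
     drop (kk n * LL n) (drop (LL n) v)"

text \<open>The machine that shows that the good query strings are compressible.\<close>
definition recon :: "bool list \<Rightarrow> bool list" where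
  "recon w = rebuild (dim w) (drop (Suc (ones w)) w)"

lemma recon_eq:
  assumes "length w = LL (2 ^ m)" "length z = kk (2 ^ m) * LL (2 ^ m)"
  shows "recon (replicate m True @ False # w @ z @ pad) =
    tl (uout (2 ^ m) (strip w)) @ z @ hash (kk (2 ^ m)) z w (replicate (kk (2 ^ m)) False) @ pad"
proof -
  let ?w = "replicate m True @ False # w @ z @ pad"
  have ones: "ones ?w = m" by (simp add: ones_def takeWhile_append)
  have bits: "nat_of_bits (replicate m False @ [True]) = 2 ^ m" by (induction m) auto
  have "dim ?w = 2 ^ m" unfolding dim_def ones capval_eq bits using assms(1) by (simp add: LL_def)
  then show ?thesis unfolding recon_def ones rebuild_def using assms by simp
qed

end

text \<open>\<open>P\<close> is the simulated heuristic, \<open>aa\<close> sets the threshold, and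
  \<open>v0\<close> is the answer when nothing is found. \<open>D\<close>, \<open>B\<close> and
  \<open>R\<close> give the number of paddings tried, the random bits per trial and the number of
  trials.\<close>

locale search = reconstruction +
  fixes P :: ptm and aa v0 :: nat and D B R :: "nat \<Rightarrow> nat"
begin

text \<open>A block \<open>blk\<close> holds, in this order, the columns \<open>z\<close>, the bits
  \<open>r\<close>, the padding of length \<open>e\<close>, the fresh column and the coins of the
  heuristic. The same block serves all \<open>i\<close>; the errors at different bits are dependent,
  and only a union bound is used for them.\<close>

definition query :: "bool list \<Rightarrow> bool list \<Rightarrow> nat \<Rightarrow> nat \<Rightarrow> bool list" where
  "query x blk e i = x @ repl (kk (length x)) i
     (take (kk (length x)) (drop (kk (length x) * LL (length x) + kk (length x) + e) blk))
     (take (kk (length x) * LL (length x) + kk (length x) + e) blk)"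

definition acoins :: "bool list \<Rightarrow> bool list \<Rightarrow> nat \<Rightarrow> bool list" where
  "acoins x blk e = drop (kk (length x) * LL (length x) + kk (length x) + e + kk (length x)) blk"

text \<open>The length of the query less \<open>aa * lg (length x)\<close>, provided that
  \<open>aa \<le> C\<close>. Reported values for compressible queries are to stay at or below it,
  those for random queries above, both with the approximation error included.\<close>

definition thr :: "bool list \<Rightarrow> nat \<Rightarrow> nat" where
  "thr x e = length x + kk (length x) * LL (length x) + (kk (length x) - aa * lg (length x)) + e"

definition pout :: "bool list \<Rightarrow> bool list \<Rightarrow> bool list" where
  "pout y w = tape_output (foldl (pstep P) (init_config y) w)"

text \<open>The comparison uses \<open>capval\<close> because the number reported by the heuristic
  may be exponentially large; capping just above the threshold preserves the outcome.\<close>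

definition abit :: "bool list \<Rightarrow> bool list \<Rightarrow> nat \<Rightarrow> nat \<Rightarrow> bool" where
  "abit x blk e i \<longleftrightarrow> \<not> capval (Suc (thr x e)) (pout (query x blk e i) (acoins x blk e)) \<le> thr x e"

lemma abit_iff: "abit x blk e i \<longleftrightarrow> thr x e < nat_of_bits (pout (query x blk e i) (acoins x blk e))"
  by (auto simp: abit_def capval_eq)

definition cand :: "bool list \<Rightarrow> bool list \<Rightarrow> nat \<Rightarrow> bool list" where
  "cand x blk e = map (abit x blk e) [0..<LL (length x)]"

definition val :: "bool list \<Rightarrow> bool list \<Rightarrow> nat \<Rightarrow> nat" where
  "val x blk e = (if uout (length x) (strip (cand x blk e)) = True # x then Suc (length (strip (cand x blk e))) else 0)"

lemma val_le: "val x blk e \<le> Suc (LL (length x))"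
  using length_strip[of "cand x blk e"] by (simp add: val_def cand_def)

end

context alphabet
begin

lemma PT_univ_input [PT_intros]: "PT p \<Longrightarrow> PT n \<Longrightarrow> PT (\<lambda>x. univ_input (p x) (n x))"
  unfolding univ_input_def by (intro PT_intros)

end

locale reconstruction_PT = alphabet + reconstruction +
  fixes m k :: nat
  assumes U: "tm_shape m k U" "m < K" "k < K" and t: "PT t"
begin

lemma PT_t [PT_intros]: "PT n \<Longrightarrow> PT (\<lambda>x. t (n x))"
  by (rule PT_comp[OF t])

lemma PT_kk [PT_intros]: "PT n \<Longrightarrow> PT (\<lambda>x. kk (n x))"
  unfolding kk_def by (intro PT_intros)

lemma PT_LL [PT_intros]: "PT n \<Longrightarrow> PT (\<lambda>x. LL (n x))"
  unfolding LL_def by (intro PT_intros)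

lemma PT_uout [PT_intros]: "PT n \<Longrightarrow> PT p \<Longrightarrow> PT (\<lambda>x. uout (n x) (p x))"
  unfolding uout_def usteps_def by (intro PT_urun[OF U] PT_intros)

lemma PT_recon: "PT recon"
proof -
  have "PT (\<lambda>x. rebuild (fst x) (snd x))" unfolding rebuild_def by (intro PT_intros)
  moreover have "PT (\<lambda>w. (dim w, drop (Suc (ones w)) w))" unfolding dim_def ones_def by (intro PT_intros)
  ultimately show ?thesis using PT_comp[of "\<lambda>x. rebuild (fst x) (snd x)" "\<lambda>w. (dim w, drop (Suc (ones w)) w)"]
    by (simp add: recon_def[abs_def])
qed

end

locale search_PT = reconstruction_PT K U t c C aq eq m k + search U t c C aq eq P aa v0 D B R
  for K U t c C aq eq m k P aa v0 D B R +
  fixes m' k' :: nat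
  assumes P: "tm_shape m' k' (fst P)" "tm_shape m' k' (snd P)" "m' < K" "k' < K"
    and DBR: "PT D" "PT B" "PT R"
begin

lemma PT_DBR [PT_intros]: "PT n \<Longrightarrow> PT (\<lambda>x. D (n x))" "PT n \<Longrightarrow> PT (\<lambda>x. B (n x))" "PT n \<Longrightarrow> PT (\<lambda>x. R (n x))"
  using PT_comp DBR by blast+

definition trial :: "bool list \<Rightarrow> bool list \<Rightarrow> nat \<Rightarrow> nat" where
  "trial x blk b = loop (\<lambda>e b. mn (val x blk e) b) (D (length x)) b"

text \<open>Each trial has its own block of random bits, so trials are independent; within a trial
  all paddings share the block.\<close>

definition result :: "bool list \<Rightarrow> bool list \<Rightarrow> nat" where
  "result x r = loop (\<lambda>j b. trial x (take (B (length x)) (drop (j * B (length x)) r)) b) (R (length x)) 0"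

definition answer :: "bool list \<Rightarrow> bool list \<Rightarrow> bool list" where
  "answer x r = (if result x r = 0 then bits v0 else bits (result x r - 1))"

lemma PT_pout [PT_intros]: "PT y \<Longrightarrow> PT w \<Longrightarrow> PT (\<lambda>x. pout (y x) (w x))"
  unfolding pout_def by (rule PT_sim[OF P])

lemma PT_abit: "PT (\<lambda>p. abit (fst (fst p)) (fst (snd (fst p))) (snd (snd (fst p))) (snd p))"
  unfolding abit_def thr_def query_def acoins_def repl_def by (intro PT_intros)

lemma PT_cand: "PT (\<lambda>p. cand (fst p) (fst (snd p)) (snd (snd p)))"
  unfolding cand_def
  by (rule PT_map_upt[where f = "\<lambda>e. abit (fst e) (fst (snd e)) (snd (snd e))", OF PT_abit]) (intro PT_intros)+

lemma PT_val: "PT (\<lambda>p. val (fst p) (fst (snd p)) (snd (snd p)))"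
  unfolding val_def by (intro PT_intros PT_cand)

lemma PT_mn [PT_intros]: "PT v \<Longrightarrow> PT b \<Longrightarrow> PT (\<lambda>x. mn (v x) (b x))"
  unfolding mn_def by (intro PT_intros)

lemma mn_le: "mn (val x blk e) b \<le> max b (Suc (LL (length x)))"
  using val_le[of x blk e] by (auto simp: mn_def)

lemma trial_le: "trial x blk b \<le> max b (Suc (LL (length x)))"
proof -
  have "loop (\<lambda>e b. mn (val x blk e) b) n b \<le> max b (Suc (LL (length x)))" for n
  proof (induction n)
    case (Suc n)
    then show ?case using mn_le[of x blk n "loop (\<lambda>e b. mn (val x blk e) b) n b"] by simp
  qed simp
  then show ?thesis by (simp add: trial_def)
qed

lemma PT_trial: "PT (\<lambda>p. trial (fst (fst p)) (snd (fst p)) (snd p))"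
  unfolding trial_def
proof (rule PT_loop[where g = "\<lambda>n. n + c + 2" and step = "\<lambda>e i b. mn (val (fst e) (snd e) i) b"])
  have "PT (\<lambda>p :: (bool list \<times> bool list) \<times> nat \<times> nat. (fst (fst p), snd (fst p), fst (snd p)))" by (intro PT_intros)
  from PT_comp[OF PT_val this]
  show "PT (\<lambda>p. mn (val (fst (fst p)) (snd (fst p)) (fst (snd p))) (snd (snd p)))"
    by (intro PT_intros) simp
  fix e :: "bool list \<times> bool list" and i b :: nat
  show "sz (mn (val (fst e) (snd e) i) b) \<le> sz b + (sz e + c + 2)"
    using mn_le[of "fst e" "snd e" i b] by (simp add: LL_def)
qed (auto intro!: PT_intros pol_intros monoI)

lemma PT_result: "PT (\<lambda>p. result (fst p) (snd p))"
  unfolding result_def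
proof (rule PT_loop[where g = "\<lambda>n. n + c + 2" and e = "\<lambda>p. p"
      and step = "\<lambda>e j b. trial (fst e) (take (B (length (fst e))) (drop (j * B (length (fst e))) (snd e))) b"])
  have "PT (\<lambda>p :: (bool list \<times> bool list) \<times> nat \<times> nat. ((fst (fst p),
      take (B (length (fst (fst p)))) (drop (fst (snd p) * B (length (fst (fst p)))) (snd (fst p)))), snd (snd p)))"
    by (intro PT_intros)
  from PT_comp[OF PT_trial this]
  show "PT (\<lambda>p :: (bool list \<times> bool list) \<times> nat \<times> nat. trial (fst (fst p))
      (take (B (length (fst (fst p)))) (drop (fst (snd p) * B (length (fst (fst p)))) (snd (fst p)))) (snd (snd p)))"
    by simp
  fix e :: "bool list \<times> bool list" and j b :: nat
  show "sz (trial (fst e) (take (B (length (fst e))) (drop (j * B (length (fst e))) (snd e))) b) \<le> sz b + (sz e + c + 2)"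
    using trial_le[of "fst e" "take (B (length (fst e))) (drop (j * B (length (fst e))) (snd e))" b]
    by (simp add: LL_def)
qed (auto intro!: PT_intros pol_intros monoI)

lemma PPT_answer:
  "PPT (\<lambda>x. map_pmf (answer x) (coins (R (length x) * B (length x))))"
proof -
  have "PT (\<lambda>p :: bool list \<times> bool list. (rev (fst p), rev (snd p)))" by (intro PT_intros)
  from PT_comp[OF PT_result this] have "PT (\<lambda>p :: bool list \<times> bool list. result (rev (fst p)) (rev (snd p)))" by simp
  then have "PT (\<lambda>p :: bool list \<times> bool list. rev (answer (rev (fst p)) (rev (snd p))))"
    unfolding answer_def One_nat_def by (intro PT_intros PT_pred)
  moreover have "PT (\<lambda>x :: bool list. R (length x) * B (length x))" by (intro PT_intros)
  ultimately show ?thesis by (drule_tac PT_ppt) auto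
qed

lemma good_mn: "good_val l b \<Longrightarrow> good_val l v \<Longrightarrow> good_val l (mn v b)"
  by (auto simp: good_val_def mn_def)

lemma result_good:
  assumes "\<And>blk e. good_val l (val x blk e)"
  shows "good_val l (result x r)"
proof -
  have "good_val l (trial x blk b)" if "good_val l b" for blk b
    unfolding trial_def using that assms by (intro loop_good good_mn)
  then show ?thesis unfolding result_def by (intro loop_good) (auto simp: good_val_def)
qed

lemma result_hit:
  assumes "0 < l" "\<And>blk e. good_val l (val x blk e)"
    and "j < R (length x)" "e < D (length x)" "val x (take (B (length x)) (drop (j * B (length x)) r)) e = l"
  shows "result x r = l"
proof -
  have good: "good_val l (trial x blk b)" if "good_val l b" for blk b
    unfolding trial_def using that assms(2) by (intro loop_good good_mn)
  have absorb: "mn v l = l" if "good_val l v" for v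
    using that assms(1) by (auto simp: mn_def good_val_def)
  have "trial x blk l = l" for blk
  proof -
    have "loop (\<lambda>e b. mn (val x blk e) b) n l = l" for n
      by (induction n) (auto simp: absorb assms(2))
    then show ?thesis by (simp add: trial_def)
  qed
  moreover have "trial x (take (B (length x)) (drop (j * B (length x)) r)) b = l" if "good_val l b" for b
    unfolding trial_def
    using that assms absorb by (intro loop_hit[where i = e] good_mn) (auto simp: mn_def good_val_def)
  ultimately show ?thesis
    unfolding result_def using assms(3) good by (intro loop_hit[where i = j]) (auto simp: good_val_def)
qed

end

section \<open>Universal machines\<close>

lemma tm_result_mono: "tm_result M w i = Some y \<Longrightarrow> i \<le> j \<Longrightarrow> tm_result M w j = Some y"
proof -
  assume *: "tm_result M w i = Some y" and "i \<le> j"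
  then obtain k where k: "j = k + i" by (metis le_add_diff_inverse2)
  from * have "halted M ((step M ^^ i) (init_config w))"
    by (auto simp: tm_result_def Let_def split: if_splits)
  from halted_funpow[OF this, of k] show ?thesis using * unfolding k tm_result_def funpow_add o_apply by simp
qed

lemma tm_result_unique: "tm_result M w i = Some y \<Longrightarrow> tm_result M w j = Some y' \<Longrightarrow> y = y'"
  using tm_result_mono[of M w i y "max i j"] tm_result_mono[of M w j y' "max i j"] by simp

lemma tm_result_urun: "tm_result M w i = Some y \<Longrightarrow> i \<le> j \<Longrightarrow> urun M j w = y"
  using tm_result_mono[of M w i y j] by (auto simp: tm_result_def Let_def urun_def split: if_splits)

text \<open>A polynomial function is computable on unary numbers, and outputs of programs are
  polynomially bounded; so its coefficients need not be looked at.\<close>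

lemma polynomial_fun_bound:
  assumes "polynomial_fun q"
  obtains a e where "\<And>n. q n \<le> a * Suc n ^ e"
proof -
  interpret alphabet 2 by standard simp
  obtain g where "pol g" and "\<And>n. q n \<le> g n"
    by (rule PT_size[OF PT_polynomial_fun[OF assms]]) simp
  then show ?thesis using that by (metis (no_types) order_trans polE)
qed

text \<open>It halts after one step with its input as output, which bounds the complexity of
  \<open>x\<close> by \<open>length x\<close> plus a constant whenever at least one step is
  allowed.\<close>

definition copy_tm :: tm where
  "copy_tm = [[(1, 0, Stay), (1, 1, Stay), (1, 2, Stay)]]"

lemma wf_copy_tm: "wf_tm copy_tm"
  unfolding wf_tm_def tm_shape_def copy_tm_def by (intro exI[of _ 1] exI[of _ 3]) auto

lemma tape_output_init: "tape_output (init_config w) = w"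
proof -
  have K: "alphabet 2" by unfold_locales simp
  interpret tracks 2 1 by unfold_locales simp_all
  show ?thesis unfolding init_config_eq tape_output_conf by simp
qed

lemma copy_tm_result: "1 \<le> T \<Longrightarrow> tm_result copy_tm w T = Some w"
proof (rule tm_result_mono[of _ _ 1])
  have "step copy_tm (init_config w) = (init_config w)\<lparr>state := 1\<rparr>"
    by (auto simp: step_def halted_def copy_tm_def init_config_def fun_eq_iff)
  moreover have "tape_output ((init_config w)\<lparr>state := 1\<rparr>) = tape_output (init_config w)"
    by (simp add: tape_output_def)
  ultimately show "tm_result copy_tm w 1 = Some w"
    by (simp add: tm_result_def halted_def copy_tm_def[symmetric] tape_output_init) (simp add: copy_tm_def)
qed

lemma tm_result_0: "wf_tm M \<Longrightarrow> tm_result M w 0 = None"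
  by (auto simp: tm_result_def halted_def init_config_def wf_tm_def tm_shape_def)

text \<open>The overhead polynomial of \<open>universal_tm\<close> is replaced by a monotone bound
  that the search can evaluate; additional steps do not change the output of a halted
  machine.\<close>

locale universal =
  fixes U :: tm and dec :: "bool list \<Rightarrow> (tm \<times> bool list) option" and aq eq :: nat
  assumes dec_wf: "dec desc = Some (M, w) \<Longrightarrow> wf_tm M"
    and dec_ex: "wf_tm M \<Longrightarrow> \<exists>c. \<forall>w. \<exists>desc. dec desc = Some (M, w) \<and> length desc \<le> length w + c"
    and run_U: "tm_result U (univ_input desc T) (aq * Suc (length desc + T) ^ eq) = Some
              (case dec desc of
                 None \<Rightarrow> []
               | Some (M, w) \<Rightarrow>
                   (case tm_result M w T of None \<Rightarrow> [] | Some y \<Rightarrow> True # y))"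
begin

lemma univ_outputs_iff:
  assumes "aq * Suc (length desc + T) ^ eq \<le> s"
  shows "univ_outputs U desc T x \<longleftrightarrow> urun U s (univ_input desc T) = True # x"
proof -
  obtain y where y: "tm_result U (univ_input desc T) (aq * Suc (length desc + T) ^ eq) = Some y"
    using run_U by blast
  then have "urun U s (univ_input desc T) = y" using assms by (rule tm_result_urun)
  moreover have "univ_outputs U desc T x \<longleftrightarrow> y = True # x"
    unfolding univ_outputs_def using y tm_result_unique by blast
  ultimately show ?thesis by simp
qed

lemma univ_outputs_iff_dec:
  "univ_outputs U desc T x \<longleftrightarrow> (\<exists>M w. dec desc = Some (M, w) \<and> tm_result M w T = Some x)"
proof -
  have "univ_outputs U desc T x \<longleftrightarrow> (case dec desc of None \<Rightarrow> []
      | Some (M, w) \<Rightarrow> (case tm_result M w T of None \<Rightarrow> [] | Some y \<Rightarrow> True # y)) = True # x"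
    unfolding univ_outputs_def using run_U tm_result_unique by (metis option.sel)
  then show ?thesis by (auto split: option.splits)
qed

lemma univ_outputs_unique: "univ_outputs U desc T x \<Longrightarrow> univ_outputs U desc T y \<Longrightarrow> x = y"
  unfolding univ_outputs_iff_dec by auto

text \<open>The start state is never the halting state. Any description of \<open>x\<close> within
  time \<open>t n\<close> thus forces \<open>t n \<ge> 1\<close>, the case in which copying bounds
  the complexity.\<close>

lemma univ_outputs_0: "\<not> univ_outputs U desc 0 x"
  unfolding univ_outputs_iff_dec using dec_wf tm_result_0 by fastforce

lemma machine_desc:
  assumes "wf_tm M"
  obtains c where "\<And>w T y. tm_result M w T = Some y \<Longrightarrow> \<exists>desc. length desc \<le> length w + c \<and> univ_outputs U desc T y"
proof -
  from dec_ex[OF assms] obtain c where "\<forall>w. \<exists>desc. dec desc = Some (M, w) \<and> length desc \<le> length w + c" ..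
  then show ?thesis using that[of c] unfolding univ_outputs_iff_dec by meson
qed

lemma Kt_le: "univ_outputs U desc (t (length x)) x \<Longrightarrow> Kt U t x \<le> length desc"
  unfolding Kt_def by (rule cInf_lower) auto

lemma Kt_attained:
  assumes "univ_outputs U desc (t (length x)) x"
  obtains p where "univ_outputs U p (t (length x)) x" "length p = Kt U t x"
proof -
  have "Kt U t x \<in> {length desc | desc. univ_outputs U desc (t (length x)) x}"
    unfolding Kt_def using assms by (intro Inf_nat_def1) auto
  then show ?thesis using that by auto
qed

lemma card_short: "finite {p :: bool list. length p < l}" "card {p :: bool list. length p < l} \<le> 2 ^ l"
proof (induction l)
  case (Suc l)
  have eq: "{p :: bool list. length p < Suc l} = {p. length p < l} \<union> {p. length p = l}" by auto
  {
    case 1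
    show ?case using Suc(1) unfolding eq by simp
  next
    case 2
    show ?case unfolding eq using card_Un_le[of "{p :: bool list. length p < l}" "{p. length p = l}"] Suc(2) by simp
  }
qed simp_all

text \<open>A description determines its output, so the strings inject into the descriptions shorter
  than \<open>l\<close>. The existence of descriptions excludes the junk value of
  \<open>Kt\<close>.\<close>

lemma card_compressible:
  assumes "\<And>x. length x = n \<Longrightarrow> \<exists>desc. univ_outputs U desc (t n) x"
  shows "card {x. length x = n \<and> Kt U t x < l} \<le> 2 ^ l"
proof -
  have "\<exists>p. univ_outputs U p (t n) x \<and> length p = Kt U t x" if "length x = n" for x
    using assms[OF that] that by (metis Kt_attained)
  then obtain f where f: "\<And>x. length x = n \<Longrightarrow> univ_outputs U (f x) (t n) x \<and> length (f x) = Kt U t x"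
    by metis
  have "card {x. length x = n \<and> Kt U t x < l} \<le> card {p :: bool list. length p < l}"
  proof (rule card_inj_on_le)
    show "inj_on f {x. length x = n \<and> Kt U t x < l}"
      using f univ_outputs_unique by (intro inj_onI) (metis (mono_tags) mem_Collect_eq)
    show "f ` {x. length x = n \<and> Kt U t x < l} \<subseteq> {p. length p < l}" using f by auto
  qed (rule card_short)
  then show ?thesis using card_short(2)[of l] by simp
qed

end

lemma universal_tmE:
  assumes "universal_tm U"
  obtains dec aq eq where "universal U dec aq eq" "wf_tm U"
proof -
  from assms obtain dec q where U: "wf_tm U" and dec: "\<And>desc M w. dec desc = Some (M, w) \<Longrightarrow> wf_tm M"
    "\<And>M. wf_tm M \<Longrightarrow> \<exists>c. \<forall>w. \<exists>desc. dec desc = Some (M, w) \<and> length desc \<le> length w + c"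
    and q: "polynomial_fun q" "\<And>desc t. tm_result U (univ_input desc t) (q (length desc + t)) = Some
              (case dec desc of
                 None \<Rightarrow> []
               | Some (M, w) \<Rightarrow>
                   (case tm_result M w t of None \<Rightarrow> [] | Some y \<Rightarrow> True # y))"
    unfolding universal_tm_def by blast
  obtain a e where ae: "\<And>n. q n \<le> a * Suc n ^ e" by (rule polynomial_fun_bound[OF q(1)]) blast
  have "universal U dec a e"
    by standard (use dec in blast, use dec in blast, rule tm_result_mono[OF q(2) ae])
  then show ?thesis using that U by blast
qed

section \<open>Counting\<close>

text \<open>Together with the count for a determined slot this replaces conditioning: requiring that
  a slot of \<open>k\<close> bits be a given function of the rest divides a count by
  \<open>2 ^ k\<close>.\<close>

lemma card_slot_free:
  fixes F :: "bool list \<Rightarrow> bool list \<Rightarrow> bool"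
  shows "card {b. length b = M + k + Q \<and> F (take M b) (drop (M + k) b)} =
    2 ^ k * card {(u, v). length u = M \<and> length v = Q \<and> F u v}"
proof -
  let ?S = "{(u, v). length u = M \<and> length v = Q \<and> F u v}"
  let ?f = "\<lambda>((u, v), m :: bool list). u @ m @ v"
  have "{b. length b = M + k + Q \<and> F (take M b) (drop (M + k) b)} = ?f ` (?S \<times> {m. length m = k})"
  proof (intro set_eqI iffI)
    fix b assume b: "b \<in> {b. length b = M + k + Q \<and> F (take M b) (drop (M + k) b)}"
    then have "b = ?f ((take M b, drop (M + k) b), take k (drop M b))"
      by simp (metis append_take_drop_id drop_drop add.commute)
    moreover have "((take M b, drop (M + k) b), take k (drop M b)) \<in> ?S \<times> {m. length m = k}" using b by auto
    ultimately show "b \<in> ?f ` (?S \<times> {m. length m = k})" by blast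
  qed auto
  moreover have "inj_on ?f (?S \<times> {m. length m = k})" by (auto simp: inj_on_def)
  ultimately have "card {b. length b = M + k + Q \<and> F (take M b) (drop (M + k) b)} = card (?S \<times> {m :: bool list. length m = k})"
    by (simp add: card_image)
  then show ?thesis by (simp add: card_cartesian_product mult.commute)
qed

lemma card_slot_fixed:
  fixes F :: "bool list \<Rightarrow> bool list \<Rightarrow> bool"
  assumes "\<And>u v. length u = M \<Longrightarrow> length v = Q \<Longrightarrow> length (g u v) = k"
  shows "card {b. length b = M + k + Q \<and> take k (drop M b) = g (take M b) (drop (M + k) b) \<and>
      F (take M b) (drop (M + k) b)} = card {(u, v). length u = M \<and> length v = Q \<and> F u v}"
proof -
  let ?S = "{(u, v). length u = M \<and> length v = Q \<and> F u v}"
  let ?f = "\<lambda>(u, v). u @ g u v @ v"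
  have "{b. length b = M + k + Q \<and> take k (drop M b) = g (take M b) (drop (M + k) b) \<and>
      F (take M b) (drop (M + k) b)} = ?f ` ?S"
  proof (intro set_eqI iffI)
    fix b assume b: "b \<in> {b. length b = M + k + Q \<and> take k (drop M b) = g (take M b) (drop (M + k) b) \<and>
      F (take M b) (drop (M + k) b)}"
    then have "b = take M b @ take k (drop M b) @ drop (M + k) b"
      by (metis append_take_drop_id drop_drop add.commute)
    then have "b = ?f (take M b, drop (M + k) b)" using b by simp
    moreover have "(take M b, drop (M + k) b) \<in> ?S" using b by auto
    ultimately show "b \<in> ?f ` ?S" by blast
  qed (use assms in auto)
  moreover have "inj_on ?f ?S" using assms by (auto simp: inj_on_def)
  ultimately show ?thesis by (simp add: card_image)
qed

lemma finite_pairs: "finite {(u, v). length u = (M :: nat) \<and> length v = (Q :: nat) \<and> F u (v :: bool list) \<and> G (u :: bool list)}"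
  by (rule finite_subset[of _ "{u. length u = M} \<times> {v. length v = Q}"]) auto

text \<open>Averaging over \<open>x\<close> turns counts for a fixed \<open>x\<close> into counts
  over whole query strings, the form in which the error of the heuristic is known.\<close>

lemma sum_card_prefix:
  fixes F :: "bool list \<Rightarrow> bool list \<Rightarrow> bool"
  shows "(\<Sum>x\<in>{x. length x = n}. card {(u, v). length u = M \<and> length v = Q \<and> F (x @ u) v}) =
    card {(y, v). length y = n + M \<and> length v = Q \<and> F y v}"
proof -
  let ?S = "SIGMA x:{x :: bool list. length x = n}. {(u, v). length u = M \<and> length v = Q \<and> F (x @ u) v}"
  let ?f = "\<lambda>(x, u, v :: bool list). (x @ u, v)"
  have img: "?f ` ?S = {(y, v). length y = n + M \<and> length v = Q \<and> F y v}"
  proof (intro set_eqI iffI)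
    fix p assume p: "p \<in> {(y, v). length y = n + M \<and> length v = Q \<and> F y v}"
    then have "p = ?f (take n (fst p), drop n (fst p), snd p)" by auto
    moreover have "(take n (fst p), drop n (fst p), snd p) \<in> ?S" using p by auto
    ultimately show "p \<in> ?f ` ?S" by blast
  qed auto
  have "inj_on ?f ?S" by (auto simp: inj_on_def)
  then have "card {(y, v). length y = n + M \<and> length v = Q \<and> F y v} = card ?S"
    unfolding img[symmetric] by (rule card_image)
  also have "\<dots> = (\<Sum>x\<in>{x. length x = n}. card {(u, v). length u = M \<and> length v = Q \<and> F (x @ u) v})"
    using finite_pairs[of M Q "\<lambda>u v. F (_ @ u) v" "\<lambda>_. True"] by (intro card_SigmaI) auto
  finally show ?thesis by simp
qed

text \<open>Independence of the blocks, expressed as a product of cardinalities.\<close>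

lemma card_blocks:
  "card {r :: bool list. length r = R * B \<and> (\<forall>j<R. take B (drop (j * B) r) \<notin> G)} =
    card {b. length b = B \<and> b \<notin> G} ^ R"
proof (induction R)
  case (Suc R)
  let ?A = "{b. length b = B \<and> b \<notin> G}"
  let ?T = "{r :: bool list. length r = R * B \<and> (\<forall>j<R. take B (drop (j * B) r) \<notin> G)}"
  let ?f = "\<lambda>(b :: bool list, r). b @ r"
  have "{r :: bool list. length r = Suc R * B \<and> (\<forall>j<Suc R. take B (drop (j * B) r) \<notin> G)} = ?f ` (?A \<times> ?T)"
  proof (intro set_eqI iffI)
    fix r assume r: "r \<in> {r :: bool list. length r = Suc R * B \<and> (\<forall>j<Suc R. take B (drop (j * B) r) \<notin> G)}"
    have "take B (drop (j * B) (drop B r)) \<notin> G" if "j < R" for j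
      using r that by (auto dest!: spec[of _ "Suc j"] simp: add.commute)
    moreover have "take B r \<notin> G" using r by (auto dest!: spec[of _ 0])
    ultimately have "(take B r, drop B r) \<in> ?A \<times> ?T" using r by auto
    moreover have "r = ?f (take B r, drop B r)" by simp
    ultimately show "r \<in> ?f ` (?A \<times> ?T)" by blast
  next
    fix r assume "r \<in> ?f ` (?A \<times> ?T)"
    then obtain b s where r: "r = b @ s" "b \<in> ?A" "s \<in> ?T" by auto
    have "take B (drop (j * B) r) \<notin> G" if "j < Suc R" for j
      using that r by (cases j) auto
    then show "r \<in> {r :: bool list. length r = Suc R * B \<and> (\<forall>j<Suc R. take B (drop (j * B) r) \<notin> G)}"
      using r by auto
  qed
  moreover have "inj_on ?f (?A \<times> ?T)" by (auto simp: inj_on_def)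
  ultimately show ?case using Suc by (simp add: card_image card_cartesian_product)
qed simp

text \<open>The product \<open>(1 + u) ^ R * (1 - u) ^ R\<close> is at most 1, and Bernoulli bounds
  its first factor from below. This weak decay suffices because the error only has to be inverse
  polynomial.\<close>

lemma power_decay:
  fixes u :: real
  assumes "0 < u" "u \<le> 1" "0 < R"
  shows "(1 - u) ^ R \<le> 1 / (real R * u)"
proof -
  have "real R * u * (1 - u) ^ R \<le> (1 + real R * u) * (1 - u) ^ R"
    using assms by (intro mult_right_mono) auto
  also have "\<dots> \<le> (1 + u) ^ R * (1 - u) ^ R"
    using assms Bernoulli_inequality[of u R] by (intro mult_right_mono) auto
  also have "\<dots> = (1 - u ^ 2) ^ R"
    by (simp flip: power_mult_distrib add: power2_eq_square algebra_simps)
  also have "\<dots> \<le> 1" using assms by (intro power_le_one) (auto simp: power_le_one)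
  finally show ?thesis using assms by (simp add: field_simps)
qed

lemma card_markov:
  fixes f :: "'a \<Rightarrow> real"
  assumes "finite X" "\<And>x. x \<in> X \<Longrightarrow> 0 \<le> f x" "(\<Sum>x\<in>X. f x) \<le> T"
  shows "real (card {x \<in> X. h < f x}) * h \<le> T"
proof -
  have "real (card {x \<in> X. h < f x}) * h = (\<Sum>x\<in>{x \<in> X. h < f x}. h)" by simp
  also have "\<dots> \<le> (\<Sum>x\<in>{x \<in> X. h < f x}. f x)" by (intro sum_mono) auto
  also have "\<dots> \<le> (\<Sum>x\<in>X. f x)" using assms by (intro sum_mono2) auto
  finally show ?thesis using assms(3) by simp
qed

lemma prob_bind_of_set:
  assumes "finite S" "S \<noteq> {}" "\<And>x. x \<in> S \<Longrightarrow> finite (set_pmf (f x))"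
  shows "measure_pmf.prob (bind_pmf (pmf_of_set S) f) A = (\<Sum>x\<in>S. measure_pmf.prob (f x) A) / card S"
proof -
  have "measure_pmf.prob (bind_pmf (pmf_of_set S) f) A = measure_pmf.expectation (bind_pmf (pmf_of_set S) f) (indicator A)"
    by simp
  also have "\<dots> = (\<Sum>x\<in>S. measure_pmf.expectation (f x) (indicator A) /\<^sub>R card S)"
    using assms by (intro pmf_expectation_bind_pmf_of_set) auto
  also have "\<dots> = (\<Sum>x\<in>S. measure_pmf.prob (f x) A) / card S"
    by (simp add: divide_inverse mult.commute sum_distrib_left)
  finally show ?thesis .
qed

lemma prob_coins: "measure_pmf.prob (coins m) A = card {w. length w = m \<and> w \<in> A} / 2 ^ m"
  unfolding coins_eq measure_pmf_of_set[OF bitstrings_nonempty finite_bitstrings]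
  by (simp only: card_bitstrings Int_def mem_Collect_eq of_nat_power of_nat_numeral)

lemma prob_experiment:
  assumes "\<And>y. length y = n \<Longrightarrow> H y = map_pmf (h y) (coins Q)"
  shows "measure_pmf.prob (heuristic_experiment H n) {(y, v). F y v} =
    (\<Sum>y\<in>{y. length y = n}. real (card {w. length w = Q \<and> F y (nat_of_bits (h y w))})) / 2 ^ (n + Q)"
proof -
  have "measure_pmf.prob (heuristic_experiment H n) {(y, v). F y v} =
      (\<Sum>y\<in>{y. length y = n}. measure_pmf.prob (map_pmf (\<lambda>z. (y, nat_of_bits z)) (H y)) {(y, v). F y v}) / 2 ^ n"
    unfolding heuristic_experiment_def by (subst prob_bind_of_set) (auto simp: assms intro: Ex_list_of_length)
  also have "(\<Sum>y\<in>{y. length y = n}. measure_pmf.prob (map_pmf (\<lambda>z. (y, nat_of_bits z)) (H y)) {(y, v). F y v}) =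
      (\<Sum>y\<in>{y. length y = n}. real (card {w. length w = Q \<and> F y (nat_of_bits (h y w))}) / 2 ^ Q)"
    by (intro sum.cong refl) (simp add: assms prob_coins vimage_def)
  finally show ?thesis by (simp add: sum_divide_distrib[symmetric] power_add mult.commute)
qed

section \<open>Success probability\<close>

lemma xorl_zero: "length a = k \<Longrightarrow> xorl (replicate k False) a = a"
  by (rule nth_equalityI) (auto simp: xorl_def)

text \<open>Identifies the unnamed rest in \<open>hash_repl\<close> as the hash with a zero column
  in place \<open>i\<close>, an explicit function of the other data.\<close>

lemma hash_repl_zero:
  assumes "length z = k * length w" "i < length w" "length a = k"
  shows "hash k (repl k i a z) w (replicate k False) =
    (if w ! i then xorl a (hash k (repl k i (replicate k False) z) w (replicate k False))
     else hash k (repl k i (replicate k False) z) w (replicate k False))"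
proof -
  obtain g where "length g = k"
    "\<forall>a. length a = k \<longrightarrow> hash k (repl k i a z) w (replicate k False) = (if w ! i then xorl a g else g)"
    using hash_repl[of z k w "replicate k False" i] assms by auto
  then show ?thesis using assms(3) xorl_zero[of g k] by auto
qed

section \<open>Exchanging a column of the query with the fresh column\<close>

lemma length_repl:
  assumes "Suc i * k \<le> length z" "length a = k"
  shows "length (repl k i a z) = length z"
  using assms by (simp add: repl_def)

lemma repl_repl:
  assumes "Suc i * k \<le> length z" "length a = k" "length b = k"
  shows "repl k i b (repl k i a z) = repl k i b z"
  using assms by (simp add: repl_def)

lemma repl_self:
  shows "repl k i (take k (drop (i * k) z)) z = z"
proof -
  have "take k (drop (i * k) z) @ drop (Suc i * k) z = drop (i * k) z"
    by (metis append_take_drop_id drop_drop mult_Suc add.commute)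
  then show ?thesis by (simp add: repl_def)
qed

lemma slot_repl:
  assumes "Suc i * k \<le> length z" "length a = k"
  shows "take k (drop (i * k) (repl k i a z)) = a"
  using assms by (simp add: repl_def)

lemma take_repl:
  assumes "Suc i * k \<le> m" "m \<le> length z" "length a = k"
  shows "take m (repl k i a z) = repl k i a (take m z)"
proof -
  have "i * k + (m - Suc i * k) + k = m" using assms(1) by simp
  then have "take m (repl k i a z) = take (i * k) z @ a @ take (m - Suc i * k) (drop (Suc i * k) z)"
    using assms by (simp add: repl_def add.commute)
  moreover have "take (i * k) (take m z) = take (i * k) z" using assms(1) by (simp add: min_def)
  moreover have "drop (Suc i * k) (take m z) = take (m - Suc i * k) (drop (Suc i * k) z)" by (rule drop_take)
  ultimately show ?thesis by (simp add: repl_def)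
qed

lemma drop_repl:
  assumes "Suc i * k \<le> m" "m \<le> length z" "length a = k"
  shows "drop m (repl k i a z) = drop m z"
proof -
  have "m = i * k + (k + (m - Suc i * k))" using assms(1) by simp
  then have "drop m (repl k i a z) = drop (m - Suc i * k) (drop (Suc i * k) z)"
    using assms unfolding repl_def by (simp del: drop_drop add: add.commute)
  then show ?thesis using assms(1) by simp
qed

text \<open>This involution turns the \<open>i\<close>-th query into the initial segment of the random string.\<close>
definition swap :: "nat \<Rightarrow> nat \<Rightarrow> nat \<Rightarrow> bool list \<Rightarrow> bool list" where
  "swap k M i b = repl k i (take k (drop M b)) (take M b) @ take k (drop (i * k) b) @ drop (M + k) b"

lemma swap_props:
  assumes "length b = M + k + Q" "Suc i * k \<le> M"
  shows "length (swap k M i b) = M + k + Q"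
    "take M (swap k M i b) = repl k i (take k (drop M b)) (take M b)"
    "take k (drop M (swap k M i b)) = take k (drop (i * k) b)"
    "drop (M + k) (swap k M i b) = drop (M + k) b"
    "take M b = repl k i (take k (drop M (swap k M i b))) (take M (swap k M i b))"
    "swap k M i (swap k M i b) = b"
proof -
  let ?a = "take k (drop M b)"
  have a: "length ?a = k" and M: "length (take M b) = M" using assms(1) by auto
  have len: "length (repl k i ?a (take M b)) = M" using length_repl[of i k "take M b" ?a] assms(2) a M by simp
  have col: "length (take k (drop (i * k) b)) = k" using assms by simp
  show 1: "length (swap k M i b) = M + k + Q" using len col assms(1) by (simp add: swap_def)
  show 2: "take M (swap k M i b) = repl k i ?a (take M b)" using len by (simp add: swap_def)
  show 3: "take k (drop M (swap k M i b)) = take k (drop (i * k) b)" using len col by (simp add: swap_def)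
  show 4: "drop (M + k) (swap k M i b) = drop (M + k) b" using len col by (simp add: swap_def)
  have col': "take k (drop (i * k) b) = take k (drop (i * k) (take M b))"
    using assms(2) by (simp add: drop_take min_def)
  show 5: "take M b = repl k i (take k (drop M (swap k M i b))) (take M (swap k M i b))"
    unfolding 2 3 using repl_repl[of i k "take M b" ?a "take k (drop (i * k) b)"] assms(2) M a col
      repl_self[of k i "take M b"] col' by simp
  have "take k (drop (i * k) (swap k M i b)) = take k (drop (i * k) (take M (swap k M i b)))"
    using assms(2) by (simp add: drop_take min_def)
  also have "\<dots> = ?a" unfolding 2 by (rule slot_repl) (use assms(2) M a in auto)
  finally have "swap k M i (swap k M i b) = take M b @ ?a @ drop (M + k) b"
    unfolding swap_def[of k M i "swap k M i b"] 5[symmetric] 4 by simp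
  also have "\<dots> = b" by (metis append_take_drop_id drop_drop add.commute)
  finally show "swap k M i (swap k M i b) = b" .
qed

text \<open>Because the exchange preserves length and is injective, an event about a modified query
  is no more frequent than the same event about the unmodified block.\<close>

lemma card_swap:
  assumes "Suc i * k \<le> M"
  shows "card {b. length b = M + k + Q \<and> F (swap k M i b)} \<le> card {b. length b = M + k + Q \<and> F b}"
proof (rule card_inj_on_le[of "swap k M i"])
  show "inj_on (swap k M i) {b. length b = M + k + Q \<and> F (swap k M i b)}"
    using swap_props(6)[OF _ assms] by (intro inj_onI) (metis (mono_tags) mem_Collect_eq)
  show "swap k M i ` {b. length b = M + k + Q \<and> F (swap k M i b)} \<subseteq> {b. length b = M + k + Q \<and> F b}"
    using swap_props(1)[OF _ assms] by auto
  show "finite {b. length b = M + k + Q \<and> F b}" by (rule finite_subset[OF _ finite_bitstrings[of "M + k + Q"]]) auto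
qed

context search
begin

text \<open>If \<open>r\<close> is the hash of the sought word \<open>w\<close>, then the query for bit \<open>i\<close> still has this form
  when \<open>w ! i\<close> is false, and is a uniformly random string when \<open>w ! i\<close> is true.\<close>
lemma trial_count:
  fixes Bad :: "bool list \<Rightarrow> bool list \<Rightarrow> bool" and Comp :: "bool list \<Rightarrow> bool"
  defines "h y w \<equiv> nat_of_bits (pout y w)"
  assumes x: "length x = n" and w: "length w = LL n" and M: "M = kk n * LL n + kk n + e"
    and sound: "\<And>z pad v. length z = kk n * LL n \<Longrightarrow> length pad = e \<Longrightarrow> length v = Q \<Longrightarrow>
      \<not> Bad (x @ z @ hash (kk n) z w (replicate (kk n) False) @ pad) v \<Longrightarrow>
      h (x @ z @ hash (kk n) z w (replicate (kk n) False) @ pad) v \<le> thr x e"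
    and complete: "\<And>u v. length u = M \<Longrightarrow> length v = Q \<Longrightarrow> \<not> Bad (x @ u) v \<Longrightarrow> \<not> Comp (x @ u) \<Longrightarrow> thr x e < h (x @ u) v"
    and bad: "4 * LL n * 2 ^ kk n * card {b. length b = M + kk n + Q \<and> Bad (x @ take M b) (drop (M + kk n) b)} \<le> 2 ^ (M + kk n + Q)"
    and comp: "4 * LL n * card {b. length b = M + kk n + Q \<and> Comp (x @ take M b)} \<le> 2 ^ (M + kk n + Q)"
  shows "2 ^ (M + kk n + Q) \<le> 2 * 2 ^ kk n * card {b. length b = M + kk n + Q \<and> cand x b e = w}"
proof -
  let ?k = "kk n" and ?L = "LL n" and ?l = "M + kk n + Q"
  let ?hash = "\<lambda>z. hash ?k z w (replicate ?k False)"
  let ?\<Omega> = "{b :: bool list. length b = ?l}"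
  \<comment> \<open>\<open>E\<close> is the event that the bet on \<open>r\<close> is right, and
    \<open>F i\<close> that moreover bit \<open>i\<close> is read wrongly.\<close>
  define E where "E = {b \<in> ?\<Omega>. take ?k (drop (?k * ?L) b) = ?hash (take (?k * ?L) b)}"
  define F where "F i = {b \<in> E. abit x b e i \<noteq> w ! i}" for i
  define \<beta> where "\<beta> = card {b \<in> ?\<Omega>. Bad (x @ take M b) (drop (M + ?k) b)}"
  define \<gamma> where "\<gamma> = card {b \<in> ?\<Omega>. Comp (x @ take M b)}"
  define S where "S = {b \<in> ?\<Omega>. cand x b e = w}"
  have finE: "finite E" "finite S" unfolding E_def S_def by auto
  have lenh: "length (?hash z) = ?k" if "length z = ?k * ?L" for z
    using that w by (intro length_hash) auto
  \<comment> \<open>On \<open>E\<close> the bits \<open>r\<close> are determined by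
    \<open>z\<close>, so the bet is right with density \<open>1 / 2 ^ kk n\<close>.\<close>
  have cardE: "2 ^ ?k * card E = 2 ^ ?l"
  proof -
    have l: "?l = ?k * ?L + ?k + (e + ?k + Q)" using M by simp
    have "card E = 2 ^ (?k * ?L) * 2 ^ (e + ?k + Q)"
      using card_slot_fixed[of "?k * ?L" "e + ?k + Q" "\<lambda>u v. ?hash u" ?k "\<lambda>_ _. True", OF lenh]
      unfolding E_def l by (simp add: card_cartesian_product)
    then show ?thesis by (simp add: l power_add)
  qed
  have q: "query x b e i = x @ take M (swap ?k M i b)" and ac: "acoins x b e = drop (M + ?k) (swap ?k M i b)"
    and z: "take (?k * ?L) (take M (swap ?k M i b)) = repl ?k i (take ?k (drop M b)) (take (?k * ?L) b)"
    and z': "take (?k * ?L) b = repl ?k i (take ?k (drop M (swap ?k M i b))) (take (?k * ?L) (swap ?k M i b))"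
    and r: "drop (?k * ?L) (take M (swap ?k M i b)) = drop (?k * ?L) (take M b)"
    and le: "Suc i * ?k \<le> M"
    if "b \<in> ?\<Omega>" "i < ?L" for b i
  proof -
    have ik: "Suc i * ?k \<le> ?k * ?L" using that(2) by (metis Suc_leI mult.commute mult_le_mono2)
    then show le: "Suc i * ?k \<le> M" using M by simp
    have len: "length b = M + ?k + Q" using that(1) by simp
    note sw = swap_props[OF len le]
    show "query x b e i = x @ take M (swap ?k M i b)" unfolding query_def x M[symmetric] sw(2) ..
    show "acoins x b e = drop (M + ?k) (swap ?k M i b)" unfolding acoins_def x M[symmetric] sw(4) ..
    have a: "length (take ?k (drop M b)) = ?k" using len by simp
    have kM: "?k * ?L \<le> M" using M by simp
    show "take (?k * ?L) (take M (swap ?k M i b)) = repl ?k i (take ?k (drop M b)) (take (?k * ?L) b)"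
      unfolding sw(2) using take_repl[OF ik _ a, of "take M b"] kM len by (simp add: min_def)
    have a': "length (take ?k (drop M (swap ?k M i b))) = ?k" using sw(1) by simp
    have "take (?k * ?L) b = take (?k * ?L) (take M b)" using kM by (simp add: min_def)
    also have "\<dots> = take (?k * ?L) (repl ?k i (take ?k (drop M (swap ?k M i b))) (take M (swap ?k M i b)))"
      unfolding sw(5)[symmetric] ..
    also have "\<dots> = repl ?k i (take ?k (drop M (swap ?k M i b))) (take (?k * ?L) (take M (swap ?k M i b)))"
      using kM sw(1) by (intro take_repl[OF ik _ a']) simp
    also have "take (?k * ?L) (take M (swap ?k M i b)) = take (?k * ?L) (swap ?k M i b)"
      using kM by (simp add: min_def)
    finally show "take (?k * ?L) b = repl ?k i (take ?k (drop M (swap ?k M i b))) (take (?k * ?L) (swap ?k M i b))" .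
    show "drop (?k * ?L) (take M (swap ?k M i b)) = drop (?k * ?L) (take M b)"
      unfolding sw(2) by (rule drop_repl[OF ik _ a]) (use kM len in simp)
  qed
  \<comment> \<open>Both sides are scaled by \<open>2 ^ kk n\<close> for the comparison with
    \<open>E\<close>. Errors of the heuristic are not independent of \<open>E\<close>: for a 0 bit
    their whole weight has to be charged, which is why \<open>bad\<close> carries the factor
    \<open>2 ^ kk n\<close>.\<close>
  have F: "2 ^ ?k * card (F i) \<le> 2 ^ ?k * \<beta> + \<gamma>" if i: "i < ?L" for i
  proof (cases "w ! i")
    case False
    \<comment> \<open>Column \<open>i\<close> does not enter the hash, so the query is again of the
      compressible kind and a wrong bit is an error of the heuristic on it.\<close>
    have "F i \<subseteq> {b. length b = ?l \<and> (\<lambda>b. Bad (x @ take M b) (drop (M + ?k) b)) (swap ?k M i b)}"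
    proof
      fix b assume b: "b \<in> F i"
      then have bO: "b \<in> ?\<Omega>" and bE: "take ?k (drop (?k * ?L) b) = ?hash (take (?k * ?L) b)"
        by (auto simp: F_def E_def)
      note f = q[OF bO i] ac[OF bO i] z[OF bO i] r[OF bO i]
      have len: "length b = ?l" using bO by simp
      let ?u = "take M (swap ?k M i b)" and ?v = "drop (M + ?k) (swap ?k M i b)"
      have lu: "length ?u = M" "length ?v = Q" using swap_props(1)[OF len le[OF bO i]] by auto
      let ?z = "take (?k * ?L) ?u"
      have a: "length (take ?k (drop M b)) = ?k" and zl: "length (take (?k * ?L) b) = ?k * length w"
        "length ?z = ?k * ?L" using len M w lu by auto
      have "?hash ?z = ?hash (take (?k * ?L) b)"
      proof -
        have c: "length (take ?k (drop (i * ?k) (take (?k * ?L) b))) = ?k"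
        proof -
          have "Suc i * ?k \<le> ?k * ?L" using i by (metis Suc_leI mult.commute mult_le_mono2)
          moreover have "length (take (?k * ?L) b) = ?k * ?L" using zl(1) w by simp
          ultimately show ?thesis by (simp only: length_take length_drop) simp
        qed
        have iw: "i < length w" using i w by simp
        show ?thesis
          using hash_repl_zero[OF zl(1) iw a] hash_repl_zero[OF zl(1) iw c] False
          unfolding f(3) repl_self by simp
      qed
      moreover have "take ?k (drop (?k * ?L) ?u) = take ?k (drop (?k * ?L) b)"
        unfolding f(4) using M by (simp add: drop_take)
      ultimately have "?u = ?z @ ?hash ?z @ drop (?k * ?L + ?k) ?u"
        using bE by (metis append_take_drop_id drop_drop add.commute)
      moreover have "length (drop (?k * ?L + ?k) ?u) = e" using lu M by simp
      moreover have "thr x e < h (x @ ?u) ?v"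
        using b False unfolding F_def by (simp add: abit_iff f h_def)
      ultimately have "Bad (x @ ?u) ?v"
        using sound[OF zl(2), of "drop (?k * ?L + ?k) ?u" ?v] lu(2) by (metis leD)
      then show "b \<in> {b. length b = ?l \<and> (\<lambda>b. Bad (x @ take M b) (drop (M + ?k) b)) (swap ?k M i b)}"
        using len by simp
    qed
    then have "card (F i) \<le> card {b. length b = ?l \<and> (\<lambda>b. Bad (x @ take M b) (drop (M + ?k) b)) (swap ?k M i b)}"
      by (rule card_mono[rotated]) (rule finite_subset[OF _ finite_bitstrings[of ?l]], auto)
    also have "\<dots> \<le> \<beta>" unfolding \<beta>_def using card_swap[OF le[OF _ i], of "replicate ?l False" Q "\<lambda>b. Bad (x @ take M b) (drop (M + ?k) b)"] by simp
    finally show ?thesis by (simp add: trans_le_add1)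
  next
    case True
    let ?G = "\<lambda>u v. Bad (x @ u) v \<or> Comp (x @ u)"
    \<comment> \<open>After the exchange the original column \<open>i\<close> occupies the spare
      slot, and membership in \<open>E\<close> says that it equals \<open>?g\<close> of the query.
      The slot is thus determined while the query is unrestricted, hence uniform.\<close>
    let ?g = "\<lambda>u v :: bool list. xorl (take ?k (drop (?k * ?L) u)) (?hash (repl ?k i (replicate ?k False) (take (?k * ?L) u)))"
    let ?T = "\<lambda>b. take ?k (drop M b) = ?g (take M b) (drop (M + ?k) b) \<and> ?G (take M b) (drop (M + ?k) b)"
    have "F i \<subseteq> {b. length b = ?l \<and> ?T (swap ?k M i b)}"
    proof
      fix b assume b: "b \<in> F i"
      then have bO: "b \<in> ?\<Omega>" and bE: "take ?k (drop (?k * ?L) b) = ?hash (take (?k * ?L) b)"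
        by (auto simp: F_def E_def)
      note f = q[OF bO i] ac[OF bO i] z'[OF bO i] r[OF bO i]
      have len: "length b = ?l" using bO by simp
      let ?s = "swap ?k M i b"
      let ?u = "take M ?s" and ?v = "drop (M + ?k) ?s" and ?a = "take ?k (drop M (swap ?k M i b))"
      have lu: "length ?u = M" "length ?v = Q" "length ?a = ?k" using swap_props(1)[OF len le[OF bO i]] by auto
      have kM: "?k * ?L \<le> M" using M by simp
      have tu: "take (?k * ?L) ?s = take (?k * ?L) ?u" using kM by (simp add: min_def)
      have zl: "length (take (?k * ?L) ?u) = ?k * length w" using lu M w by simp
      let ?hz = "?hash (repl ?k i (replicate ?k False) (take (?k * ?L) ?u))"
      have "take ?k (drop (?k * ?L) b) = xorl ?a ?hz"
        unfolding bE f(3) tu using hash_repl_zero[OF zl, of i ?a] i w lu True by simp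
      moreover have "take ?k (drop (?k * ?L) ?u) = take ?k (drop (?k * ?L) b)"
        unfolding f(4) using M by (simp add: drop_take)
      moreover have "length ?hz = ?k"
      proof (rule lenh)
        have "Suc i * ?k \<le> ?k * ?L" using i by (metis Suc_leI mult.commute mult_le_mono2)
        then show "length (repl ?k i (replicate ?k False) (take (?k * ?L) ?u)) = ?k * ?L"
          using zl w by (subst length_repl) auto
      qed
      ultimately have "?a = ?g ?u ?v" using xorl_cancel[of ?a ?hz] lu(3) by simp
      moreover have "h (x @ ?u) ?v \<le> thr x e"
        using b True unfolding F_def by (simp add: abit_iff f h_def)
      then have "?G ?u ?v" using complete[OF lu(1,2)] by (metis leD)
      ultimately show "b \<in> {b. length b = ?l \<and> ?T (swap ?k M i b)}" using len by simp
    qed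
    then have "card (F i) \<le> card {b. length b = ?l \<and> ?T (swap ?k M i b)}"
      by (rule card_mono[rotated]) (rule finite_subset[OF _ finite_bitstrings[of ?l]], auto)
    also have "\<dots> \<le> card {b. length b = ?l \<and> ?T b}"
      using card_swap[OF le[OF _ i], of "replicate ?l False" Q ?T] by simp
    also have "\<dots> = card {(u, v). length u = M \<and> length v = Q \<and> ?G u v}"
    proof (rule card_slot_fixed)
      fix u v :: "bool list" assume "length u = M"
      then have "length (take ?k (drop (?k * ?L) u)) = ?k" "length (take (?k * ?L) u) = ?k * ?L" using M by auto
      moreover have "Suc i * ?k \<le> ?k * ?L" using i by (metis Suc_leI mult.commute mult_le_mono2)
      ultimately show "length (?g u v) = ?k"
        using lenh[of "repl ?k i (replicate ?k False) (take (?k * ?L) u)"] by (simp add: length_repl)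
    qed
    finally have "2 ^ ?k * card (F i) \<le> 2 ^ ?k * card {(u, v). length u = M \<and> length v = Q \<and> ?G u v}"
      by (rule mult_le_mono2)
    also have "\<dots> = card {b. length b = ?l \<and> ?G (take M b) (drop (M + ?k) b)}"
      by (rule card_slot_free[symmetric])
    also have "{b. length b = ?l \<and> ?G (take M b) (drop (M + ?k) b)} =
        {b \<in> ?\<Omega>. Bad (x @ take M b) (drop (M + ?k) b)} \<union> {b \<in> ?\<Omega>. Comp (x @ take M b)}" by auto
    also have "card \<dots> \<le> \<beta> + \<gamma>" unfolding \<beta>_def \<gamma>_def by (rule card_Un_le)
    also have "\<dots> \<le> 2 ^ ?k * \<beta> + \<gamma>" by simp
    finally show ?thesis .
  qed
  have "E \<subseteq> S \<union> (\<Union>i\<in>{..<?L}. F i)"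
  proof
    fix b assume b: "b \<in> E"
    show "b \<in> S \<union> (\<Union>i\<in>{..<?L}. F i)"
    proof (cases "\<exists>i<?L. b \<in> F i")
      case False
      then have "cand x b e = w" using b w x by (intro nth_equalityI) (auto simp: cand_def F_def)
      then show ?thesis using b by (auto simp: S_def E_def)
    qed auto
  qed
  moreover have finF: "finite (F i)" for i unfolding F_def using finE by simp
  ultimately have "card E \<le> card (S \<union> (\<Union>i\<in>{..<?L}. F i))" using finE by (intro card_mono) auto
  also have "\<dots> \<le> card S + card (\<Union>i\<in>{..<?L}. F i)" by (rule card_Un_le)
  also have "\<dots> \<le> card S + (\<Sum>i<?L. card (F i))" using card_UN_le[of "{..<?L}" F] by simp
  finally have "2 ^ ?k * card E \<le> 2 ^ ?k * card S + (\<Sum>i<?L. 2 ^ ?k * card (F i))"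
    by (metis add_mult_distrib2 mult_le_mono2 sum_distrib_left)
  also have "(\<Sum>i<?L. 2 ^ ?k * card (F i)) \<le> (\<Sum>i<?L. 2 ^ ?k * \<beta> + \<gamma>)" using F by (intro sum_mono) auto
  finally have "2 ^ ?l \<le> 2 ^ ?k * card S + ?L * (2 ^ ?k * \<beta> + \<gamma>)" unfolding cardE by simp
  \<comment> \<open>Each of the two error sums takes at most a quarter of the weight of
    \<open>E\<close>, so at least half of it remains.\<close>
  moreover have "4 * (?L * (2 ^ ?k * \<beta>)) \<le> 2 ^ ?l" "4 * (?L * \<gamma>) \<le> 2 ^ ?l"
    using bad comp unfolding \<beta>_def \<gamma>_def by (simp_all add: mult_ac)
  ultimately have "2 ^ ?l \<le> 2 * (2 ^ ?k * card S)" unfolding add_mult_distrib2 by linarith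
  then show ?thesis unfolding S_def by (simp add: mult.assoc)
qed

end

section \<open>From a single trial to the whole experiment\<close>

lemma finite_sub_bitstrings [simp]: "finite {b :: bool list. length b = m \<and> F b}"
  by (rule finite_subset[OF _ finite_bitstrings[of m]]) auto

lemma card_sub_bitstrings: "card {b :: bool list. length b = m \<and> F b} + card {b. length b = m \<and> \<not> F b} = 2 ^ m"
proof -
  have "card ({b :: bool list. length b = m \<and> F b} \<union> {b. length b = m \<and> \<not> F b}) =
      card {b :: bool list. length b = m \<and> F b} + card {b. length b = m \<and> \<not> F b}"
    by (rule card_Un_disjoint) auto
  moreover have "{b :: bool list. length b = m \<and> F b} \<union> {b. length b = m \<and> \<not> F b} = {b. length b = m}" by auto
  ultimately show ?thesis by simp
qed

lemma real_card_sub_bitstrings: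
  "real (card {b :: bool list. length b = m \<and> F b}) + real (card {b. length b = m \<and> \<not> F b}) = 2 ^ m"
proof -
  have "real (card {b :: bool list. length b = m \<and> F b} + card {b. length b = m \<and> \<not> F b}) = real (2 ^ m)"
    unfolding card_sub_bitstrings ..
  then show ?thesis by simp
qed

lemma sum_card_pairs:
  fixes F :: "bool list \<Rightarrow> bool list \<Rightarrow> bool"
  shows "card {(y, v). length y = N \<and> length v = Q \<and> F y v} = (\<Sum>y\<in>{y. length y = N}. card {v. length v = Q \<and> F y v})"
proof -
  have "{(y, v). length y = N \<and> length v = Q \<and> F y v} = (SIGMA y:{y. length y = N}. {v. length v = Q \<and> F y v})" by auto
  then show ?thesis by (simp add: card_SigmaI)
qed

locale attack = search_PT K U t c C aq eq m k P aa v0 D B R m' k' + universal U dec aq eq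
  for K U t c C aq eq m k P aa v0 D B R m' k' dec +
  assumes v0: "v0 = Inf {}"
    and copy: "\<And>x T. 1 \<le> T \<Longrightarrow> \<exists>desc. length desc \<le> length x + c \<and> univ_outputs U desc T x"
begin

lemma uout_iff: "length p \<le> LL n \<Longrightarrow> uout n p = True # x \<longleftrightarrow> univ_outputs U p (t n) x"
  unfolding uout_def usteps_def
  by (rule univ_outputs_iff[symmetric]) (intro mult_le_mono2 power_mono, auto)

lemma val_good: "good_val (Suc (Kt U t x)) (val x b e)"
proof (cases "uout (length x) (strip (cand x b e)) = True # x")
  case True
  have "length (strip (cand x b e)) \<le> LL (length x)"
    using length_strip[of "cand x b e"] by (simp add: cand_def)
  with True have "univ_outputs U (strip (cand x b e)) (t (length x)) x" by (simp add: uout_iff)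
  from Kt_le[of _ t, OF this] show ?thesis using True by (simp add: val_def good_val_def)
qed (simp add: val_def good_val_def)

text \<open>If \<open>x\<close> has no description within time \<open>t\<close>, its complexity is
  the junk value of an empty infimum. No candidate passes the verification then, and the answer
  falls back to this very value.\<close>

lemma answer_trivial:
  assumes "\<And>p. \<not> univ_outputs U p (t (length x)) x"
  shows "nat_of_bits (answer x r) = Kt U t x"
proof -
  have val0: "val x b e = 0" for b e
    using assms uout_iff[of "strip (cand x b e)" "length x" x] length_strip[of "cand x b e"]
    by (simp add: val_def cand_def)
  have "good_val (Suc (result x r)) (result x r)" by (rule result_good) (simp add: good_val_def val0)
  then have "result x r = 0" by (simp add: good_val_def)
  moreover have "Kt U t x = Inf {}" using assms by (simp add: Kt_def)
  ultimately show ?thesis by (simp add: answer_def v0[symmetric])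
qed

lemma answer_hit:
  assumes "univ_outputs U p (t (length x)) x" "length p = Kt U t x" "length p < LL (length x)"
    and "j < R (length x)" "e < D (length x)"
    and "cand x (take (B (length x)) (drop (j * B (length x)) r)) e = padw (LL (length x)) p"
  shows "nat_of_bits (answer x r) = Kt U t x"
proof -
  have "val x (take (B (length x)) (drop (j * B (length x)) r)) e = Suc (Kt U t x)"
    using assms(1-3,6) by (simp add: val_def strip_padw uout_iff)
  with assms(4,5) have "result x r = Suc (Kt U t x)" by (intro result_hit[OF _ val_good]) auto
  then show ?thesis by (simp add: answer_def)
qed

text \<open>One trial hits with probability at least \<open>1 / (2 * 2 ^ kk n)\<close>, so all
  \<open>R n\<close> trials miss with probability at most \<open>2 * 2 ^ kk n / R n\<close>.\<close>

lemma answer_prob: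
  assumes x: "length x = n" and p: "univ_outputs U p (t n) x" "length p = Kt U t x" "length p < LL n"
    and e: "e < D n" and R: "0 < R n"
    and count: "2 ^ B n \<le> 2 * 2 ^ kk n * card {b. length b = B n \<and> cand x b e = padw (LL n) p}"
  shows "(1 - 2 * 2 ^ kk n / R n) * 2 ^ (R n * B n) \<le>
    card {r. length r = R n * B n \<and> nat_of_bits (answer x r) = Kt U t x}"
proof -
  let ?G = "{b. cand x b e = padw (LL n) p}"
  let ?u = "1 / (2 * 2 ^ kk n) :: real"
  have "card {r. length r = R n * B n \<and> nat_of_bits (answer x r) \<noteq> Kt U t x} \<le>
      card {r :: bool list. length r = R n * B n \<and> (\<forall>j<R n. take (B n) (drop (j * B n) r) \<notin> ?G)}"
    using answer_hit[of p x] p e x by (intro card_mono) auto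
  also have "\<dots> = card {b. length b = B n \<and> b \<notin> ?G} ^ R n" by (rule card_blocks)
  finally have 1: "real (card {r. length r = R n * B n \<and> nat_of_bits (answer x r) \<noteq> Kt U t x}) \<le>
      real (card {b. length b = B n \<and> b \<notin> ?G}) ^ R n"
    unfolding of_nat_power[symmetric] of_nat_le_iff .
  have "real (2 ^ B n) \<le> real (2 * 2 ^ kk n * card {b. length b = B n \<and> b \<in> ?G})"
    using count by (subst of_nat_le_iff) simp
  then have "?u * 2 ^ B n \<le> real (card {b. length b = B n \<and> b \<in> ?G})"
    by (simp add: field_simps)
  moreover have "real (card {b. length b = B n \<and> b \<in> ?G}) + real (card {b. length b = B n \<and> b \<notin> ?G}) = 2 ^ B n"
    by (rule real_card_sub_bitstrings)
  ultimately have "real (card {b. length b = B n \<and> b \<notin> ?G}) \<le> (1 - ?u) * 2 ^ B n"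
    by (simp only: left_diff_distrib)
  then have "real (card {b. length b = B n \<and> b \<notin> ?G}) ^ R n \<le> ((1 - ?u) * 2 ^ B n) ^ R n"
    by (intro power_mono) auto
  also have "\<dots> = (1 - ?u) ^ R n * 2 ^ (R n * B n)"
    by (simp add: power_mult_distrib power_mult[symmetric] mult.commute)
  also have "\<dots> \<le> (1 / (real (R n) * ?u)) * 2 ^ (R n * B n)"
  proof (intro mult_right_mono power_decay)
    have "(1 :: real) \<le> 2 * 2 ^ kk n" using one_le_power[of "2 :: real" "kk n"] by linarith
    then show "?u \<le> 1" by simp
  qed (use R in auto)
  finally have "real (card {r. length r = R n * B n \<and> nat_of_bits (answer x r) \<noteq> Kt U t x}) \<le>
      (1 / (real (R n) * ?u)) * 2 ^ (R n * B n)" by (rule order_trans[OF 1])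
  then have "real (card {r. length r = R n * B n \<and> nat_of_bits (answer x r) \<noteq> Kt U t x}) \<le>
      2 * 2 ^ kk n / R n * 2 ^ (R n * B n)" by simp
  moreover have "real (card {r. length r = R n * B n \<and> nat_of_bits (answer x r) = Kt U t x}) +
      real (card {r. length r = R n * B n \<and> nat_of_bits (answer x r) \<noteq> Kt U t x}) = 2 ^ (R n * B n)"
    by (rule real_card_sub_bitstrings)
  ultimately show ?thesis by (simp only: left_diff_distrib)
qed

text \<open>The error \<open>1 / q\<close> is divided into three equal parts. By Markov at most a
  fraction \<open>1 / (3 * q)\<close> of the \<open>x\<close> meets too many errors of the
  heuristic, and at most as many meet too many compressible queries; for the others all trials miss
  with probability at most \<open>1 / (3 * q)\<close>. So 12 is 3 times the 4 required for a single
  \<open>x\<close>, and 6 is 3 times the 2 in the bound on misses.\<close>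

lemma experiment_bound:
  fixes Bad :: "bool list \<Rightarrow> bool list \<Rightarrow> bool" and Comp :: "bool list \<Rightarrow> bool" and q :: real
  defines "h y w \<equiv> nat_of_bits (pout y w)"
  assumes M: "M = kk n * LL n + kk n + e" and e: "e < D n" and R: "0 < R n" and B: "B n = M + kk n + Q"
    and sound: "\<And>x p z pad v. length x = n \<Longrightarrow> univ_outputs U p (t n) x \<Longrightarrow> length p < LL n \<Longrightarrow>
      length z = kk n * LL n \<Longrightarrow> length pad = e \<Longrightarrow> length v = Q \<Longrightarrow>
      \<not> Bad (x @ z @ hash (kk n) z (padw (LL n) p) (replicate (kk n) False) @ pad) v \<Longrightarrow>
      h (x @ z @ hash (kk n) z (padw (LL n) p) (replicate (kk n) False) @ pad) v \<le> thr x e"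
    and complete: "\<And>x u v. length x = n \<Longrightarrow> length u = M \<Longrightarrow> length v = Q \<Longrightarrow>
      \<not> Bad (x @ u) v \<Longrightarrow> \<not> Comp (x @ u) \<Longrightarrow> thr x e < h (x @ u) v"
    and q: "1 \<le> q"
    and bad: "12 * q * LL n * 2 ^ kk n * card {(y, v). length y = n + M \<and> length v = Q \<and> Bad y v} \<le> 2 ^ (n + M + Q)"
    and comp: "12 * q * LL n * card {y. length y = n + M \<and> Comp y} \<le> 2 ^ (n + M)"
    and Rq: "6 * q * 2 ^ kk n \<le> R n"
  shows "1 - 1 / q \<le> measure_pmf.prob
    (heuristic_experiment (\<lambda>x. map_pmf (answer x) (coins (R (length x) * B (length x)))) n)
    {(x, v). v = Kt U t x}"
proof -
  let ?k = "kk n" and ?L = "LL n"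
  let ?X = "{x :: bool list. length x = n}"
  define f1 where "f1 x = real (4 * ?L * 2 ^ ?k * card {b. length b = M + ?k + Q \<and> Bad (x @ take M b) (drop (M + ?k) b)})" for x
  define f2 where "f2 x = real (4 * ?L * card {b. length b = M + ?k + Q \<and> Comp (x @ take M b)})" for x
  define good where "good x = real (card {r. length r = R n * B n \<and> nat_of_bits (answer x r) = Kt U t x})" for x
  have s1: "(\<Sum>x\<in>?X. f1 x) \<le> 2 ^ n * 2 ^ B n / (3 * q)"
  proof -
    let ?c = "card {(y, v). length y = n + M \<and> length v = Q \<and> Bad y v}"
    have "(\<Sum>x\<in>?X. f1 x) = real (4 * ?L * 2 ^ ?k * (2 ^ ?k * (\<Sum>x\<in>?X. card {(u, v). length u = M \<and> length v = Q \<and> Bad (x @ u) v})))"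
      unfolding f1_def card_slot_free[of M ?k Q "\<lambda>u v. Bad (_ @ u) v"] by (simp add: sum_distrib_left)
    also have "\<dots> = real (4 * ?L * 2 ^ ?k * (2 ^ ?k * ?c))" unfolding sum_card_prefix ..
    finally have "(\<Sum>x\<in>?X. f1 x) * (3 * q) = (12 * q * ?L * 2 ^ ?k * ?c) * 2 ^ ?k" by (simp add: mult_ac)
    also have "\<dots> \<le> 2 ^ (n + M + Q) * 2 ^ ?k" using bad by (intro mult_right_mono) auto
    also have "\<dots> = 2 ^ n * 2 ^ B n" by (simp add: B power_add mult_ac)
    finally show ?thesis using q by (simp add: field_simps)
  qed
  have s2: "(\<Sum>x\<in>?X. f2 x) \<le> 2 ^ n * 2 ^ B n / (3 * q)"
  proof -
    let ?c = "card {y. length y = n + M \<and> Comp y}"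
    have "(\<Sum>x\<in>?X. f2 x) = real (4 * ?L * (2 ^ ?k * (\<Sum>x\<in>?X. card {(u, v :: bool list). length u = M \<and> length v = Q \<and> Comp (x @ u)})))"
      unfolding f2_def card_slot_free[of M ?k Q "\<lambda>u v. Comp (_ @ u)"] by (simp add: sum_distrib_left)
    also have "(\<Sum>x\<in>?X. card {(u, v :: bool list). length u = M \<and> length v = Q \<and> Comp (x @ u)}) =
        card {(y, v :: bool list). length y = n + M \<and> length v = Q \<and> Comp y}"
      by (rule sum_card_prefix)
    also have "{(y, v :: bool list). length y = n + M \<and> length v = Q \<and> Comp y} =
        {y. length y = n + M \<and> Comp y} \<times> {v. length v = Q}" by auto
    finally have "(\<Sum>x\<in>?X. f2 x) * (3 * q) = (12 * q * ?L * ?c) * (2 ^ ?k * 2 ^ Q)"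
      by (simp add: card_cartesian_product mult_ac)
    also have "\<dots> \<le> 2 ^ (n + M) * (2 ^ ?k * 2 ^ Q)" using comp by (intro mult_right_mono) auto
    also have "\<dots> = 2 ^ n * 2 ^ B n" by (simp add: B power_add mult_ac)
    finally show ?thesis using q by (simp add: field_simps)
  qed
  let ?F = "{x \<in> ?X. \<not> 2 ^ B n < f1 x \<and> \<not> 2 ^ B n < f2 x}"
  have m1: "real (card {x \<in> ?X. 2 ^ B n < f1 x}) \<le> 2 ^ n / (3 * q)"
  proof (rule mult_right_le_imp_le[of _ "2 ^ B n"])
    show "real (card {x \<in> ?X. 2 ^ B n < f1 x}) * 2 ^ B n \<le> 2 ^ n / (3 * q) * 2 ^ B n"
      using card_markov[of ?X f1 _ "2 ^ B n", OF _ _ s1] by (simp add: f1_def)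
  qed simp
  have m2: "real (card {x \<in> ?X. 2 ^ B n < f2 x}) \<le> 2 ^ n / (3 * q)"
  proof (rule mult_right_le_imp_le[of _ "2 ^ B n"])
    show "real (card {x \<in> ?X. 2 ^ B n < f2 x}) * 2 ^ B n \<le> 2 ^ n / (3 * q) * 2 ^ B n"
      using card_markov[of ?X f2 _ "2 ^ B n", OF _ _ s2] by (simp add: f2_def)
  qed simp
  have "2 ^ n = card ?X" by simp
  also have "?X = ?F \<union> ({x \<in> ?X. 2 ^ B n < f1 x} \<union> {x \<in> ?X. 2 ^ B n < f2 x})" by auto
  also have "card \<dots> \<le> card ?F + (card {x \<in> ?X. 2 ^ B n < f1 x} + card {x \<in> ?X. 2 ^ B n < f2 x})"
    by (meson card_Un_le add_left_mono order_trans)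
  finally have "real (2 ^ n) \<le> real (card ?F + (card {x \<in> ?X. 2 ^ B n < f1 x} + card {x \<in> ?X. 2 ^ B n < f2 x}))"
    by (subst of_nat_le_iff)
  moreover have "2 ^ n * (1 - 2 / (3 * q)) = 2 ^ n - 2 ^ n / (3 * q) - 2 ^ n / (3 * q)"
    by (simp add: algebra_simps)
  ultimately have F: "2 ^ n * (1 - 2 / (3 * q)) \<le> real (card ?F)"
    using m1 m2 unfolding of_nat_add of_nat_power of_nat_numeral by linarith
  have each: "(1 - 1 / (3 * q)) * 2 ^ (R n * B n) \<le> good x" if x: "x \<in> ?F" for x
  proof (cases "\<exists>p. univ_outputs U p (t n) x")
    case True
    have len: "length x = n" using x by simp
    then obtain p where p: "univ_outputs U p (t n) x" "length p = Kt U t x"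
      using True Kt_attained[of _ t x] by auto
    have "1 \<le> t n" using univ_outputs_0 p(1) by (cases "t n") auto
    from copy[OF this, of x] obtain d where "length d \<le> n + c" "univ_outputs U d (t n) x" using len by auto
    then have pL: "length p < LL n" using Kt_le[of d t x] len p(2) by (simp add: LL_def)
    have "2 ^ (M + ?k + Q) \<le> 2 * 2 ^ ?k * card {b. length b = M + ?k + Q \<and> cand x b e = padw ?L p}"
    proof (rule trial_count[OF len length_padw[OF pL] M, where Bad = Bad and Comp = Comp])
      show "nat_of_bits (pout (x @ z @ hash ?k z (padw ?L p) (replicate ?k False) @ pad) v) \<le> thr x e"
        if "length z = ?k * ?L" "length pad = e" "length v = Q"
          "\<not> Bad (x @ z @ hash ?k z (padw ?L p) (replicate ?k False) @ pad) v" for z pad v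
        using sound[OF len p(1) pL that] by (simp add: h_def)
      show "thr x e < nat_of_bits (pout (x @ u) v)"
        if "length u = M" "length v = Q" "\<not> Bad (x @ u) v" "\<not> Comp (x @ u)" for u v
        using complete[OF len that] by (simp add: h_def)
      have "f1 x \<le> real (2 ^ B n)" "f2 x \<le> real (2 ^ B n)" using x by auto
      then show "4 * ?L * 2 ^ ?k * card {b. length b = M + ?k + Q \<and> Bad (x @ take M b) (drop (M + ?k) b)} \<le> 2 ^ (M + ?k + Q)"
        "4 * ?L * card {b. length b = M + ?k + Q \<and> Comp (x @ take M b)} \<le> 2 ^ (M + ?k + Q)"
        unfolding f1_def f2_def B of_nat_le_iff by blast+
    qed
    then have "(1 - 2 * 2 ^ ?k / R n) * 2 ^ (R n * B n) \<le> good x"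
      unfolding good_def B[symmetric] by (intro answer_prob[OF len p pL e R])
    moreover have "2 * 2 ^ ?k / R n \<le> 1 / (3 * q)" using Rq R q by (simp add: field_simps)
    then have "(1 - 1 / (3 * q)) * 2 ^ (R n * B n) \<le> (1 - 2 * 2 ^ ?k / R n) * 2 ^ (R n * B n)"
      by (intro mult_right_mono) auto
    ultimately show ?thesis by linarith
  next
    case False
    then have "nat_of_bits (answer x r) = Kt U t x" for r using x by (intro answer_trivial) auto
    then have "good x = 2 ^ (R n * B n)" by (simp add: good_def)
    then show ?thesis using q by simp
  qed
  have "1 - 1 / q \<le> (1 - 2 / (3 * q)) * (1 - 1 / (3 * q))"
    using q by (simp add: field_simps)
  then have "(1 - 1 / q) * 2 ^ (n + R n * B n) \<le> (2 ^ n * (1 - 2 / (3 * q))) * ((1 - 1 / (3 * q)) * 2 ^ (R n * B n))"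
    by (simp add: power_add mult_ac)
  also have "\<dots> \<le> real (card ?F) * ((1 - 1 / (3 * q)) * 2 ^ (R n * B n))"
    using F q by (intro mult_right_mono) auto
  also have "\<dots> = (\<Sum>x\<in>?F. (1 - 1 / (3 * q)) * 2 ^ (R n * B n))" by simp
  also have "\<dots> \<le> (\<Sum>x\<in>?F. good x)" using each by (intro sum_mono)
  also have "\<dots> \<le> (\<Sum>x\<in>?X. good x)" by (intro sum_mono2) (auto simp: good_def)
  finally have "1 - 1 / q \<le> (\<Sum>x\<in>?X. good x) / 2 ^ (n + R n * B n)" by (simp add: field_simps)
  moreover have "measure_pmf.prob
      (heuristic_experiment (\<lambda>x. map_pmf (answer x) (coins (R (length x) * B (length x)))) n)
      {(x, v). v = Kt U t x} = (\<Sum>x\<in>?X. good x) / 2 ^ (n + R n * B n)"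
    unfolding good_def
    by (rule prob_experiment[where h = answer and F = "\<lambda>x v. v = Kt U t x"]) simp
  ultimately show ?thesis by simp
qed

end

section \<open>Choice of the parameters\<close>

text \<open>At powers of two a polynomial factor becomes a number of bits proportional to
  \<open>lg n\<close>, which can be weighed against \<open>kk n\<close>.\<close>

lemma pol_at_powers:
  assumes "pol f" obtains S where "\<And>j. f (2 ^ j) \<le> 2 ^ (S * Suc j)"
proof -
  obtain a e where ae: "\<And>n. f n \<le> a * Suc n ^ e" by (rule polE[OF assms]) blast
  have "f (2 ^ j) \<le> 2 ^ ((a + e) * Suc j)" for j
  proof -
    have "Suc (2 ^ j) \<le> 2 ^ Suc j" by simp
    from power_mono[OF this, of e] have 1: "Suc (2 ^ j) ^ e \<le> 2 ^ (e * Suc j)"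
      by (simp only: power_mult[symmetric] mult.commute[of e])
    have "a \<le> a * Suc j" by simp
    also have "\<dots> \<le> 2 ^ (a * Suc j)" by (rule less_imp_le[OF less_exp])
    finally have "a * Suc (2 ^ j) ^ e \<le> 2 ^ (a * Suc j) * 2 ^ (e * Suc j)" using 1 by (rule mult_le_mono)
    then show ?thesis using ae[of "2 ^ j"] unfolding add_mult_distrib power_add by linarith
  qed
  then show ?thesis using that by blast
qed

lemma real_poly_bound: "\<exists>a e. \<forall>n. \<bar>poly p (real n)\<bar> \<le> real (a * Suc n ^ e)"
proof (induction p)
  case 0
  then show ?case by auto
next
  case (pCons b p)
  then obtain a e where ae: "\<And>n. \<bar>poly p (real n)\<bar> \<le> real (a * Suc n ^ e)" by blast
  define c where "c = nat \<lceil>\<bar>b\<bar>\<rceil>"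
  have "\<bar>poly (pCons b p) (real n)\<bar> \<le> real ((c + a) * Suc n ^ Suc e)" for n
  proof -
    have "\<bar>poly (pCons b p) (real n)\<bar> \<le> \<bar>b\<bar> + real n * \<bar>poly p (real n)\<bar>"
      using abs_triangle_ineq[of b "real n * poly p (real n)"] by (simp add: abs_mult)
    also have "\<dots> \<le> real c + real (Suc n) * real (a * Suc n ^ e)"
      using ae[of n] unfolding c_def by (intro add_mono mult_mono) (auto simp: real_nat_ceiling_ge)
    also have "\<dots> \<le> real (c * Suc n ^ Suc e) + real (Suc n) * real (a * Suc n ^ e)"
    proof (intro add_right_mono of_nat_mono)
      have "c * 1 \<le> c * Suc n ^ Suc e" by (intro mult_le_mono2 one_le_power) simp
      then show "c \<le> c * Suc n ^ Suc e" by simp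
    qed
    also have "\<dots> = real ((c + a) * Suc n ^ Suc e)" by (simp add: algebra_simps)
    finally show ?thesis .
  qed
  then show ?case by blast
qed

lemma prun_stable:
  assumes "\<And>c. c \<in> set_pmf (prun P T c0) \<Longrightarrow> halted (fst P) c \<and> halted (snd P) c" "T \<le> T'"
  shows "prun P T' c0 = prun P T c0"
proof -
  obtain j where j: "T' = T + j" using assms(2) le_Suc_ex by blast
  have "prun P T' c0 = bind_pmf (prun P T c0) (prun P j)" unfolding j prun_add ..
  also have "\<dots> = bind_pmf (prun P T c0) return_pmf"
  proof (intro bind_pmf_cong refl)
    fix c assume "c \<in> set_pmf (prun P T c0)"
    with assms(1) have "foldl (pstep P) c w = c" for w by (intro halted_foldl) auto
    then have "foldl (pstep P) c = (\<lambda>_. c)" by (rule ext)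
    then show "prun P j c = return_pmf c" by (simp add: prun_eq)
  qed
  finally show ?thesis by (simp add: bind_return_pmf')
qed

text \<open>A halted machine ignores further coins, so any number \<open>Q\<close> beyond the time
  bound yields the same distribution. The search need not know the exact running time.\<close>

lemma PPT_coins:
  assumes "PPT H"
  obtains P m k a e where "tm_shape m k (fst P)" "tm_shape m k (snd P)"
    "\<And>y Q. a * Suc (length y) ^ e \<le> Q \<Longrightarrow>
      H y = map_pmf (\<lambda>w. tape_output (foldl (pstep P) (init_config y) w)) (coins Q)"
proof -
  from assms obtain P q where P: "wf_ptm P" and q: "polynomial_fun q"
    and H: "\<And>x. (\<forall>c\<in>set_pmf (prun P (q (length x)) (init_config x)). halted (fst P) c) \<and>
          H x = map_pmf tape_output (prun P (q (length x)) (init_config x))"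
    unfolding PPT_def by blast
  obtain m k where mk: "tm_shape m k (fst P)" "tm_shape m k (snd P)" using P unfolding wf_ptm_def by blast
  then have len: "length (fst P) = length (snd P)" by (simp add: tm_shape_def)
  obtain a e where ae: "\<And>n. q n \<le> a * Suc n ^ e" by (rule polynomial_fun_bound[OF q]) blast
  have "H y = map_pmf (\<lambda>w. tape_output (foldl (pstep P) (init_config y) w)) (coins Q)"
    if "a * Suc (length y) ^ e \<le> Q" for y Q
  proof -
    have "prun P Q (init_config y) = prun P (q (length y)) (init_config y)"
      using H[of y] len order_trans[OF ae that] by (intro prun_stable) (auto simp: halted_def)
    then have "H y = map_pmf tape_output (prun P Q (init_config y))" using H[of y] by simp
    then show ?thesis unfolding prun_eq pmf.map_comp o_def .
  qed
  with mk that show ?thesis by blast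
qed

context reconstruction
begin

text \<open>The length of a query without padding.\<close>

definition qsize :: "nat \<Rightarrow> nat" where "qsize n = n + kk n * LL n + kk n"

text \<open>For large \<open>n\<close> all queries at scale \<open>n\<close> have length at most
  \<open>(2 * n) ^ 3\<close>, hence \<open>log N \<le> 3 * lg n\<close>. This is the origin of the
  factor 3 in the constants.\<close>

lemma qsize_power_less:
  assumes "C * (c + 3) \<le> j"
  shows "qsize (2 ^ Suc j) \<le> 2 ^ (3 * Suc j)"
proof -
  define X :: nat where "X = 2 ^ Suc j"
  have jX: "Suc (Suc j) \<le> X" unfolding X_def using less_exp[of "Suc j"] by simp
  then have X1: "1 \<le> X" and XC: "1 + C * (c + 3) \<le> X" using assms by auto
  have "qsize X = X + C * Suc (Suc j) * (X + c + 2)"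
    unfolding qsize_def kk_def LL_def X_def lg_power by (simp add: algebra_simps)
  also have "\<dots> \<le> X + C * X * ((c + 3) * X)"
  proof -
    have "(c + 2) * 1 \<le> (c + 2) * X" by (rule mult_le_mono2[OF X1])
    then have "X + c + 2 \<le> (c + 3) * X" by (simp add: algebra_simps)
    then show ?thesis using jX by (intro add_left_mono mult_le_mono) auto
  qed
  also have "\<dots> = X + (C * (c + 3)) * X * X" by (simp add: algebra_simps)
  also have "\<dots> \<le> X * X + (C * (c + 3)) * X * X" using X1 by simp
  also have "\<dots> = (1 + C * (c + 3)) * (X * X)" by (simp add: algebra_simps)
  also have "\<dots> \<le> X * (X * X)" using XC by (rule mult_le_mono1)
  also have "\<dots> = 2 ^ (3 * Suc j)" 
    unfolding X_def mult.commute[of 3] power_mult power3_eq_cube by (simp only: mult.assoc)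
  finally show ?thesis by (simp add: X_def)
qed

end

lemma (in reconstruction_PT) PT_sizes:
  "PT (\<lambda>n. qsize (2 * n))"
  "PT (\<lambda>n. qsize n + qsize (2 * n) + kk n + a * Suc (qsize n + qsize (2 * n)) ^ e)"
  "PT (\<lambda>n. 6 * (a * Suc n ^ e) * (2 * n) ^ C)"
  unfolding qsize_def by (intro PT_intros)+

text \<open>Monotonicity of \<open>s\<close> is avoided by taking the least index with
  \<open>N < s j\<close>; dominating the sum of the first terms pushes this index beyond
  \<open>j0\<close>.\<close>

lemma exists_scale:
  fixes s :: "nat \<Rightarrow> nat"
  assumes "\<And>j. j \<le> s j" "(\<Sum>j\<le>j0. s j) \<le> N"
  obtains j where "j0 \<le> j" "s j \<le> N" "N < s (Suc j)"
proof -
  define i where "i = (LEAST j. N < s j)"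
  have "N < s (Suc N)" using assms(1)[of "Suc N"] by simp
  then have i: "N < s i" unfolding i_def by (rule LeastI)
  have "j0 < i"
  proof (rule ccontr)
    assume "\<not> j0 < i"
    then have "s i \<le> (\<Sum>j\<le>j0. s j)" by (intro member_le_sum) auto
    then show False using i assms(2) by simp
  qed
  then obtain j where j: "i = Suc j" by (cases i) auto
  have "\<not> N < s j" using not_less_Least[of j "\<lambda>j. N < s j"] j unfolding i_def by simp
  then show ?thesis using that[of j] i j \<open>j0 < i\<close> by simp
qed

lemma complement_bound:
  fixes b s x q :: real
  assumes "b + s = x" "1 - 1 / q \<le> s / x" "0 < q" "0 < x"
  shows "b * q \<le> x"
proof -
  have "s / x = 1 - b / x" using assms by (simp add: field_simps)
  then have "b / x \<le> 1 / q" using assms(2) by simp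
  then show ?thesis using assms(3,4) by (simp add: field_simps)
qed

lemma approx_hard_nat:
  fixes dd :: nat
  assumes "universal_tm U" "polynomial_fun t" "mildly_hard_on_average (Kt U t)"
  shows "\<exists>t'. polynomial_fun t' \<and> mildly_hard_on_average_to_approx (\<lambda>n. real dd * log 2 (real n)) (Kt U t')"
proof -
  obtain dec aq eq where "universal U dec aq eq" and "wf_tm U" by (rule universal_tmE[OF assms(1)])
  then interpret universal U dec aq eq by simp
  obtain m k where U: "tm_shape m k U" using \<open>wf_tm U\<close> unfolding wf_tm_def by blast
  obtain p0 where p0: "\<And>n :: nat. 0 < poly p0 (real n)" and hard: "hard_on_average (\<lambda>n. 1 / poly p0 (real n)) (Kt U t)"
    using assms(3) unfolding mildly_hard_on_average_def by blast
  obtain a0 e0 where "\<And>n. \<bar>poly p0 (real n)\<bar> \<le> real (a0 * Suc n ^ e0)" using real_poly_bound[of p0] by blast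
  then have pp: "poly p0 (real n) \<le> real (a0 * Suc n ^ e0)" for n by (meson abs_ge_self order_trans)
  obtain c where copy: "\<And>w T y. tm_result copy_tm w T = Some y \<Longrightarrow> \<exists>desc. length desc \<le> length w + c \<and> univ_outputs U desc T y"
    by (rule machine_desc[OF wf_copy_tm]) blast
  \<comment> \<open>The factor required in the bound on compressible strings costs at most
    \<open>S * lg n\<close> bits.\<close>
  have "pol (\<lambda>n. 12 * (a0 * Suc n ^ e0) * (n + c + 1))" by (intro pol_intros)
  then obtain S where S: "\<And>j. 12 * (a0 * Suc (2 ^ j) ^ e0) * (2 ^ j + c + 1) \<le> 2 ^ (S * Suc j)"
    by (rule pol_at_powers) blast
  \<comment> \<open>In units of \<open>lg n\<close>, a random string loses \<open>S\<close> by its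
    deficiency and \<open>3 * dd\<close> by the approximation; one more unit makes the comparison
    strict, which gives \<open>aa\<close>. A compressible query saves \<open>C\<close> and gives
    back \<open>3 * dd\<close> for the approximation, 1 for the header and 1 for the machine
    constants; what remains must be at least \<open>aa\<close>, and one unit is to spare.\<close>
  define aa where "aa = S + 3 * dd + 1"
  define C where "C = aa + 3 * dd + 3"
  \<comment> \<open>The reconstruction machine determines \<open>t'\<close>, so it is compiled
    before any heuristic is given, over an alphabet that fits \<open>U\<close>.\<close>
  interpret M0: reconstruction_PT "m + k + 2" U t c C aq eq m k
  proof unfold_locales
    interpret alphabet "m + k + 2" by unfold_locales simp
    show "alphabet.PT (m + k + 2) t" by (rule PT_polynomial_fun[OF assms(2)])
  qed (use U in auto)
  have "M0.PT (\<lambda>w. rev (M0.recon (rev w)))"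
    by (intro M0.PT_rev M0.PT_comp[OF M0.PT_recon] M0.PT_id)
  then obtain M q where M: "wf_tm M" "pol q" "\<And>w T. q (length w) \<le> T \<Longrightarrow> tm_result M w T = Some (rev (rev (M0.recon (rev (rev w)))))"
    by (rule M0.PT_tm) blast
  obtain c1 where M_desc: "\<And>w T y. tm_result M w T = Some y \<Longrightarrow> \<exists>desc. length desc \<le> length w + c1 \<and> univ_outputs U desc T y"
    by (rule machine_desc[OF M(1)]) blast
  obtain aT eT where q: "\<And>n. q n \<le> aT * Suc n ^ eT" by (rule polE[OF M(2)]) blast
  \<comment> \<open>The \<open>Suc\<close> makes \<open>t'\<close> at least 1, so that by copying
    every string has a description within \<open>t'\<close>.\<close>
  define t' where "t' n = Suc aT * Suc n ^ eT" for n
  \<comment> \<open>The admissible error of the approximation pays for the density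
    \<open>1 / 2 ^ kk n\<close>, that is for \<open>(2 * n) ^ C\<close>. It is a bound in
    \<open>n\<close>, which \<open>n \<le> N\<close> transfers to the length \<open>N\<close> of the
    queries.\<close>
  have "pol (\<lambda>n. 12 * (a0 * Suc n ^ e0) * (n + c + 1) * (2 * n) ^ C)" by (intro pol_intros)
  then obtain a e' where f: "\<And>n. 12 * (a0 * Suc n ^ e0) * (n + c + 1) * (2 * n) ^ C \<le> a * Suc n ^ e'"
    by (rule polE) blast
  obtain p where p: "\<And>n. real (Suc a * Suc n ^ e') = poly p (real n)"
    using polynomial_fun_pol[of "Suc a" e'] unfolding polynomial_fun_def by blast
  have "hard_on_average_to_approx (\<lambda>n. 1 / poly p (real n)) (\<lambda>n. real dd * log 2 (real n)) (Kt U t')"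
    unfolding hard_on_average_to_approx_def
  proof (intro allI impI, rule ccontr)
    fix H assume "PPT H" and "\<not> (\<forall>\<^sub>F n in sequentially. measure_pmf.prob (heuristic_experiment H n)
          {(x, v). \<bar>real v - real (Kt U t' x)\<bar> \<le> real dd * log 2 (real (length x))} < 1 - 1 / poly p (real n))"
    then have freq: "\<exists>N\<ge>N0. 1 - 1 / poly p (real N) \<le> measure_pmf.prob (heuristic_experiment H N)
          {(x, v). \<bar>real v - real (Kt U t' x)\<bar> \<le> real dd * log 2 (real (length x))}" for N0
      unfolding eventually_sequentially by (meson not_less)
    obtain P m' k' aH eH where P: "tm_shape m' k' (fst P)" "tm_shape m' k' (snd P)"
      and H: "\<And>y Q. aH * Suc (length y) ^ eH \<le> Q \<Longrightarrow>
        H y = map_pmf (\<lambda>w. tape_output (foldl (pstep P) (init_config y) w)) (coins Q)"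
      by (rule PPT_coins[OF \<open>PPT H\<close>]) blast
    \<comment> \<open>The search simulates both \<open>U\<close> and \<open>P\<close>, so its
      alphabet exceeds the states and symbols of each.\<close>
    let ?K = "m + k + m' + k' + 2"
    interpret A0: reconstruction_PT ?K U t c C aq eq m k
    proof unfold_locales
      interpret alphabet ?K by unfold_locales simp
      show "alphabet.PT ?K t" by (rule PT_polynomial_fun[OF assms(2)])
    qed (use U in auto)
    \<comment> \<open>\<open>D\<close> exceeds every padding that reaches a length below
      \<open>qsize (2 * n)\<close>. \<open>B\<close> leaves room for the query, the fresh column and
      enough coins at such lengths. \<open>R\<close> is \<open>6 * q * 2 ^ kk n\<close> with
      \<open>2 ^ kk n\<close> written as \<open>(2 * n) ^ C\<close>.\<close>
    define D where "D n = M0.qsize (2 * n)" for n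
    define B where "B n = M0.qsize n + M0.qsize (2 * n) + M0.kk n + aH * Suc (M0.qsize n + M0.qsize (2 * n)) ^ eH" for n
    define R where "R n = 6 * (a0 * Suc n ^ e0) * (2 * n) ^ C" for n
    interpret attack ?K U t c C aq eq m k P aa "Inf {}" D B R m' k' dec
    proof unfold_locales
      show "A0.PT D" "A0.PT B" "A0.PT R" unfolding D_def[abs_def] B_def[abs_def] R_def[abs_def] by (rule A0.PT_sizes)+
      show "\<exists>desc. length desc \<le> length x + c \<and> univ_outputs U desc T x" if "1 \<le> T" for x T
        using copy[OF copy_tm_result[OF that]] .
    qed (use P in auto)
    have "\<forall>\<^sub>F n in sequentially. measure_pmf.prob
        (heuristic_experiment (\<lambda>x. map_pmf (answer x) (coins (R (length x) * B (length x)))) n)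
        {(x, v). v = Kt U t x} < 1 - 1 / poly p0 (real n)"
      using hard PPT_answer unfolding hard_on_average_def by blast
    then obtain n0 where n0: "\<And>n. n0 \<le> n \<Longrightarrow> measure_pmf.prob
        (heuristic_experiment (\<lambda>x. map_pmf (answer x) (coins (R (length x) * B (length x)))) n)
        {(x, v). v = Kt U t x} < 1 - 1 / poly p0 (real n)"
      unfolding eventually_sequentially by blast
    \<comment> \<open>Ensures \<open>n0 \<le> n\<close>, that \<open>c + 1 + c1\<close> is at most
      \<open>lg n\<close>, and the cubic bound on the length of queries.\<close>
    define j0 where "j0 = n0 + c + 1 + c1 + C * (c + 3)"
    obtain N where N0: "(\<Sum>j\<le>j0. M0.qsize (2 ^ j)) \<le> N" and N: "1 - 1 / poly p (real N) \<le>
        measure_pmf.prob (heuristic_experiment H N)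
          {(x, v). \<bar>real v - real (Kt U t' x)\<bar> \<le> real dd * log 2 (real (length x))}"
      using freq by blast
    have "j \<le> M0.qsize (2 ^ j)" for j
      using less_exp[of j] unfolding M0.qsize_def by linarith
    from exists_scale[of "\<lambda>j. M0.qsize (2 ^ j)", OF this N0] obtain j where
      j: "j0 \<le> j" "M0.qsize (2 ^ j) \<le> N" "N < M0.qsize (2 ^ Suc j)" by blast
    define n :: nat where "n = 2 ^ j"
    define e where "e = N - M0.qsize n"
    define l where "l = Suc j"
    define M' where "M' = M0.kk n * M0.LL n + M0.kk n + e"
    \<comment> \<open>All remaining bits of the block serve as coins of the heuristic.\<close>
    define Q where "Q = B n - M' - M0.kk n"
    define s where "s = S * l"
    have "0 < l" by (simp add: l_def)
    have lg_n: "lg n = l" by (simp add: n_def lg_power l_def)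
    have k_eq: "M0.kk n = C * l" by (simp add: M0.kk_def lg_n)
    have aa_l: "aa * l = S * l + 3 * dd * l + l" by (simp add: aa_def algebra_simps)
    have C_l: "C * l = S * l + 2 * (3 * dd * l) + 4 * l" by (simp add: C_def aa_def algebra_simps)
    have pow: "2 ^ M0.kk n = (2 * n) ^ C" 
    proof -
      have "2 * n = 2 ^ l" by (simp add: n_def l_def)
      then show ?thesis unfolding k_eq by (simp add: power_mult[symmetric] mult.commute)
    qed
    have NM: "n + M' = N" using j(2) unfolding e_def M'_def M0.qsize_def n_def[symmetric] by simp
    have eD: "e < D n" using j(3) unfolding e_def D_def n_def by simp
    have "M' + M0.kk n + aH * Suc N ^ eH \<le> B n"
    proof -
      have "N \<le> M0.qsize n + M0.qsize (2 * n)" using j(2,3) unfolding n_def by simp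
      then have "aH * Suc N ^ eH \<le> aH * Suc (M0.qsize n + M0.qsize (2 * n)) ^ eH"
        by (intro mult_le_mono2 power_mono) auto
      moreover have "M' \<le> M0.qsize n + M0.qsize (2 * n)"
        using eD unfolding M'_def D_def M0.qsize_def by simp
      ultimately show ?thesis unfolding B_def by linarith
    qed
    then have BQ: "B n = M' + M0.kk n + Q" "aH * Suc N ^ eH \<le> Q" unfolding Q_def by auto
    have logN: "log 2 (real N) \<le> 3 * real l"
    proof -
      have "N < 2 ^ (3 * Suc j)"
        using j(1,3) M0.qsize_power_less[of j] unfolding j0_def by linarith
      then have "real N \<le> 2 ^ (3 * l)" unfolding l_def by (metis less_imp_le of_nat_le_iff of_nat_numeral of_nat_power)
      moreover have "0 < (2 :: nat) ^ j" by simp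
      then have "0 < N" using j(2) unfolding M0.qsize_def by linarith
      ultimately have "log 2 (real N) \<le> log 2 (2 ^ (3 * l))" by (subst log_le_cancel_iff) auto
      then show ?thesis by simp
    qed
    then have dlog: "real dd * log 2 (real N) \<le> real (3 * dd * l)"
      using mult_left_mono[OF logN, of "real dd"] by (simp add: mult_ac)
    have thr: "thr x e = n + M0.kk n * M0.LL n + (3 * dd * l + 3 * l) + e" if "length x = n" for x :: "bool list"
    proof -
      have "M0.kk n - aa * lg n = 3 * dd * l + 3 * l"
        unfolding k_eq lg_n aa_l C_l by linarith
      then show ?thesis unfolding thr_def that by simp
    qed
    define Bad where "Bad y v \<longleftrightarrow> \<not> \<bar>real (nat_of_bits (pout y v)) - real (Kt U t' y)\<bar> \<le> real dd * log 2 (real (length y))" for y v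
    \<comment> \<open>At most a fraction \<open>1 / 2 ^ s\<close> of the strings is compressible by
      more than \<open>s\<close> bits, which outweighs the factor
      \<open>12 * q * LL n\<close>.\<close>
    define Comp where "Comp y \<longleftrightarrow> Kt U t' y < N - s" for y
    let ?q = "real (a0 * Suc n ^ e0)"
    have t'1: "1 \<le> t' n" for n unfolding t'_def by (simp add: Suc_leI)
    have "1 - 1 / ?q \<le> measure_pmf.prob
        (heuristic_experiment (\<lambda>x. map_pmf (answer x) (coins (R (length x) * B (length x)))) n)
        {(x, v). v = Kt U t x}"
    proof (rule experiment_bound[where M = M' and e = e and Q = Q and Bad = Bad and Comp = Comp])
      have "0 < ?q" using pp[of n] p0[of n] by linarith
      then have "0 < a0 * Suc n ^ e0" by (simp only: of_nat_0_less_iff)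
      then show "1 \<le> ?q" by linarith
      have "0 < n" by (simp add: n_def)
      then show "0 < R n" using \<open>0 < a0 * Suc n ^ e0\<close> unfolding R_def by simp
      have "R n = 6 * (a0 * Suc n ^ e0) * 2 ^ M0.kk n" unfolding R_def pow ..
      then show "6 * ?q * 2 ^ M0.kk n \<le> R n" by simp
    next
      fix x u v assume x: "length x = n" and u: "length u = M'" and "length v = Q" and "\<not> Bad (x @ u) v" "\<not> Comp (x @ u)"
      then have "\<bar>real (nat_of_bits (pout (x @ u) v)) - real (Kt U t' (x @ u))\<bar> \<le> real (3 * dd * l)"
        "N - s \<le> Kt U t' (x @ u)"
        using dlog NM by (auto simp: Bad_def Comp_def)
      then have "N - s \<le> nat_of_bits (pout (x @ u) v) + 3 * dd * l" by linarith
      moreover have "M0.kk n = s + 2 * (3 * dd * l) + 4 * l" unfolding k_eq C_l s_def ..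
      ultimately show "thr x e < nat_of_bits (pout (x @ u) v)"
        unfolding thr[OF x] using NM \<open>0 < l\<close> unfolding M'_def by linarith
    next
      fix x p z pad v :: "bool list"
      assume x: "length x = n" and p: "univ_outputs U p (t n) x" "length p < M0.LL n" and z: "length z = M0.kk n * M0.LL n"
        and pad: "length pad = e" and "length v = Q"
      let ?y = "x @ z @ hash (M0.kk n) z (padw (M0.LL n) p) (replicate (M0.kk n) False) @ pad"
      \<comment> \<open>The header for \<open>n\<close>, the padded description, the columns and the
        padding. The hash is left out, since it is recomputed; this saves \<open>kk n\<close>
        bits.\<close>
      let ?w = "replicate j True @ False # padw (M0.LL n) p @ z @ pad"
      assume "\<not> Bad ?y v"
      have "length (hash (M0.kk n) z (padw (M0.LL n) p) (replicate (M0.kk n) False)) = M0.kk n"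
        using z length_padw[OF p(2)] by (intro length_hash) auto
      then have ly: "length ?y = N" using x z pad NM by (simp add: M'_def)
      have "M0.uout n p = True # x" using p by (simp add: uout_iff)
      then have y: "M0.recon ?w = ?y"
        using M0.recon_eq[of "padw (M0.LL n) p" j z pad] length_padw[OF p(2)] z unfolding n_def by (simp add: strip_padw)
      have lw: "length ?w = l + M0.LL n + M0.kk n * M0.LL n + e"
        using length_padw[OF p(2)] z pad by (simp add: l_def)
      have cl: "c + 1 + c1 \<le> l" using j(1) unfolding j0_def l_def by simp
      have kl: "M0.kk n = S * l + 2 * (3 * dd * l) + 4 * l" unfolding k_eq C_l ..
      \<comment> \<open>Hence \<open>t' N\<close>, which depends only on the length of the output,
        covers the running time on \<open>?w\<close>.\<close>
      have "length ?w \<le> N" unfolding lw using NM cl kl unfolding M'_def M0.LL_def by linarith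
      then have "aT * Suc (length ?w) ^ eT \<le> Suc aT * Suc N ^ eT" by (intro mult_le_mono power_mono) auto
      then have "q (length ?w) \<le> t' N" using q[of "length ?w"] unfolding t'_def by linarith
      from M(3)[OF this] y have "tm_result M ?w (t' N) = Some ?y" by simp
      from M_desc[OF this] obtain d where d: "length d \<le> length ?w + c1" "univ_outputs U d (t' N) ?y" by blast
      have "Kt U t' ?y \<le> length d" by (rule Kt_le) (use d(2) ly in simp)
      moreover have "\<bar>real (nat_of_bits (pout ?y v)) - real (Kt U t' ?y)\<bar> \<le> real (3 * dd * l)"
        using \<open>\<not> Bad ?y v\<close> dlog unfolding Bad_def ly by linarith
      ultimately have "nat_of_bits (pout ?y v) \<le> l + M0.LL n + M0.kk n * M0.LL n + e + c1 + 3 * dd * l"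
        using d(1) unfolding lw by linarith
      then show "nat_of_bits (pout ?y v) \<le> thr x e" unfolding thr[OF x] using cl unfolding M0.LL_def by linarith
    next
      have f': "12 * (a0 * Suc n ^ e0) * M0.LL n * 2 ^ M0.kk n \<le> Suc a * Suc N ^ e'"
      proof -
        have "12 * (a0 * Suc n ^ e0) * M0.LL n * 2 ^ M0.kk n \<le> a * Suc n ^ e'" unfolding pow M0.LL_def by (rule f)
        also have "\<dots> \<le> Suc a * Suc N ^ e'" using NM by (intro mult_le_mono power_mono) auto
        finally show ?thesis .
      qed
      let ?G = "\<lambda>y v. \<bar>real v - real (Kt U t' y)\<bar> \<le> real dd * log 2 (real (length y))"
      let ?S = "\<Sum>y\<in>{y. length y = N}. real (card {w. length w = Q \<and> ?G y (nat_of_bits (pout y w))})"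
      let ?b = "card {(y, v). length y = N \<and> length v = Q \<and> Bad y v}"
      have Hc: "H y = map_pmf (pout y) (coins Q)" if "length y = N" for y
        using H[of y Q] BQ(2) that unfolding pout_def by simp
      have "1 - 1 / poly p (real N) \<le> ?S / 2 ^ (N + Q)"
        by (rule ord_le_eq_trans[OF N prob_experiment[of N H pout Q ?G, OF Hc]])
      moreover have "real ?b + ?S = 2 ^ (N + Q)"
      proof -
        have "real ?b + ?S = (\<Sum>y\<in>{y. length y = N}. real (card {v. length v = Q \<and> ?G y (nat_of_bits (pout y v))}) +
            real (card {v. length v = Q \<and> \<not> ?G y (nat_of_bits (pout y v))}))"
          unfolding sum_card_pairs Bad_def by (simp add: sum.distrib)
        also have "\<dots> = (\<Sum>y\<in>{y :: bool list. length y = N}. 2 ^ Q)" unfolding real_card_sub_bitstrings ..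
        finally show ?thesis by (simp add: power_add)
      qed
      moreover have pN: "0 < poly p (real N)" unfolding p[symmetric] of_nat_0_less_iff by simp
      ultimately have "real ?b * poly p (real N) \<le> 2 ^ (N + Q)" by (intro complement_bound[of _ ?S]) simp_all
      moreover have "12 * ?q * M0.LL n * 2 ^ M0.kk n = real (12 * (a0 * Suc n ^ e0) * M0.LL n * 2 ^ M0.kk n)" by simp
      then have "12 * ?q * M0.LL n * 2 ^ M0.kk n \<le> poly p (real N)"
        unfolding p[symmetric] by (rule ord_eq_le_trans) (rule of_nat_mono[OF f'])
      then have "12 * ?q * M0.LL n * 2 ^ M0.kk n * real ?b \<le> poly p (real N) * real ?b" by (rule mult_right_mono) simp
      ultimately show "12 * ?q * M0.LL n * 2 ^ M0.kk n * card {(y, v). length y = n + M' \<and> length v = Q \<and> Bad y v} \<le> 2 ^ (n + M' + Q)"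
        unfolding NM by (simp add: mult.commute)
      \<comment> \<open>Needed for the count of compressible strings, where a string without
        description would have the junk value.\<close>
      have "\<exists>desc. univ_outputs U desc (t' N) y" for y
        using copy[OF t'1] by blast
      then have "card {y. length y = N \<and> Comp y} \<le> 2 ^ (N - s)"
        unfolding Comp_def by (rule card_compressible)
      moreover have "12 * (a0 * Suc n ^ e0) * M0.LL n \<le> 2 ^ s"
        using S[of j] unfolding s_def l_def n_def M0.LL_def by simp
      ultimately have "12 * (a0 * Suc n ^ e0) * M0.LL n * card {y. length y = N \<and> Comp y} \<le> 2 ^ s * 2 ^ (N - s)"
        by (intro mult_le_mono)
      also have "\<dots> = 2 ^ N"
      proof -
        have "s \<le> M0.kk n" unfolding s_def k_eq C_l by simp
        then have "s \<le> N" using NM unfolding M'_def by linarith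
        then show ?thesis by (simp flip: power_add)
      qed
      finally have "real (12 * (a0 * Suc n ^ e0) * M0.LL n * card {y. length y = N \<and> Comp y}) \<le> real (2 ^ N)"
        by (rule of_nat_mono)
      then show "12 * ?q * M0.LL n * card {y. length y = n + M' \<and> Comp y} \<le> 2 ^ (n + M')"
        unfolding NM by simp
    qed (use BQ eD in \<open>simp_all add: M'_def\<close>)
    moreover have "n0 \<le> n" using j(1) less_exp[of j] unfolding j0_def n_def by linarith
    from n0[OF this] have "measure_pmf.prob
        (heuristic_experiment (\<lambda>x. map_pmf (answer x) (coins (R (length x) * B (length x)))) n)
        {(x, v). v = Kt U t x} < 1 - 1 / poly p0 (real n)" .
    moreover have "1 / ?q \<le> 1 / poly p0 (real n)" using pp[of n] p0[of n] by (intro divide_left_mono) auto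
    ultimately show False by linarith
  qed
  moreover have "0 < poly p (real n)" for n :: nat unfolding p[symmetric] of_nat_0_less_iff by simp
  moreover have "polynomial_fun t'" unfolding t'_def[abs_def] by (rule polynomial_fun_pol)
  ultimately show ?thesis unfolding mildly_hard_on_average_to_approx_def by blast
qed

theorem theorem1p2:
  fixes U :: tm
  assumes "universal_tm U"
    and "\<exists>t. polynomial_fun t \<and> mildly_hard_on_average (Kt U t)"
  shows "\<forall>d::real. \<exists>t'. polynomial_fun t' \<and>
           mildly_hard_on_average_to_approx (\<lambda>n. d * log 2 (real n)) (Kt U t')"
proof
  fix d :: real
  \<comment> \<open>Hardness for a larger tolerance implies hardness for a smaller one, so
    \<open>d\<close> may be rounded up; a negative \<open>d\<close> becomes 0.\<close>
  define dd where "dd = nat \<lceil>d\<rceil>"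
  obtain t where "polynomial_fun t" "mildly_hard_on_average (Kt U t)" using assms(2) by blast
  from approx_hard_nat[OF assms(1) this, of dd] obtain t' p where t': "polynomial_fun t'"
    and p: "\<And>n :: nat. 0 < poly p (real n)"
    and hard: "hard_on_average_to_approx (\<lambda>n. 1 / poly p (real n)) (\<lambda>n. real dd * log 2 (real n)) (Kt U t')"
    unfolding mildly_hard_on_average_to_approx_def by blast
  have "hard_on_average_to_approx (\<lambda>n. 1 / poly p (real n)) (\<lambda>n. d * log 2 (real n)) (Kt U t')"
    unfolding hard_on_average_to_approx_def
  proof (intro allI impI)
    fix H assume "PPT H"
    have "\<forall>\<^sub>F n in sequentially. measure_pmf.prob (heuristic_experiment H n)
        {(x, v). \<bar>real v - real (Kt U t' x)\<bar> \<le> real dd * log 2 (real (length x))} < 1 - 1 / poly p (real n)"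
      using hard \<open>PPT H\<close> unfolding hard_on_average_to_approx_def by blast
    then show "\<forall>\<^sub>F n in sequentially. measure_pmf.prob (heuristic_experiment H n)
        {(x, v). \<bar>real v - real (Kt U t' x)\<bar> \<le> d * log 2 (real (length x))} < 1 - 1 / poly p (real n)"
    proof (rule eventually_mono)
      fix n
      \<comment> \<open>At length 0 the logarithm is 0 by convention, so both tolerances vanish
        there.\<close>
      have "d * log 2 (real l) \<le> real dd * log 2 (real l)" for l
      proof (cases "l = 0")
        case False
        then show ?thesis unfolding dd_def by (intro mult_right_mono real_nat_ceiling_ge) simp
      qed (simp add: log_def)
      then have "measure_pmf.prob (heuristic_experiment H n)
          {(x, v). \<bar>real v - real (Kt U t' x)\<bar> \<le> d * log 2 (real (length x))} \<le>
        measure_pmf.prob (heuristic_experiment H n)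
          {(x, v). \<bar>real v - real (Kt U t' x)\<bar> \<le> real dd * log 2 (real (length x))}"
        by (intro measure_pmf.finite_measure_mono) (auto intro: order_trans)
      then show "measure_pmf.prob (heuristic_experiment H n)
          {(x, v). \<bar>real v - real (Kt U t' x)\<bar> \<le> real dd * log 2 (real (length x))} < 1 - 1 / poly p (real n) \<Longrightarrow>
        measure_pmf.prob (heuristic_experiment H n)
          {(x, v). \<bar>real v - real (Kt U t' x)\<bar> \<le> d * log 2 (real (length x))} < 1 - 1 / poly p (real n)"
        by linarith
    qed
  qed
  with t' p show "\<exists>t'. polynomial_fun t' \<and>
      mildly_hard_on_average_to_approx (\<lambda>n. d * log 2 (real n)) (Kt U t')"
    unfolding mildly_hard_on_average_to_approx_def by blast
qed

end
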